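(* Suppose the Boundedness, Demand-shock and (enlarged) Link-function assumptions stated in the context hold and $T\ge6$. Then for any sequence of covariates $x_1,\dots,x_T\in\mathcal X$, the regret $\mathrm{Reg}_T^{\pi}(x_1,\dots,x_T)$ of the Thompson sampling pricing algorithm (described in the context) run with regularization parameter $\lambda=1$ is at most $$36\,\bar g\,\bar p\,\bar\gamma\sqrt{2e\pi\, dT\log\left(\frac{2d+T}{2d}\right)\log(4T^2)}+2\bar D\bar p=\tilde O(d\sqrt T),$$ where $\bar\gamma=2\bar\theta+\frac{2\bar\sigma}{\underline g}\sqrt{2\log T+2d\log\left(\frac{2d+T}{2d}\right)}$ and $\tilde O$ hides logarithmic factors.
   Context: Model. For $t=1,\dots,T$ the seller observes $x_t\in\mathcal X\subset\mathbb R^d$, sets a price $p_t\in[\underline p,\bar p]$ with $0\le\underline p\le\bar p$, and observes the demand $D_t=g(x_t^\top\alpha^*+x_t^\top\beta^*\cdot p_t)+\epsilon_t$. Here $g:\mathbb R\to\mathbb R$ is known and $\theta^*=(\alpha^*,\beta^* )\in\mathbb R^{2d}$ is unknown. Put $z_t=(x_t,p_tx_t)\in\mathbb R^{2d}$. Boundedness. $\theta^*\in\Theta:=\{\theta\in\mathbb R^{2d}:\|\theta\|_2\le\bar\theta\}$ for some $\bar\theta>0$; $0\le g(x^\top\alpha^*+x^\top\beta^*p)\le\bar D$ and $\|(x,px)\|_2\le1$ for all $x\in\mathcal X$, $p\in[\underline p,\bar p]$. Enlarged link-function assumption. Let $\tilde\Theta$ be the set of $\theta\in\mathbb R^{2d}$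 such that $\|\theta-\tilde\theta\|_2\le4\bar\theta\sqrt{\log(4T^2)}+\frac{4\bar\sigma}{\underline g}\sqrt{(2\log T+2d\log(\frac{2d+T}{2d}))\log(4T^2)}$ for some $\tilde\theta\in\Theta$. $g$ is strictly increasing and differentiable, and $0<\underline g\le g'(z)\le\bar g<\infty$ for all $z=x^\top\alpha+x^\top\beta p$ with $x\in\mathcal X$, $(\alpha,\beta)\in\tilde\Theta$, $p\in[\underline p,\bar p]$. Demand shock. With $\mathcal H_t=\sigma(p_1,\dots,p_t,\epsilon_1,\dots,\epsilon_t,x_1,\dots,x_{t+1})$ and $\mathcal H_0$ trivial, $\mathbb E[\epsilon_t|\mathcal H_{t-1}]=0$ and $\log\mathbb E[e^{s\epsilon_t}|\mathcal H_{t-1}]\le\bar\sigma^2s^2/2$ for all $s\in\mathbb R$ and all $t$; $\bar\sigma$ is known. The algorithm's randomization $\eta_t$ is independent of the past and of the shocks. Revenue and regret. $r(p;a,b)=p\,g(a+bp)$ and $r^*(a,b)=\max_{p\in[\underline p,\bar p]}r(p;a,b)$; maximizers are assumed computable. For a non-anticipating policy $\pi$ producing prices $p_t$, $\mathrm{Reg}_T^\pi(x_1,\dots,x_T)=\sum_{t=1}^T r^*(x_t^\top\alpha^*,x_t^\top\beta^* )-\mathbb E[\sum_{t=1}^T p_tD_t]$, with expectation over the shocks and the policy's randomness. Estimator. $M_t=\lambda I_{2d}+\sum_{s=1}^tz_sz_s^\top$. The quasi-likelihood is $l_t(\theta)=-\int_{D_t}^{g(z_t^\top\theta)}\frac{u-D_t}{h(u)}du$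 with $h(u)=g'(g^{-1}(u))$ (up to a constant not depending on $\theta$, $l_t$ is the function with gradient $(D_t-g(z_t^\top\theta))z_t$). The estimator is $\hat\theta_t=(\hat\alpha_t,\hat\beta_t)=\arg\max_{\theta\in\Theta}\{-\frac{\lambda\underline g}{2}\|\theta\|_2^2+\sum_{s=1}^tl_s(\theta)\}$. Thompson sampling pricing algorithm. At each $t$: compute $\hat\theta_{t-1}$, observe $x_t$, and set $(\hat a_t,\hat b_t)=(x_t^\top\hat\alpha_{t-1},x_t^\top\hat\beta_{t-1})$. Let $\tilde M_{t-1}=(X_t^\top M_{t-1}^{-1}X_t)^{-1}$ where $X_t=\begin{pmatrix}x_t&\mathbf 0\\ \mathbf 0&x_t\end{pmatrix}\in\mathbb R^{2d\times2}$, so $\tilde M_{t-1}^{-1/2}$ is the symmetric positive semidefinite square root of $X_t^\top M_{t-1}^{-1}X_t$. Draw $\eta_t\sim\mathcal N(0,I_2)$ and set $(\tilde a_t,\tilde b_t)=(\hat a_t,\hat b_t)+\big(2\sqrt\lambda\bar\theta+\frac{2\bar\sigma}{\underline g}\sqrt{2\log T+2d\log(\frac{2d\lambda+T}{2d\lambda})}\big)\tilde M_{t-1}^{-1/2}\eta_t$. Set $p_t\in\arg\max_{p\in[\underline p,\bar p]}r(p;\tilde a_t,\tilde b_t)$ and observe $D_t$. *)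

theory Defs
  imports "HOL-Probability.Probability"
begin

section \<open>Vectors in dimension 2d\<close>

text \<open>
  Covariates live in \<open>real^'n\<close> with d = CARD('n); a parameter (alpha, beta) is a vector indexed by
  \<open>'n + 'n\<close>, so that its norm is the Euclidean norm of dimension 2d.
\<close>

definition stack :: "real^'n \<Rightarrow> real^'n \<Rightarrow> real^('n + 'n)" where
  "stack a b = (\<chi> i. case i of Inl j \<Rightarrow> a $ j | Inr j \<Rightarrow> b $ j)"

definition upper :: "real^('n + 'n) \<Rightarrow> real^'n" where
  "upper \<theta> = (\<chi> j. \<theta> $ Inl j)"

definition lower :: "real^('n + 'n) \<Rightarrow> real^'n" where
  "lower \<theta> = (\<chi> j. \<theta> $ Inr j)"

definition regressor :: "real^'n \<Rightarrow> real \<Rightarrow> real^('n + 'n)" where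
  "regressor x p = stack x (p *\<^sub>R x)"

definition block_covariate :: "real^'n \<Rightarrow> real^2^('n + 'n)" where
  "block_covariate x = (\<chi> i k. case i of
      Inl j \<Rightarrow> (if k = 1 then x $ j else 0)
    | Inr j \<Rightarrow> (if k = 2 then x $ j else 0))"

definition psd_sqrt :: "real^'k^'k \<Rightarrow> real^'k^'k" where
  "psd_sqrt A = (THE S. transpose S = S \<and> (\<forall>v. 0 \<le> v \<bullet> (S *v v)) \<and> S ** S = A)"


section \<open>Revenue, demand and regret\<close>

definition revenue :: "(real \<Rightarrow> real) \<Rightarrow> real \<Rightarrow> real \<Rightarrow> real \<Rightarrow> real" where
  "revenue g a b p = p * g (a + b * p)"

text \<open>The supremum is a maximum whenever \<open>g\<close> is continuous and \<open>pmin \<le> pmax\<close>.\<close>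

definition opt_revenue :: "(real \<Rightarrow> real) \<Rightarrow> real \<Rightarrow> real \<Rightarrow> real \<Rightarrow> real \<Rightarrow> real" where
  "opt_revenue g pmin pmax a b = (SUP p\<in>{pmin..pmax}. revenue g a b p)"

definition demand ::
  "(real \<Rightarrow> real) \<Rightarrow> real^'n \<Rightarrow> real^'n \<Rightarrow> (nat \<Rightarrow> real^'n) \<Rightarrow> (nat \<Rightarrow> 'w \<Rightarrow> real) \<Rightarrow>
   (nat \<Rightarrow> 'w \<Rightarrow> real) \<Rightarrow> nat \<Rightarrow> 'w \<Rightarrow> real" where
  "demand g \<alpha> \<beta> x p \<epsilon> t \<omega> = g (x t \<bullet> \<alpha> + (x t \<bullet> \<beta>) * p t \<omega>) + \<epsilon> t \<omega>"

definition regret ::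
  "'w measure \<Rightarrow> (real \<Rightarrow> real) \<Rightarrow> real \<Rightarrow> real \<Rightarrow> real^'n \<Rightarrow> real^'n \<Rightarrow> (nat \<Rightarrow> real^'n) \<Rightarrow>
   (nat \<Rightarrow> 'w \<Rightarrow> real) \<Rightarrow> (nat \<Rightarrow> 'w \<Rightarrow> real) \<Rightarrow> nat \<Rightarrow> real" where
  "regret M g pmin pmax \<alpha> \<beta> x p \<epsilon> T =
     (\<Sum>t=1..T. opt_revenue g pmin pmax (x t \<bullet> \<alpha>) (x t \<bullet> \<beta>))
     - (\<integral>\<omega>. (\<Sum>t=1..T. p t \<omega> * demand g \<alpha> \<beta> x p \<epsilon> t \<omega>) \<partial>M)"


section \<open>Information\<close>

text \<open>
  The covariates form a fixed deterministic sequence, hence generate only the trivial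
  sigma-algebra and do not appear among the generators.
\<close>

definition shock_history ::
  "'w measure \<Rightarrow> (nat \<Rightarrow> 'w \<Rightarrow> real) \<Rightarrow> (nat \<Rightarrow> 'w \<Rightarrow> real) \<Rightarrow> nat \<Rightarrow> 'w measure" where
  "shock_history M p \<epsilon> t =
     vimage_algebra (space M) (\<lambda>\<omega>. \<lambda>s\<in>{1..t}. (p s \<omega>, \<epsilon> s \<omega>)) (\<Pi>\<^sub>M s\<in>{1..t}. borel)"

text \<open>What the price of period \<open>t\<close> may depend on: the past together with the draws up to \<open>t\<close>.\<close>

definition price_info ::
  "'w measure \<Rightarrow> (nat \<Rightarrow> 'w \<Rightarrow> real) \<Rightarrow> (nat \<Rightarrow> 'w \<Rightarrow> real) \<Rightarrow> (nat \<Rightarrow> 'w \<Rightarrow> real^2) \<Rightarrow> nat \<Rightarrow>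
   'w measure" where
  "price_info M p \<epsilon> \<eta> t =
     vimage_algebra (space M)
       (\<lambda>\<omega>. ((\<lambda>s\<in>{1..<t}. (p s \<omega>, \<epsilon> s \<omega>)), (\<lambda>s\<in>{1..t}. \<eta> s \<omega>)))
       ((\<Pi>\<^sub>M s\<in>{1..<t}. borel) \<Otimes>\<^sub>M (\<Pi>\<^sub>M s\<in>{1..t}. borel))"

definition shock_assumption ::
  "'w measure \<Rightarrow> real \<Rightarrow> (nat \<Rightarrow> 'w \<Rightarrow> real) \<Rightarrow> (nat \<Rightarrow> 'w \<Rightarrow> real) \<Rightarrow> nat \<Rightarrow> bool" where
  "shock_assumption M \<sigma> p \<epsilon> T \<longleftrightarrow>
     (\<forall>t\<in>{1..T}.
        integrable M (\<epsilon> t) \<and>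
        (AE \<omega> in M. real_cond_exp M (shock_history M p \<epsilon> (t - 1)) (\<epsilon> t) \<omega> = 0) \<and>
        (\<forall>s. integrable M (\<lambda>\<omega>. exp (s * \<epsilon> t \<omega>)) \<and>
             (AE \<omega> in M. ln (real_cond_exp M (shock_history M p \<epsilon> (t - 1))
                                (\<lambda>\<omega>. exp (s * \<epsilon> t \<omega>)) \<omega>) \<le> \<sigma>\<^sup>2 * s\<^sup>2 / 2)))"

text \<open>
  The draw of period \<open>t\<close> is standard Gaussian on the plane, independent of all earlier prices and
  draws jointly with the whole shock sequence.
\<close>

definition randomization ::
  "'w measure \<Rightarrow> (nat \<Rightarrow> 'w \<Rightarrow> real) \<Rightarrow> (nat \<Rightarrow> 'w \<Rightarrow> real) \<Rightarrow> (nat \<Rightarrow> 'w \<Rightarrow> real^2) \<Rightarrow> nat \<Rightarrow> bool"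
  where
  "randomization M p \<epsilon> \<eta> T \<longleftrightarrow>
     (\<forall>t\<in>{1..T}.
        distributed M lborel (\<eta> t) (\<lambda>v. ennreal (\<Prod>i\<in>UNIV. std_normal_density (v $ i))) \<and>
        prob_space.indep_set M
          (sets (vimage_algebra (space M) (\<eta> t) borel))
          (sets (vimage_algebra (space M)
            (\<lambda>\<omega>. ((\<lambda>s\<in>{1..<t}. (p s \<omega>, \<eta> s \<omega>)), (\<lambda>s\<in>{1..T}. \<epsilon> s \<omega>)))
            ((\<Pi>\<^sub>M s\<in>{1..<t}. borel) \<Otimes>\<^sub>M (\<Pi>\<^sub>M s\<in>{1..T}. borel)))))"


section \<open>Estimator\<close>

text \<open>
  The quasi-likelihood is the integral of \<open>- (u - D) / h u\<close> with \<open>h u = g' (g^-1 u)\<close> up to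
  \<open>g (z \<bullet> \<theta>)\<close>. The usual lower limit \<open>D\<close> only contributes a constant independent of \<open>\<theta>\<close>, but a
  noisy demand may lie outside the range of \<open>g\<close>, where \<open>h\<close> is undefined; the lower limit is
  therefore normalised to \<open>g 0\<close>, the value at \<open>\<theta> = 0\<close>.
\<close>

definition quasi_lik :: "(real \<Rightarrow> real) \<Rightarrow> 'a::real_inner \<Rightarrow> real \<Rightarrow> 'a \<Rightarrow> real" where
  "quasi_lik g z D \<theta> =
     - (LBINT u = ereal (g 0)..ereal (g (z \<bullet> \<theta>)). (u - D) / deriv g (inv g u))"

text \<open>In the following \<open>q\<close> and \<open>D\<close> are realised price and demand sequences.\<close>

definition qmle ::
  "(real \<Rightarrow> real) \<Rightarrow> real \<Rightarrow> real \<Rightarrow> real \<Rightarrow> (nat \<Rightarrow> real^'n) \<Rightarrow> (nat \<Rightarrow> real) \<Rightarrow> (nat \<Rightarrow> real) \<Rightarrow>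
   nat \<Rightarrow> real^('n + 'n)" where
  "qmle g gmin \<theta>max lam x q D t =
     arg_max_on
       (\<lambda>\<theta>. - (lam * gmin / 2) * (norm \<theta>)\<^sup>2
            + (\<Sum>s=1..t. quasi_lik g (regressor (x s) (q s)) (D s) \<theta>))
       (cball 0 \<theta>max)"

definition design_matrix ::
  "real \<Rightarrow> (nat \<Rightarrow> real^'n) \<Rightarrow> (nat \<Rightarrow> real) \<Rightarrow> nat \<Rightarrow> real^('n + 'n)^('n + 'n)" where
  "design_matrix lam x q t =
     lam *\<^sub>R mat 1 + (\<Sum>s=1..t. (\<chi> i j. regressor (x s) (q s) $ i * regressor (x s) (q s) $ j))"


section \<open>Thompson sampling\<close>

definition ts_scale :: "real \<Rightarrow> real \<Rightarrow> real \<Rightarrow> real \<Rightarrow> nat \<Rightarrow> nat \<Rightarrow> real" where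
  "ts_scale gmin \<theta>max \<sigma> lam d T =
     2 * sqrt lam * \<theta>max
     + 2 * \<sigma> / gmin * sqrt (2 * ln (real T)
         + 2 * real d * ln ((2 * real d * lam + real T) / (2 * real d * lam)))"

text \<open>
  The sampled pair for period \<open>t\<close>, given the draw \<open>e\<close>. The matrix
  \<open>transpose X ** matrix_inv M ** X\<close> is used directly instead of the inverse of its inverse, so that
  it also makes sense for \<open>x t = 0\<close>.
\<close>

definition ts_sample ::
  "(real \<Rightarrow> real) \<Rightarrow> real \<Rightarrow> real \<Rightarrow> real \<Rightarrow> real \<Rightarrow> nat \<Rightarrow> (nat \<Rightarrow> real^'n) \<Rightarrow> (nat \<Rightarrow> real) \<Rightarrow>
   (nat \<Rightarrow> real) \<Rightarrow> nat \<Rightarrow> real^2 \<Rightarrow> real^2" where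
  "ts_sample g gmin \<theta>max \<sigma> lam T x q D t e =
     (let \<theta>hat = qmle g gmin \<theta>max lam x q D (t - 1);
          X = block_covariate (x t)
      in vector [x t \<bullet> upper \<theta>hat, x t \<bullet> lower \<theta>hat]
         + ts_scale gmin \<theta>max \<sigma> lam CARD('n) T *\<^sub>R
           (psd_sqrt (transpose X ** matrix_inv (design_matrix lam x q (t - 1)) ** X) *v e))"

definition ts_policy ::
  "'w measure \<Rightarrow> (real \<Rightarrow> real) \<Rightarrow> real \<Rightarrow> real \<Rightarrow> real \<Rightarrow> real \<Rightarrow> real \<Rightarrow> real \<Rightarrow> nat \<Rightarrow> real^'n \<Rightarrow>
   real^'n \<Rightarrow> (nat \<Rightarrow> real^'n) \<Rightarrow> (nat \<Rightarrow> 'w \<Rightarrow> real) \<Rightarrow> (nat \<Rightarrow> 'w \<Rightarrow> real) \<Rightarrow> (nat \<Rightarrow> 'w \<Rightarrow> real^2) \<Rightarrow>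
   bool" where
  "ts_policy M g gmin \<theta>max \<sigma> pmin pmax lam T \<alpha> \<beta> x p \<epsilon> \<eta> \<longleftrightarrow>
     (\<forall>t\<in>{1..T}.
        p t \<in> borel_measurable (price_info M p \<epsilon> \<eta> t) \<and>
        (\<forall>\<omega>\<in>space M.
           let ab = ts_sample g gmin \<theta>max \<sigma> lam T x (\<lambda>s. p s \<omega>)
                      (\<lambda>s. demand g \<alpha> \<beta> x p \<epsilon> s \<omega>) t (\<eta> t \<omega>)
           in is_arg_max (revenue g (ab $ 1) (ab $ 2)) (\<lambda>q. q \<in> {pmin..pmax}) (p t \<omega>)))"


section \<open>Parameter sets and bounds\<close>

definition enlarged_params ::
  "real \<Rightarrow> real \<Rightarrow> real \<Rightarrow> nat \<Rightarrow> (real^('n::finite + 'n)) set" where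
  "enlarged_params gmin \<theta>max \<sigma> T =
     {\<theta>. \<exists>\<theta>'\<in>cball 0 \<theta>max. norm (\<theta> - \<theta>') \<le>
        4 * \<theta>max * sqrt (ln (4 * (real T)\<^sup>2))
        + 4 * \<sigma> / gmin * sqrt ((2 * ln (real T)
            + 2 * real CARD('n) * ln ((2 * real CARD('n) + real T) / (2 * real CARD('n))))
            * ln (4 * (real T)\<^sup>2))}"

definition gamma_bar :: "real \<Rightarrow> real \<Rightarrow> real \<Rightarrow> nat \<Rightarrow> nat \<Rightarrow> real" where
  "gamma_bar gmin \<theta>max \<sigma> d T =
     2 * \<theta>max
     + 2 * \<sigma> / gmin * sqrt (2 * ln (real T)
         + 2 * real d * ln ((2 * real d + real T) / (2 * real d)))"

definition ts_bound ::
  "real \<Rightarrow> real \<Rightarrow> real \<Rightarrow> real \<Rightarrow> real \<Rightarrow> real \<Rightarrow> nat \<Rightarrow> nat \<Rightarrow> real" where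
  "ts_bound gmin gmax \<theta>max \<sigma> pmax Dmax d T =
     36 * gmax * pmax * gamma_bar gmin \<theta>max \<sigma> d T
       * sqrt (2 * exp 1 * pi * real d * real T
               * ln ((2 * real d + real T) / (2 * real d)) * ln (4 * (real T)\<^sup>2))
     + 2 * Dmax * pmax"

text \<open>
  Big-O up to powers of \<open>ln T\<close>, uniformly in the dimension \<open>d \<ge> 1\<close> and the horizon \<open>T \<ge> 6\<close>.
\<close>

definition soft_O :: "(nat \<Rightarrow> nat \<Rightarrow> real) \<Rightarrow> (nat \<Rightarrow> nat \<Rightarrow> real) \<Rightarrow> bool" where
  "soft_O f h \<longleftrightarrow>
     (\<exists>C k. \<forall>d\<ge>1. \<forall>T\<ge>6. \<bar>f d T\<bar> \<le> C * \<bar>h d T\<bar> * ln (real T) ^ k)"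

end

theory Submission
  imports Defs
begin

text \<open>
  Determinants are replaced throughout by the Gaussian integrals \<open>Z M\<close> of \<open>exp (- w \<bullet> M w / 2)\<close>.
  Writing \<open>exp (y\<^sup>2 / 2)\<close> as a Gaussian average of \<open>exp (\<xi> y)\<close> and translating, one gets
  \<open>Z M = sqrt (1 + z \<bullet> inverse M z) * Z (M + z z\<^sup>T)\<close>; comparing the integrand with that of \<open>c I\<close>,
  \<open>c = 1 + T / 2d\<close>, via \<open>1 + y \<le> exp y\<close> gives \<open>Z I \<le> sqrt c ^ (2d) * Z M\<close> whenever \<open>M\<close> is \<open>I\<close> plus at most
  \<open>T\<close> rank-one terms of norm at most 1. The two facts bound the sum of the squared widths
  \<open>z \<bullet> inverse M z\<close> along the play by \<open>4 d ln c\<close>. The second one, combined with integrating the exponential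
  supermartingale of the shocks against a Gaussian in \<open>w\<close> and Markov's inequality, yields at each
  fixed time, with probability \<open>1 - 1 / T\<close>, that the noise is small in the norm of \<open>inverse M\<close>. The
  first-order condition of the estimator turns this into an error of at most \<open>\<gamma> / 2\<close> in the norm of \<open>M\<close>.

  Given the history, the sampled revenue curve dominates the true optimum with probability at least
  1/20. Exchanging the draw for an independent copy that is optimistic bounds the loss of the period by
  widths at the price played and at the price the copy would play; the latter has the same conditional law as the
  former, so averaging over the optimistic copies costs a factor 20. No confidence statement uniform in time is
  needed: an exceptional event of probability \<open>1 / T + 1 / T\<^sup>2\<close> per period contributes the term
  \<open>2 Dmax pmax\<close>.
\<close>

section \<open>Gaussian integrals of quadratic forms\<close>

text \<open>The bounds on \<open>deriv g\<close> hold only at index values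
  \<open>z \<bullet> \<theta>\<close> with \<open>\<theta>\<close> in the enlarged set, so every
  argument of \<open>g\<close> has to be kept in that range. This is why draws are truncated at
  \<open>\<kappa>\<close>, whose product with \<open>\<gamma>\<close> is the radius of the
  enlargement, and why an optimistic draw is also required to have norm at most 5/2. The sampling
  scale \<open>\<gamma>\<close> is twice the confidence radius, so half a standard deviation in the
  direction of the best price already offsets the estimation error; this fixes the half-plane in the
  event of mass at least 1/20. A second difficulty is conditioning: the shock hypothesis conditions
  on prices and shocks only, whereas a price also depends on its own draw, so the draws are adjoined
  one by one through their independence. The price under an exchanged draw is obtained by factoring
  the price through history and draw; its optimality, known only along actual sample points, carries
  over almost surely by independence.\<close>

definition gauss_mass :: "('a::euclidean_space \<Rightarrow> 'a) \<Rightarrow> ennreal" where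
  "gauss_mass A = (\<integral>\<^sup>+w. ennreal (exp (- (w \<bullet> A w) / 2)) \<partial>lborel)"

text \<open>Translation by \<open>u\<close> completes the square; translation invariance of Lebesgue
  measure holds for extended nonnegative integrals, so both sides may be infinite.\<close>

lemma nn_integral_exp_linear_quadratic:
  fixes A :: "'a::euclidean_space \<Rightarrow> 'a"
  assumes lin: "linear A" and sym: "\<And>x y. x \<bullet> A y = A x \<bullet> y"
  shows "(\<integral>\<^sup>+w. ennreal (exp (A u \<bullet> w - (w \<bullet> A w) / 2)) \<partial>lborel)
    = ennreal (exp ((A u \<bullet> u) / 2)) * gauss_mass A"
proof -
  have [measurable]: "A \<in> borel_measurable borel"
    using lin by (intro borel_measurable_continuous_onI linear_continuous_on linear_linear[THEN iffD1])
      (auto simp: linear_conv_bounded_linear)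
  have "(\<integral>\<^sup>+w. ennreal (exp (A u \<bullet> w - (w \<bullet> A w) / 2)) \<partial>lborel)
      = (\<integral>\<^sup>+w. ennreal (exp (A u \<bullet> w - (w \<bullet> A w) / 2)) \<partial>distr lborel borel ((+) u))"
    by (simp add: lborel_distr_plus)
  also have "\<dots> = (\<integral>\<^sup>+w. ennreal (exp (A u \<bullet> (u + w) - ((u + w) \<bullet> A (u + w)) / 2)) \<partial>lborel)"
    by (subst nn_integral_distr) auto
  also have "\<dots> = (\<integral>\<^sup>+w. ennreal (exp ((A u \<bullet> u) / 2)) * ennreal (exp (- (w \<bullet> A w) / 2)) \<partial>lborel)"
  proof (rule nn_integral_cong)
    fix w
    have "A u \<bullet> (u + w) - ((u + w) \<bullet> A (u + w)) / 2 = (A u \<bullet> u) / 2 + (- (w \<bullet> A w) / 2)"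
      using sym[of u w] sym[of u u]
      by (simp add: linear_add[OF lin] inner_add_left inner_add_right inner_commute field_simps)
    then show "ennreal (exp (A u \<bullet> (u + w) - ((u + w) \<bullet> A (u + w)) / 2))
        = ennreal (exp ((A u \<bullet> u) / 2)) * ennreal (exp (- (w \<bullet> A w) / 2))"
      by (simp only: exp_add ennreal_mult' exp_ge_zero)
  qed
  finally show ?thesis
    by (simp add: nn_integral_cmult gauss_mass_def)
qed

lemma nn_integral_gauss_1d:
  assumes "c > 0"
  shows "(\<integral>\<^sup>+x. ennreal (exp (- c * x\<^sup>2 / 2)) \<partial>lborel) = ennreal (sqrt (2 * pi / c))"
    and "(\<integral>\<^sup>+x. ennreal (x\<^sup>2 * exp (- c * x\<^sup>2 / 2)) \<partial>lborel) = ennreal (sqrt (2 * pi / c) / c)"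
proof -
  let ?s = "1 / sqrt c"
  have d: "normal_density 0 ?s x = exp (- c * x\<^sup>2 / 2) / sqrt (2 * pi / c)" for x
    using assms by (simp add: normal_density_def power_divide real_sqrt_divide real_sqrt_mult field_simps)
  have h: "has_bochner_integral lborel (\<lambda>x. normal_density 0 ?s x * (x - 0) ^ (2 * k))
      (fact (2 * k) / ((2 / ?s\<^sup>2)^k * fact k))" for k
    using assms by (intro normal_moment_even) simp
  have e: "exp (- c * x\<^sup>2 / 2) = sqrt (2 * pi / c) * normal_density 0 ?s x" for x
    using assms by (simp add: d)
  have "has_bochner_integral lborel (\<lambda>x. sqrt (2 * pi / c) * normal_density 0 ?s x) (sqrt (2 * pi / c))"
    using has_bochner_integral_mult_right[OF h[of 0], of "sqrt (2 * pi / c)"] by simp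
  then show "(\<integral>\<^sup>+x. ennreal (exp (- c * x\<^sup>2 / 2)) \<partial>lborel) = ennreal (sqrt (2 * pi / c))"
    unfolding e using assms by (intro nn_integral_eq_integral[THEN trans] arg_cong[where f=ennreal] has_bochner_integral_integral_eq) (auto dest: integrable.intros simp: normal_density_nonneg)
  have "has_bochner_integral lborel (\<lambda>x. x\<^sup>2 * (sqrt (2 * pi / c) * normal_density 0 ?s x)) (sqrt (2 * pi / c) / c)"
    using has_bochner_integral_mult_right[OF h[of 1], of "sqrt (2 * pi / c)"] assms
    by (simp add: power_divide fact_numeral mult_ac)
  then show "(\<integral>\<^sup>+x. ennreal (x\<^sup>2 * exp (- c * x\<^sup>2 / 2)) \<partial>lborel) = ennreal (sqrt (2 * pi / c) / c)"
    unfolding e using assms by (intro nn_integral_eq_integral[THEN trans] arg_cong[where f=ennreal] has_bochner_integral_integral_eq) (auto dest: integrable.intros simp: normal_density_nonneg)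
qed

lemma exp_norm_prod:
  fixes w :: "'a::euclidean_space"
  shows "exp (- (w \<bullet> (c *\<^sub>R w)) / 2) = (\<Prod>b\<in>Basis. exp (- c * (w \<bullet> b)\<^sup>2 / 2))"
  by (simp add: exp_sum[symmetric] sum_negf sum_divide_distrib[symmetric] sum_distrib_left[symmetric]
      euclidean_inner[of w w] power2_eq_square)

lemma gauss_mass_scaleR:
  assumes "c > 0"
  shows "gauss_mass (\<lambda>w::'a::euclidean_space. c *\<^sub>R w) = ennreal (sqrt (2 * pi / c) ^ DIM('a))"
  unfolding gauss_mass_def exp_norm_prod
  using assms nn_integral_lborel_prod[of "\<lambda>b::'a. \<lambda>x. ennreal (exp (- c * x\<^sup>2 / 2))"]
  by (simp add: prod_ennreal nn_integral_gauss_1d[OF assms, simplified] ennreal_power)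

text \<open>Each coordinate of the Gaussian of precision \<open>c\<close> has second moment
  \<open>1 / c\<close>, and there are \<open>DIM('a)\<close> of them.\<close>

lemma gauss_second_moment_norm:
  fixes c :: real
  assumes c: "c > 0"
  shows "(\<integral>\<^sup>+w. ennreal ((norm (w::'a::euclidean_space))\<^sup>2 * exp (- (w \<bullet> (c *\<^sub>R w)) / 2)) \<partial>lborel)
    = ennreal (DIM('a) / c) * gauss_mass (\<lambda>w::'a. c *\<^sub>R w)"
proof -
  let ?e = "\<lambda>x::real. exp (- c * x\<^sup>2 / 2)"
  have one: "(\<integral>\<^sup>+w. ennreal ((w \<bullet> b)\<^sup>2 * exp (- (w \<bullet> (c *\<^sub>R w)) / 2)) \<partial>lborel)
      = ennreal (1 / c) * gauss_mass (\<lambda>w::'a. c *\<^sub>R w)" if b: "b \<in> Basis" for b :: 'a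
  proof -
    \<comment> \<open>Only the factor of coordinate \<open>b\<close> carries the square, so the
      integrand remains a product over the basis.\<close>
    define f where "f = (\<lambda>(b'::'a) x. ennreal (if b' = b then x\<^sup>2 * ?e x else ?e x))"
    have f_prod: "(\<Prod>b'\<in>Basis. f b' (w \<bullet> b')) = ennreal ((w \<bullet> b)\<^sup>2 * exp (- (w \<bullet> (c *\<^sub>R w)) / 2))" for w :: 'a
    proof -
      have "(\<Prod>b'\<in>Basis. f b' (w \<bullet> b')) = ennreal (\<Prod>b'\<in>Basis. if b' = b then (w \<bullet> b')\<^sup>2 * ?e (w \<bullet> b') else ?e (w \<bullet> b'))"
        unfolding f_def by (subst prod_ennreal) auto
      also have "(\<Prod>b'\<in>Basis. if b' = b then (w \<bullet> b')\<^sup>2 * ?e (w \<bullet> b') else ?e (w \<bullet> b'))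
        = (\<Prod>b'\<in>Basis. (if b' = b then (w \<bullet> b')\<^sup>2 else 1) * ?e (w \<bullet> b'))"
        by (intro prod.cong) auto
      also have "\<dots> = (w \<bullet> b)\<^sup>2 * exp (- (w \<bullet> (c *\<^sub>R w)) / 2)"
        unfolding exp_norm_prod prod.distrib using b by simp
      finally show ?thesis .
    qed
    have fi: "(\<integral>\<^sup>+x. f b' x \<partial>lborel) = ennreal ((if b' = b then 1 / c else 1) * sqrt (2 * pi / c))" for b'
      unfolding f_def using nn_integral_gauss_1d[OF c] by (cases "b' = b") auto
    have "(\<integral>\<^sup>+w. (\<Prod>b'\<in>Basis. f b' (w \<bullet> b')) \<partial>lborel) = (\<Prod>b'\<in>Basis. (\<integral>\<^sup>+x. f b' x \<partial>lborel))"
      by (rule nn_integral_lborel_prod) (auto simp: f_def)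
    also have "\<dots> = ennreal (\<Prod>b'\<in>(Basis::'a set). (if b' = b then 1 / c else 1) * sqrt (2 * pi / c))"
      unfolding fi using c by (subst prod_ennreal) auto
    also have "\<dots> = ennreal (1 / c) * gauss_mass (\<lambda>w::'a. c *\<^sub>R w)"
      using b c by (simp add: prod.distrib gauss_mass_scaleR ennreal_mult'[symmetric])
    finally show ?thesis
      unfolding f_prod .
  qed
  have "(\<integral>\<^sup>+w. ennreal ((norm (w::'a))\<^sup>2 * exp (- (w \<bullet> (c *\<^sub>R w)) / 2)) \<partial>lborel)
      = (\<integral>\<^sup>+w. (\<Sum>b\<in>Basis. ennreal ((w \<bullet> b)\<^sup>2 * exp (- (w \<bullet> (c *\<^sub>R w)) / 2))) \<partial>(lborel::'a measure))"
  proof (rule nn_integral_cong)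
    fix w :: 'a
    have "(norm w)\<^sup>2 = (\<Sum>b\<in>Basis. (w \<bullet> b)\<^sup>2)"
      unfolding power2_norm_eq_inner euclidean_inner[of w w] by (simp add: power2_eq_square)
    then show "ennreal ((norm w)\<^sup>2 * exp (- (w \<bullet> (c *\<^sub>R w)) / 2))
        = (\<Sum>b\<in>Basis. ennreal ((w \<bullet> b)\<^sup>2 * exp (- (w \<bullet> (c *\<^sub>R w)) / 2)))"
      by (subst sum_ennreal) (auto simp only: sum_distrib_right zero_le_power2 exp_ge_zero intro!: mult_nonneg_nonneg)
  qed
  also have "\<dots> = (\<Sum>b\<in>(Basis::'a set). ennreal (1 / c) * gauss_mass (\<lambda>w::'a. c *\<^sub>R w))"
    by (subst nn_integral_sum) (auto simp only: one intro!: sum.cong, measurable)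
  also have "\<dots> = ennreal (DIM('a) / c) * gauss_mass (\<lambda>w::'a. c *\<^sub>R w)"
    using c by (simp add: ennreal_of_nat_eq_real_of_nat mult.assoc[symmetric] ennreal_mult'[symmetric])
  finally show ?thesis .
qed

text \<open>Two integrations of \<open>cosh \<ge> 1\<close> starting from 0. It converts bounds on
  exponential moments at \<open>s\<close> and \<open>- s\<close> into bounds on second
  moments.\<close>

lemma cosh_ge: "1 + x\<^sup>2 / 2 \<le> cosh (x::real)"
proof -
  have "1 + x\<^sup>2 / 2 \<le> cosh x" if "0 \<le> x" for x :: real
  proof -
    have "sinh y \<ge> y" if "0 \<le> y" for y :: real
    proof -
      have "(\<lambda>y. sinh y - y) 0 \<le> (\<lambda>y. sinh y - y) y"
        by (rule DERIV_nonneg_imp_nondecreasing[OF that])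
          (auto intro!: derivative_eq_intros exI simp: cosh_real_ge_1)
      then show ?thesis by simp
    qed
    then have "(\<lambda>x. cosh x - x\<^sup>2 / 2) 0 \<le> (\<lambda>x. cosh x - x\<^sup>2 / 2) x"
      by (intro DERIV_nonneg_imp_nondecreasing[OF that])
        (auto intro!: derivative_eq_intros exI)
    then show ?thesis by simp
  qed
  from this[of "\<bar>x\<bar>"] show ?thesis by (cases "0 \<le> x") auto
qed

text \<open>Exact value of the moment, of which only the upper bound is needed: compare \<open>1 + y\<^sup>2 / 2 \<le> cosh y\<close> with the
  moment generating function and let the argument tend to 0.\<close>

lemma gauss_second_moment_le:
  fixes z :: "'a::euclidean_space"
  assumes c: "c > 0"
  shows "(\<integral>\<^sup>+w. ennreal ((z \<bullet> w)\<^sup>2 * exp (- (w \<bullet> (c *\<^sub>R w)) / 2)) \<partial>lborel)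
    \<le> ennreal ((norm z)\<^sup>2 / c) * gauss_mass (\<lambda>w::'a. c *\<^sub>R w)" (is "?m \<le> _")
proof -
  let ?g = "\<lambda>w::'a. exp (- (w \<bullet> (c *\<^sub>R w)) / 2)"
  define K where "K = sqrt (2 * pi / c) ^ DIM('a)"
  have K: "gauss_mass (\<lambda>w::'a. c *\<^sub>R w) = ennreal K" "K > 0"
    using c by (auto simp: gauss_mass_scaleR K_def)
  define a where "a = (norm z)\<^sup>2 / c"
  have a: "a \<ge> 0" using c by (simp add: a_def)
  have mgf: "(\<integral>\<^sup>+w. ennreal (exp (s * (z \<bullet> w)) * ?g w) \<partial>lborel) = ennreal (exp (s\<^sup>2 * a / 2) * K)" for s
  proof -
    have "linear (\<lambda>w::'a. c *\<^sub>R w)" by (simp add: linear_iff scaleR_add_right)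
    from nn_integral_exp_linear_quadratic[OF this, of "(s / c) *\<^sub>R z"]
    have *: "(\<integral>\<^sup>+w. ennreal (exp (s * (z \<bullet> w) - c * (w \<bullet> w) / 2)) \<partial>lborel)
        = ennreal (exp (s * (s * (z \<bullet> z) / c) / 2)) * ennreal K"
      using c by (simp add: K(1)[symmetric])
    have "exp (s * (z \<bullet> w)) * ?g w = exp (s * (z \<bullet> w) - c * (w \<bullet> w) / 2)" for w
      by (simp add: exp_add[symmetric])
    moreover have "s * (s * (z \<bullet> z) / c) / 2 = s\<^sup>2 * a / 2"
      by (simp add: a_def power2_norm_eq_inner[symmetric] power2_eq_square[of s])
    ultimately show ?thesis
      using * K(2) by (simp only: ennreal_mult' exp_ge_zero)
  qed
  \<comment> \<open>The moment generating function at \<open>s\<close> and at \<open>- s\<close>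
    adds up to twice a \<open>cosh\<close>, whose lower bound isolates the second moment.\<close>
  have bound: "ennreal (s\<^sup>2) * ?m + ennreal (2 * K) \<le> ennreal (2 * exp (s\<^sup>2 * a / 2) * K)" for s
  proof -
    have "ennreal (s\<^sup>2) * ?m + ennreal 2 * gauss_mass (\<lambda>w::'a. c *\<^sub>R w)
        = (\<integral>\<^sup>+w. ennreal (s\<^sup>2) * ennreal ((z \<bullet> w)\<^sup>2 * ?g w) + ennreal 2 * ennreal (?g w) \<partial>lborel)"
      by (simp add: nn_integral_add nn_integral_cmult gauss_mass_def)
    also have "\<dots> \<le> (\<integral>\<^sup>+w. ennreal (exp (s * (z \<bullet> w)) * ?g w) + ennreal (exp ((-s) * (z \<bullet> w)) * ?g w) \<partial>lborel)"
    proof (rule nn_integral_mono)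
      fix w
      have "(1 + (s * (z \<bullet> w))\<^sup>2 / 2) * (2 * ?g w) \<le> cosh (s * (z \<bullet> w)) * (2 * ?g w)"
        by (intro mult_right_mono cosh_ge) auto
      then have "s\<^sup>2 * ((z \<bullet> w)\<^sup>2 * ?g w) + 2 * ?g w
          \<le> exp (s * (z \<bullet> w)) * ?g w + exp ((-s) * (z \<bullet> w)) * ?g w"
        by (simp add: cosh_field_def field_simps power_mult_distrib)
      then show "ennreal (s\<^sup>2) * ennreal ((z \<bullet> w)\<^sup>2 * ?g w) + ennreal 2 * ennreal (?g w)
        \<le> ennreal (exp (s * (z \<bullet> w)) * ?g w) + ennreal (exp ((-s) * (z \<bullet> w)) * ?g w)"
        by (simp only: ennreal_mult'[symmetric] ennreal_plus[symmetric] zero_le_power2 exp_ge_zero mult_nonneg_nonneg zero_le_numeral ennreal_leI)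
    qed
    also have "\<dots> = ennreal (exp (s\<^sup>2 * a / 2) * K) + ennreal (exp ((-s)\<^sup>2 * a / 2) * K)"
      unfolding mgf[symmetric] by (rule nn_integral_add) auto
    also have "\<dots> = ennreal (2 * exp (s\<^sup>2 * a / 2) * K)"
      using K by (simp add: ennreal_plus[symmetric] del: ennreal_plus)
    finally show ?thesis using K ennreal_mult'[of 2 K] by simp
  qed
  have "?m < \<infinity>"
    using bound[of 1] by (auto simp: less_top[symmetric] top_unique)
  then obtain m where m: "?m = ennreal m" "m \<ge> 0"
    by (cases ?m) auto
  have b: "s\<^sup>2 * m + 2 * K \<le> 2 * exp (s\<^sup>2 * a / 2) * K" for s
    using bound[of s] m K by (simp add: ennreal_mult'[symmetric] ennreal_plus[symmetric] ennreal_le_iff del: ennreal_plus)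
  have "m \<le> a * K"
  proof (rule field_le_epsilon)
    fix e :: real assume e: "e > 0"
    \<comment> \<open>\<open>y\<close> is the square of the argument of the moment generating
      function. The first term of the minimum makes \<open>exp_bound\<close> applicable, the second
      keeps the quadratic remainder below \<open>e\<close>.\<close>
    define y where "y = min (1 / (1 + a)) (e / (1 + a\<^sup>2 * K))"
    have y: "y > 0" "y * a \<le> 1" "y * (a\<^sup>2 * K) \<le> e"
    proof -
      show "y > 0" using a e K by (simp add: y_def add_pos_nonneg)
      have "y * a \<le> 1 / (1 + a) * a" using a by (intro mult_right_mono) (auto simp: y_def)
      also have "\<dots> \<le> 1" using a by (simp add: field_simps)
      finally show "y * a \<le> 1" .
      have "y * (a\<^sup>2 * K) \<le> e / (1 + a\<^sup>2 * K) * (a\<^sup>2 * K)" using K by (intro mult_right_mono) (auto simp: y_def)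
      also have "\<dots> \<le> e" using e K by (simp add: field_simps add_pos_nonneg)
      finally show "y * (a\<^sup>2 * K) \<le> e" .
    qed
    have "exp (y * a / 2) \<le> 1 + (y * a / 2) + (y * a / 2)\<^sup>2"
      using y a by (intro exp_bound) auto
    then have "2 * exp (y * a / 2) * K \<le> 2 * (1 + (y * a / 2) + (y * a / 2)\<^sup>2) * K"
      using K by simp
    with b[of "sqrt y"] y have "y * m + 2 * K \<le> 2 * (1 + (y * a / 2) + (y * a / 2)\<^sup>2) * K" by simp
    then have "y * m \<le> y * (a * K + y * (a\<^sup>2 * K) / 2)"
      by (simp add: field_simps power2_eq_square)
    then have "m \<le> a * K + y * (a\<^sup>2 * K) / 2" using y by simp
    with y e show "m \<le> a * K + e" by linarith
  qed
  then show ?thesis using m K a by (simp add: a_def[symmetric] ennreal_mult'[symmetric])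
qed


text \<open>Gaussian form of the inequality between determinant and trace. With
  \<open>c = 1 + \<tau> / DIM('a)\<close> one has \<open>(c - 1) * DIM('a) = \<tau>\<close>, so
  under the Gaussian of precision \<open>c\<close> the mean of the linear term in
  \<open>1 + y \<le> exp y\<close> is nonnegative.\<close>

lemma gauss_mass_trace_bound:
  fixes z :: "'i \<Rightarrow> 'a::euclidean_space"
  assumes fin: "finite I" and z: "\<And>i. i \<in> I \<Longrightarrow> norm (z i) \<le> 1" and card: "real (card I) \<le> \<tau>"
  shows "gauss_mass (\<lambda>w::'a. w)
    \<le> ennreal (sqrt (1 + \<tau> / DIM('a)) ^ DIM('a)) * gauss_mass (\<lambda>w. w + (\<Sum>i\<in>I. (z i \<bullet> w) *\<^sub>R z i))"
proof -
  let ?n = "real DIM('a)"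
  define c where "c = 1 + \<tau> / ?n"
  have n: "?n > 0" by simp
  have \<tau>: "\<tau> \<ge> 0" using card by linarith
  have c: "c > 0" "c \<ge> 1" using \<tau> n by (auto simp: c_def add_pos_nonneg)
  let ?A = "\<lambda>w. w + (\<Sum>i\<in>I. (z i \<bullet> w) *\<^sub>R z i)"
  let ?g = "\<lambda>w::'a. exp (- (w \<bullet> (c *\<^sub>R w)) / 2)"
  define K where "K = sqrt (2 * pi / c) ^ DIM('a)"
  have K: "gauss_mass (\<lambda>w::'a. c *\<^sub>R w) = ennreal K" "K > 0"
    using c by (auto simp: gauss_mass_scaleR K_def)
  \<comment> \<open>The negative part of the linear term stands on the right, so that all integrands
    are nonnegative.\<close>
  have pt: "ennreal (?g w) + ennreal ((c - 1) / 2) * ennreal ((norm w)\<^sup>2 * ?g w)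
      \<le> ennreal (exp (- (w \<bullet> ?A w) / 2)) + (\<Sum>i\<in>I. ennreal (1/2) * ennreal ((z i \<bullet> w)\<^sup>2 * ?g w))" for w
  proof -
    let ?s = "\<Sum>i\<in>I. (z i \<bullet> w)\<^sup>2"
    have q: "w \<bullet> ?A w = (norm w)\<^sup>2 + ?s"
      by (simp add: inner_add_right inner_sum_right dot_square_norm inner_commute power2_eq_square[of "_ \<bullet> _"])
    have "1 + ((c - 1) * (norm w)\<^sup>2 - ?s) / 2 \<le> exp (((c - 1) * (norm w)\<^sup>2 - ?s) / 2)"
      by (rule exp_ge_add_one_self)
    then have "(1 + ((c - 1) * (norm w)\<^sup>2 - ?s) / 2) * ?g w \<le> exp (((c - 1) * (norm w)\<^sup>2 - ?s) / 2) * ?g w"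
      by (rule mult_right_mono) simp
    also have "\<dots> = exp (- (w \<bullet> ?A w) / 2)"
      unfolding exp_add[symmetric] q by (simp add: dot_square_norm field_simps)
    finally have "?g w + (c - 1) / 2 * ((norm w)\<^sup>2 * ?g w) \<le> exp (- (w \<bullet> ?A w) / 2) + (\<Sum>i\<in>I. 1/2 * ((z i \<bullet> w)\<^sup>2 * ?g w))"
      by (simp add: sum_distrib_left[symmetric] sum_distrib_right[symmetric] sum_divide_distrib[symmetric] field_simps)
    then have "ennreal (?g w + (c - 1) / 2 * ((norm w)\<^sup>2 * ?g w))
        \<le> ennreal (exp (- (w \<bullet> ?A w) / 2) + (\<Sum>i\<in>I. 1/2 * ((z i \<bullet> w)\<^sup>2 * ?g w)))"
      by (rule ennreal_leI)
    moreover have "ennreal ((c - 1) / 2) * ennreal ((norm w)\<^sup>2 * ?g w) = ennreal ((c - 1) / 2 * ((norm w)\<^sup>2 * ?g w))"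
      using c by (intro ennreal_mult'[symmetric]) auto
    moreover have "ennreal (1/2) * ennreal ((z i \<bullet> w)\<^sup>2 * ?g w) = ennreal (1/2 * ((z i \<bullet> w)\<^sup>2 * ?g w))" for i
      by (intro ennreal_mult'[symmetric]) auto
    moreover have "(\<Sum>i\<in>I. ennreal (1/2 * ((z i \<bullet> w)\<^sup>2 * ?g w))) = ennreal (\<Sum>i\<in>I. 1/2 * ((z i \<bullet> w)\<^sup>2 * ?g w))"
      by (intro sum_ennreal) auto
    moreover have "(c - 1) / 2 * ((norm w)\<^sup>2 * ?g w) \<ge> 0" "(\<Sum>i\<in>I. 1/2 * ((z i \<bullet> w)\<^sup>2 * ?g w)) \<ge> 0"
      using c by (auto intro!: sum_nonneg)
    ultimately show ?thesis
      by (simp only: ennreal_plus[symmetric] exp_ge_zero)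
  qed
  have "ennreal K + ennreal ((c - 1) / 2) * (ennreal (?n / c) * ennreal K)
      = (\<integral>\<^sup>+w. ennreal (?g w) + ennreal ((c - 1) / 2) * ennreal ((norm w)\<^sup>2 * ?g w) \<partial>lborel)"
    using gauss_second_moment_norm[OF c(1), where 'a='a] K
    by (simp add: nn_integral_add nn_integral_cmult gauss_mass_def)
  also have "\<dots> \<le> (\<integral>\<^sup>+w. ennreal (exp (- (w \<bullet> ?A w) / 2)) + (\<Sum>i\<in>I. ennreal (1/2) * ennreal ((z i \<bullet> w)\<^sup>2 * ?g w)) \<partial>lborel)"
    by (rule nn_integral_mono) (rule pt)
  also have "\<dots> = gauss_mass ?A + (\<Sum>i\<in>I. ennreal (1/2) * (\<integral>\<^sup>+w. ennreal ((z i \<bullet> w)\<^sup>2 * ?g w) \<partial>lborel))"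
    by (subst nn_integral_add) (auto simp: gauss_mass_def nn_integral_sum nn_integral_cmult)
  also have "\<dots> \<le> gauss_mass ?A + (\<Sum>i\<in>I. ennreal (1/2) * (ennreal (1 / c) * ennreal K))"
  proof (intro add_left_mono sum_mono mult_left_mono)
    fix i assume i: "i \<in> I"
    have "(\<integral>\<^sup>+w. ennreal ((z i \<bullet> w)\<^sup>2 * ?g w) \<partial>lborel) \<le> ennreal ((norm (z i))\<^sup>2 / c) * ennreal K"
      using gauss_second_moment_le[OF c(1), of "z i"] K by simp
    also have "\<dots> \<le> ennreal (1 / c) * ennreal K"
      using z[OF i] c by (intro mult_right_mono ennreal_leI divide_right_mono power_le_one) auto
    finally show "(\<integral>\<^sup>+w. ennreal ((z i \<bullet> w)\<^sup>2 * ?g w) \<partial>lborel) \<le> ennreal (1 / c) * ennreal K" .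
  qed auto
  also have "\<dots> = gauss_mass ?A + ennreal (card I / (2 * c) * K)"
  proof -
    have "ennreal (1/2) * (ennreal (1 / c) * ennreal K) = ennreal (1/2 * (1 / c * K))"
      using c by (metis ennreal_mult' less_imp_le zero_le_divide_1_iff zero_le_numeral)
    moreover have "of_nat (card I) * ennreal (1/2 * (1 / c * K)) = ennreal (real (card I) * (1/2 * (1 / c * K)))"
      by (simp only: ennreal_of_nat_eq_real_of_nat ennreal_mult' of_nat_0_le_iff)
    ultimately show ?thesis by (simp only: sum_constant) (simp add: mult_ac)
  qed
  finally have le: "ennreal K + ennreal ((c - 1) / 2) * (ennreal (?n / c) * ennreal K) \<le> gauss_mass ?A + ennreal (card I / (2 * c) * K)" .
  have "ennreal ((c - 1) / 2) * (ennreal (?n / c) * ennreal K) = ennreal (\<tau> / (2 * c) * K)"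
    using c K n by (simp add: ennreal_mult'[symmetric] c_def)
  with le have "ennreal K + ennreal (\<tau> / (2 * c) * K) \<le> gauss_mass ?A + ennreal (card I / (2 * c) * K)" by simp
  also have "\<dots> \<le> gauss_mass ?A + ennreal (\<tau> / (2 * c) * K)"
    using c K card by (intro add_left_mono ennreal_leI mult_right_mono divide_right_mono) auto
  finally have le': "ennreal K \<le> gauss_mass ?A"
    by (simp add: add.commute ennreal_add_left_cancel_le)
  have "gauss_mass (\<lambda>w::'a. w) = ennreal (sqrt (2 * pi) ^ DIM('a))"
    using gauss_mass_scaleR[of 1, where 'a='a] by simp
  also have "sqrt (2 * pi) ^ DIM('a) = sqrt c ^ DIM('a) * K"
    using c by (simp add: K_def power_mult_distrib[symmetric] real_sqrt_mult[symmetric])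
  also have "ennreal \<dots> = ennreal (sqrt c ^ DIM('a)) * ennreal K"
    using c by (simp add: ennreal_mult')
  also have "\<dots> \<le> ennreal (sqrt c ^ DIM('a)) * gauss_mass ?A"
    by (intro mult_left_mono le') auto
  finally show ?thesis by (simp add: c_def)
qed

text \<open>Counterpart of the matrix determinant lemma, with \<open>u\<close> in the role of the
  inverse of \<open>A\<close> applied to \<open>z\<close>.\<close>

lemma gauss_mass_rank_one:
  fixes A :: "'a::euclidean_space \<Rightarrow> 'a"
  assumes lin: "linear A" and sym: "\<And>x y. x \<bullet> A y = A x \<bullet> y" and u: "A u = z" and k: "z \<bullet> u \<ge> 0"
  shows "gauss_mass A = ennreal (sqrt (1 + z \<bullet> u)) * gauss_mass (\<lambda>w. A w + (z \<bullet> w) *\<^sub>R z)"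
proof -
  define k where "k = z \<bullet> u"
  define B where "B = (\<lambda>w. A w + (z \<bullet> w) *\<^sub>R z)"
  have linB: "linear B"
    unfolding B_def by (intro linearI) (auto simp: linear_add[OF lin] linear_scale[OF lin] algebra_simps)
  have symB: "x \<bullet> B y = B x \<bullet> y" for x y
    by (simp add: B_def inner_add_left inner_add_right sym[of x y] inner_commute[of x z])
  have [measurable]: "A \<in> borel_measurable borel" "B \<in> borel_measurable borel"
    using lin linB by (auto intro!: borel_measurable_continuous_onI linear_continuous_on simp: linear_conv_bounded_linear)
  have k0: "k \<ge> 0" using k by (simp add: k_def)
  \<comment> \<open>As in the Sherman-Morrison formula, the updated operator sends \<open>u\<close>
    to \<open>1 + k\<close> times \<open>z\<close>; the equation \<open>B v = x *\<^sub>R z\<close>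
    is thereby solved, and the square can be completed.\<close>
  have Bu: "B ((x / (1 + k)) *\<^sub>R u) = x *\<^sub>R z" for x
  proof -
    have "B u = (1 + k) *\<^sub>R z" by (simp add: B_def u k_def algebra_simps)
    then show ?thesis using k0 by (simp add: linear_scale[OF linB])
  qed
  define r where "r = 1 / sqrt (2 * pi)"
  have r: "r > 0" "r * sqrt (2 * pi) = 1" by (auto simp: r_def)
  have mix: "ennreal (exp (x\<^sup>2 / 2)) = (\<integral>\<^sup>+y. ennreal (r * exp (x * y - y\<^sup>2 / 2)) \<partial>lborel)" for x :: real
  proof -
    have "linear (\<lambda>w::real. w)" by (simp add: linear_iff)
    from nn_integral_exp_linear_quadratic[OF this, of x] gauss_mass_scaleR[of 1, where 'a=real]
    have "(\<integral>\<^sup>+y. ennreal (exp (x * y - y\<^sup>2 / 2)) \<partial>lborel) = ennreal (exp (x\<^sup>2 / 2)) * ennreal (sqrt (2 * pi))"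
      by (simp add: power2_eq_square)
    then have "(\<integral>\<^sup>+y. ennreal (r * exp (x * y - y\<^sup>2 / 2)) \<partial>lborel) = ennreal r * (ennreal (exp (x\<^sup>2 / 2)) * ennreal (sqrt (2 * pi)))"
      using r(1) by (simp only: ennreal_mult' less_imp_le) (simp add: nn_integral_cmult)
    also have "\<dots> = ennreal (exp (x\<^sup>2 / 2) * (r * sqrt (2 * pi)))"
      using r(1) by (simp add: ennreal_mult'[symmetric] mult_ac)
    finally show ?thesis by (simp add: r(2))
  qed
  have "gauss_mass A = (\<integral>\<^sup>+w. ennreal (exp (- (w \<bullet> B w) / 2)) * ennreal (exp ((z \<bullet> w)\<^sup>2 / 2)) \<partial>lborel)"
    unfolding gauss_mass_def
  proof (rule nn_integral_cong)
    fix w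
    have "- (w \<bullet> A w) / 2 = - (w \<bullet> B w) / 2 + (z \<bullet> w)\<^sup>2 / 2"
      by (simp add: B_def inner_add_right inner_commute power2_eq_square field_simps)
    then show "ennreal (exp (- (w \<bullet> A w) / 2)) = ennreal (exp (- (w \<bullet> B w) / 2)) * ennreal (exp ((z \<bullet> w)\<^sup>2 / 2))"
      by (simp only: exp_add ennreal_mult' exp_ge_zero)
  qed
  also have "\<dots> = (\<integral>\<^sup>+w. (\<integral>\<^sup>+y. ennreal (exp (- (w \<bullet> B w) / 2)) * ennreal (r * exp ((z \<bullet> w) * y - y\<^sup>2 / 2)) \<partial>lborel) \<partial>lborel)"
    unfolding mix by (intro nn_integral_cong nn_integral_cmult[symmetric]) auto
  also have "\<dots> = (\<integral>\<^sup>+y. (\<integral>\<^sup>+w. ennreal (exp (- (w \<bullet> B w) / 2)) * ennreal (r * exp ((z \<bullet> w) * y - y\<^sup>2 / 2)) \<partial>lborel) \<partial>lborel)"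
    by (rule lborel_pair.Fubini'[symmetric]) auto
  also have "\<dots> = (\<integral>\<^sup>+y. ennreal (r * exp (- (1 / (1 + k)) * y\<^sup>2 / 2)) * gauss_mass B \<partial>lborel)"
  proof (rule nn_integral_cong)
    fix y :: real
    have "ennreal (exp (- (w \<bullet> B w) / 2)) * ennreal (r * exp ((z \<bullet> w) * y - y\<^sup>2 / 2))
      = ennreal (r * exp (- y\<^sup>2 / 2)) * ennreal (exp (B ((y / (1 + k)) *\<^sub>R u) \<bullet> w - (w \<bullet> B w) / 2))" for w
      unfolding Bu using r by (simp add: ennreal_mult'[symmetric] exp_add[symmetric] mult_ac exp_diff exp_minus field_simps)
    then have "(\<integral>\<^sup>+w. ennreal (exp (- (w \<bullet> B w) / 2)) * ennreal (r * exp ((z \<bullet> w) * y - y\<^sup>2 / 2)) \<partial>lborel)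
      = ennreal (r * exp (- y\<^sup>2 / 2)) * (ennreal (exp ((B ((y / (1 + k)) *\<^sub>R u) \<bullet> ((y / (1 + k)) *\<^sub>R u)) / 2)) * gauss_mass B)"
      by (simp only:) (subst nn_integral_cmult, auto simp: nn_integral_exp_linear_quadratic[OF linB symB])
    also have "\<dots> = ennreal (r * (exp (- y\<^sup>2 / 2) * exp ((B ((y / (1 + k)) *\<^sub>R u) \<bullet> ((y / (1 + k)) *\<^sub>R u)) / 2))) * gauss_mass B"
      by (simp only: mult.assoc[symmetric] ennreal_mult'[symmetric] exp_ge_zero) (use r in \<open>simp add: mult.assoc ennreal_mult'[symmetric]\<close>)
    \<comment> \<open>The two quadratic terms combine to \<open>- y\<^sup>2 / 2\<close> times
      \<open>1 - k / (1 + k)\<close>.\<close>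
    also have "exp (- y\<^sup>2 / 2) * exp ((B ((y / (1 + k)) *\<^sub>R u) \<bullet> ((y / (1 + k)) *\<^sub>R u)) / 2) = exp (- (1 / (1 + k)) * y\<^sup>2 / 2)"
      unfolding exp_add[symmetric] Bu using k0
      by (simp add: k_def[symmetric] power2_eq_square) (simp add: field_simps)
    finally show "(\<integral>\<^sup>+w. ennreal (exp (- (w \<bullet> B w) / 2)) * ennreal (r * exp ((z \<bullet> w) * y - y\<^sup>2 / 2)) \<partial>lborel)
      = ennreal (r * exp (- (1 / (1 + k)) * y\<^sup>2 / 2)) * gauss_mass B" .
  qed
  also have "\<dots> = (\<integral>\<^sup>+y. ennreal (r * exp (- (1 / (1 + k)) * y\<^sup>2 / 2)) \<partial>lborel) * gauss_mass B"
    by (rule nn_integral_multc) auto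
  also have "(\<integral>\<^sup>+y. ennreal (r * exp (- (1 / (1 + k)) * y\<^sup>2 / 2)) \<partial>lborel) = ennreal r * ennreal (sqrt (2 * pi / (1 / (1 + k))))"
    using k0 r by (subst nn_integral_gauss_1d(1)[symmetric]) (auto simp: ennreal_mult' nn_integral_cmult)
  also have "\<dots> = ennreal (sqrt (1 + k))"
    using k0 r by (simp add: ennreal_mult'[symmetric] real_sqrt_mult mult.assoc[symmetric])
  finally show ?thesis by (simp add: B_def k_def)
qed

section \<open>Design matrices and the elliptical potential\<close>

lemma sum_UNIV_Plus:
  "(\<Sum>i\<in>(UNIV :: ('a::finite + 'b::finite) set). f i) = (\<Sum>j\<in>UNIV. f (Inl j)) + (\<Sum>j\<in>UNIV. f (Inr j))"
  using sum.Plus[of UNIV UNIV f] by (simp add: comp_def)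

lemma regressor_inner:
  "regressor y q \<bullet> \<theta> = y \<bullet> upper \<theta> + (y \<bullet> lower \<theta>) * q"
  by (simp add: regressor_def stack_def upper_def lower_def inner_vec_def sum_UNIV_Plus sum_distrib_left mult_ac)

lemma upper_stack [simp]: "upper (stack a b) = a" and lower_stack [simp]: "lower (stack a b) = b"
  by (simp_all add: upper_def lower_def stack_def vec_eq_iff)

lemma regressor_eq: "regressor y q = stack y 0 + q *\<^sub>R stack 0 y"
  by (auto simp: regressor_def stack_def vec_eq_iff split: sum.split)

lemma block_covariate_mult: "block_covariate y *v w = w $ 1 *\<^sub>R stack y 0 + w $ 2 *\<^sub>R stack 0 y"
  by (auto simp: block_covariate_def stack_def vec_eq_iff matrix_vector_mult_def UNIV_2 mult.commute split: sum.split)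

text \<open>The design matrix for \<open>lam = 1\<close> as an operator on an arbitrary inner
  product space, the form in which the Gaussian integrals apply to it.\<close>

definition design_op :: "(nat \<Rightarrow> 'a::real_inner) \<Rightarrow> nat \<Rightarrow> 'a \<Rightarrow> 'a" where
  "design_op z t w = w + (\<Sum>s=1..t. (z s \<bullet> w) *\<^sub>R z s)"

lemma design_op_linear: "linear (design_op z t)"
  by (intro linearI)
    (auto simp: design_op_def algebra_simps inner_add_right sum.distrib scaleR_add_left scaleR_sum_right)

lemma design_op_sym: "v \<bullet> design_op z t w = design_op z t v \<bullet> w"
  by (simp add: design_op_def inner_add_left inner_add_right inner_sum_left inner_sum_right inner_commute mult.commute)

lemma design_op_quad: "w \<bullet> design_op z t w = (norm w)\<^sup>2 + (\<Sum>s=1..t. (z s \<bullet> w)\<^sup>2)"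
  by (simp add: design_op_def inner_add_right inner_sum_right dot_square_norm inner_commute power2_eq_square[of "_ \<bullet> _"])

lemma design_op_ge: "(norm w)\<^sup>2 \<le> w \<bullet> design_op z t w"
  by (simp add: design_op_quad sum_nonneg)

lemma design_matrix_mult:
  "design_matrix 1 x q t *v w = design_op (\<lambda>s. regressor (x s) (q s)) t w"
proof -
  have "(design_matrix 1 x q t *v w) $ i = design_op (\<lambda>s. regressor (x s) (q s)) t w $ i" for i
  proof -
    let ?z = "\<lambda>s. regressor (x s) (q s)"
    have "(design_matrix 1 x q t *v w) $ i
        = (mat 1 *v w) $ i + (\<Sum>j\<in>UNIV. (\<Sum>s=1..t. ?z s $ i * ?z s $ j) * w $ j)"
      by (simp add: design_matrix_def matrix_vector_mult_def algebra_simps sum.distrib sum_component)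
    also have "(\<Sum>j\<in>UNIV. (\<Sum>s=1..t. ?z s $ i * ?z s $ j) * w $ j) = (\<Sum>s=1..t. (?z s \<bullet> w) * ?z s $ i)"
      unfolding sum_distrib_right
      by (subst sum.swap) (simp add: inner_vec_def sum_distrib_right sum_distrib_left mult_ac)
    finally show ?thesis by (simp add: design_op_def sum_component)
  qed
  then show ?thesis by (simp add: vec_eq_iff)
qed

text \<open>The quadratic form dominates the squared norm, hence the kernel is trivial and
  \<open>matrix_inv\<close> is a genuine inverse.\<close>

lemma design_matrix_inv:
  "design_op (\<lambda>s. regressor (x s) (q s)) t (matrix_inv (design_matrix 1 x q t) *v v) = v"
proof -
  let ?V = "design_matrix 1 x q t"
  have "w = 0" if "?V *v w = 0" for w
  proof -
    have "(norm w)\<^sup>2 \<le> w \<bullet> (?V *v w)" unfolding design_matrix_mult by (rule design_op_ge)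
    then show ?thesis using that by simp
  qed
  then have "\<exists>B. B ** ?V = mat 1"
    by (simp add: matrix_left_invertible_ker)
  then have "invertible ?V"
    using invertible_left_inverse by blast
  then have "?V ** matrix_inv ?V = mat 1"
    unfolding invertible_def matrix_inv_def by (rule someI2_ex) simp
  then have "?V *v (matrix_inv ?V *v v) = v"
    by (simp add: matrix_vector_mul_assoc)
  then show ?thesis by (simp add: design_matrix_mult)
qed

text \<open>Feeds Cramer's rule, through which the inverse is seen to depend measurably on the
  prices.\<close>

lemma design_matrix_det: "det (design_matrix 1 x q t) \<noteq> 0"
proof -
  have "w = 0" if "design_matrix 1 x q t *v w = 0" for w
    using design_op_ge[of w "\<lambda>s. regressor (x s) (q s)" t] that by (simp add: design_matrix_mult)
  then have "\<exists>B. B ** design_matrix 1 x q t = mat 1" by (simp add: matrix_left_invertible_ker)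
  then show ?thesis using invertible_left_inverse invertible_det_nz by blast
qed

text \<open>Cauchy-Schwarz for the inner product of the design. With \<open>u\<close> the inverse
  design applied to a regressor, it bounds a prediction error by a width times the estimation
  error.\<close>

lemma design_op_cauchy:
  "(design_op z t u \<bullet> v)\<^sup>2 \<le> (u \<bullet> design_op z t u) * (v \<bullet> design_op z t v)"
proof -
  let ?B = "\<lambda>u v. u \<bullet> design_op z t v"
  have lin: "linear (design_op z t)" by (rule design_op_linear)
  have nn: "?B w w \<ge> 0" for w using design_op_ge[of w z t] zero_le_power2[of "norm w"] by linarith
  show ?thesis
  proof (cases "?B u u = 0")
    case True
    then have "u = 0" using design_op_ge[of u z t] by simp
    then show ?thesis using nn by (simp add: linear_0[OF lin])
  next
    case False
    then have p: "?B u u > 0" using nn[of u] by simp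
    \<comment> \<open>The minimiser of the form along the line
      \<open>v - r *\<^sub>R u\<close>.\<close>
    define r where "r = ?B u v / ?B u u"
    have "0 \<le> ?B (v - r *\<^sub>R u) (v - r *\<^sub>R u)" by (rule nn)
    also have "\<dots> = ?B v v - 2 * r * ?B u v + r\<^sup>2 * ?B u u"
      using design_op_sym[of v z t u]
      by (simp add: linear_diff[OF lin] linear_scale[OF lin] inner_diff_left inner_diff_right inner_commute power2_eq_square algebra_simps)
    also have "\<dots> = ?B v v - (?B u v)\<^sup>2 / ?B u u"
      using p by (simp add: r_def power2_eq_square field_simps)
    finally show ?thesis using p by (simp add: design_op_sym[symmetric] field_simps)
  qed
qed

text \<open>Each rank-one update divides the Gaussian mass by
  \<open>sqrt (1 + z s \<bullet> u s)\<close>, the trace bound limits the total loss of mass, and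
  logarithms turn the product into a sum. Here \<open>u s\<close> is the inverse of the design
  before period \<open>s\<close>, applied to \<open>z s\<close>.\<close>

lemma elliptical_potential:
  fixes z u :: "nat \<Rightarrow> 'a::euclidean_space"
  assumes u: "\<And>s. s \<in> {1..T} \<Longrightarrow> design_op z (s - 1) (u s) = z s"
    and z: "\<And>s. s \<in> {1..T} \<Longrightarrow> norm (z s) \<le> 1"
  shows "(\<Sum>s=1..T. z s \<bullet> u s) \<le> 2 * DIM('a) * ln (1 + T / DIM('a))"
proof -
  let ?n = "DIM('a)"
  \<comment> \<open>The design is at least the identity, so its inverse does not enlarge
    \<open>z s\<close>. The upper bound 1 is what permits the estimate of each term by a
    logarithm.\<close>
  have k: "0 \<le> z s \<bullet> u s" "z s \<bullet> u s \<le> 1" if s: "s \<in> {1..T}" for s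
  proof -
    have le: "(norm (u s))\<^sup>2 \<le> z s \<bullet> u s"
      using design_op_ge[of "u s" z "s - 1"] u[OF s] by (simp add: inner_commute)
    then show "0 \<le> z s \<bullet> u s" using zero_le_power2[of "norm (u s)"] by linarith
    have cs: "z s \<bullet> u s \<le> norm (u s)"
      using norm_cauchy_schwarz[of "z s" "u s"] mult_right_mono[OF z[OF s], of "norm (u s)"] by simp
    have "norm (u s) \<le> 1"
    proof (rule ccontr)
      assume "\<not> ?thesis"
      then have "norm (u s) * 1 < norm (u s) * norm (u s)" by (intro mult_strict_left_mono) auto
      then have "norm (u s) < (norm (u s))\<^sup>2" by (simp add: power2_eq_square)
      with le cs show False by linarith
    qed
    with cs show "z s \<bullet> u s \<le> 1" by linarith
  qed
  have tel: "gauss_mass (\<lambda>w::'a. w) = ennreal (\<Prod>s=1..t. sqrt (1 + z s \<bullet> u s)) * gauss_mass (design_op z t)" if "t \<le> T" for t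
    using that
  proof (induction t)
    case 0
    then show ?case by (simp add: design_op_def[abs_def])
  next
    case (Suc t)
    have s: "Suc t \<in> {1..T}" using Suc by simp
    have eq: "(\<lambda>w. design_op z t w + (z (Suc t) \<bullet> w) *\<^sub>R z (Suc t)) = design_op z (Suc t)"
      by (simp add: design_op_def[abs_def] add.assoc)
    have "gauss_mass (design_op z t) = ennreal (sqrt (1 + z (Suc t) \<bullet> u (Suc t))) * gauss_mass (design_op z (Suc t))"
      using gauss_mass_rank_one[OF design_op_linear design_op_sym, of z t "u (Suc t)" "z (Suc t)"] u[OF s] k(1)[OF s]
      by (simp add: eq)
    moreover have "(\<Prod>s=1..t. sqrt (1 + z s \<bullet> u s)) \<ge> 0"
      using Suc k(1) by (intro prod_nonneg) auto
    ultimately show ?case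
      using Suc k(1)[OF s] by (simp add: mult.assoc[symmetric] ennreal_mult'[symmetric])
  qed
  let ?P = "\<Prod>s=1..T. sqrt (1 + z s \<bullet> u s)"
  let ?C = "sqrt (1 + T / ?n) ^ ?n"
  have P: "?P \<ge> 0" using k(1) by (intro prod_nonneg) auto
  have "gauss_mass (\<lambda>w::'a. w) \<le> ennreal ?C * gauss_mass (design_op z T)"
    using gauss_mass_trace_bound[of "{1..T}" z "real T"] z by (simp add: design_op_def[abs_def])
  moreover have m: "gauss_mass (\<lambda>w::'a. w) = ennreal (sqrt (2 * pi) ^ ?n)"
    using gauss_mass_scaleR[of 1, where 'a='a] by simp
  moreover have "gauss_mass (design_op z T) \<le> gauss_mass (\<lambda>w::'a. w)"
    unfolding gauss_mass_def using design_op_ge[of _ z T]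
    by (intro nn_integral_mono ennreal_leI) (simp add: dot_square_norm)
  \<comment> \<open>This mass is finite and, by the telescoped product, positive; both are needed to
    cancel it.\<close>
  ultimately obtain G where G: "gauss_mass (design_op z T) = ennreal G" "G \<ge> 0"
    by (cases "gauss_mass (design_op z T)") (auto simp: top_unique)
  have "ennreal (?P * G) = ennreal (sqrt (2 * pi) ^ ?n)"
    using tel[of T] m G P by (simp add: ennreal_mult')
  then have PG: "?P * G = sqrt (2 * pi) ^ ?n" using P G by (subst (asm) ennreal_inj) auto
  then have Gpos: "G > 0" using G by (cases "G = 0") auto
  have "ennreal (?P * G) \<le> ennreal (?C * G)"
    using \<open>gauss_mass (\<lambda>w::'a. w) \<le> ennreal ?C * gauss_mass (design_op z T)\<close> m G PG by (simp add: ennreal_mult')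
  then have "?P * G \<le> ?C * G" using G by (subst (asm) ennreal_le_iff) auto
  then have PC: "?P \<le> ?C" using Gpos by simp
  have Ppos: "0 < ?P" using k(1) by (intro prod_pos) (auto simp: add_pos_nonneg)
  have "(\<Sum>s=1..T. z s \<bullet> u s) \<le> (\<Sum>s=1..T. 4 * ln (sqrt (1 + z s \<bullet> u s)))"
  proof (rule sum_mono)
    fix s assume s: "s \<in> {1..T}"
    let ?k = "z s \<bullet> u s"
    \<comment> \<open>On the unit interval this yields \<open>?k \<le> 2 * ln (1 + ?k)\<close>; the
      factor 4 below accounts for the square root.\<close>
    have "ln (1 / (1 + ?k)) \<le> 1 / (1 + ?k) - 1" using k(1)[OF s] by (intro ln_le_minus_one) auto
    also have "\<dots> \<le> - ?k / 2" using k[OF s] by (simp add: field_simps mult_left_le)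
    finally have "?k \<le> 2 * ln (1 + ?k)" using k(1)[OF s] by (simp add: ln_div)
    then show "?k \<le> 4 * ln (sqrt (1 + ?k))" using k(1)[OF s] by (simp add: ln_sqrt)
  qed
  also have "\<dots> = 4 * ln ?P"
  proof -
    have "sqrt (1 + z s \<bullet> u s) > 0" if "s \<in> {1..T}" for s
      using k(1)[OF that] by (simp add: add_pos_nonneg)
    then have "\<And>s. s \<in> {1..T} \<Longrightarrow> sqrt (1 + z s \<bullet> u s) \<noteq> 0"
      by (metis less_irrefl)
    then have "ln ?P = (\<Sum>s=1..T. ln (sqrt (1 + z s \<bullet> u s)))"
      by (rule ln_prod[OF finite_atLeastAtMost])
    then show ?thesis by (simp add: sum_distrib_left)
  qed
  also have "\<dots> \<le> 4 * ln ?C" using PC Ppos by simp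
  also have "\<dots> = 2 * ?n * ln (1 + T / ?n)"
    by (simp add: ln_realpow ln_sqrt add_pos_nonneg)
  finally show ?thesis .
qed

section \<open>Positive semidefinite square roots of two-by-two matrices\<close>

lemma nonneg_quadratic_form_discriminant:
  fixes a b c :: real
  assumes q: "\<And>s r. 0 \<le> a * s\<^sup>2 + 2 * b * s * r + c * r\<^sup>2"
  shows "0 \<le> a" "0 \<le> c" "0 \<le> a * c - b\<^sup>2"
proof -
  show a: "0 \<le> a" using q[of 1 0] by simp
  show "0 \<le> c" using q[of 0 1] by simp
  show "0 \<le> a * c - b\<^sup>2"
  proof (cases "a = 0")
    case True
    have "b = 0"
    proof (rule ccontr)
      assume b0: "b \<noteq> 0"
      \<comment> \<open>With \<open>a = 0\<close> and \<open>r = 1\<close> the form is affine in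
        \<open>s\<close>, and at this point it equals -1.\<close>
      have "0 \<le> 2 * b * (- (c + 1) / (2 * b)) + c" using q[of "- (c + 1) / (2 * b)" 1] True by simp
      then show False using b0 by simp
    qed
    then show ?thesis using True by simp
  next
    case False
    have "0 \<le> a * (a * c - b\<^sup>2)" using q[of b "- a"] by (simp add: power2_eq_square algebra_simps)
    then show ?thesis using False a by (simp add: zero_le_mult_iff)
  qed
qed

text \<open>By Cayley-Hamilton, a root times its trace equals \<open>A\<close> plus its determinant
  times the identity. The determinant must be \<open>d\<close>, and the squared trace must be the
  trace of \<open>A\<close> plus \<open>2 * d\<close>. This settles uniqueness for the definite
  description and yields a closed formula from which measurability can be read off.\<close>

lemma psd_sqrt_2x2:
  fixes A :: "real^2^2"
  assumes sym: "transpose A = A" and psd: "\<And>v. 0 \<le> v \<bullet> (A *v v)"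
  defines "d \<equiv> sqrt (A $ 1 $ 1 * A $ 2 $ 2 - (A $ 1 $ 2)\<^sup>2)"
  shows "psd_sqrt A = (1 / sqrt (A $ 1 $ 1 + A $ 2 $ 2 + 2 * d)) *\<^sub>R (A + d *\<^sub>R mat 1)" (is "_ = ?S")
    and "transpose (psd_sqrt A) = psd_sqrt A"
    and "psd_sqrt A ** psd_sqrt A = A"
proof -
  define a b c \<tau> where "a = A $ 1 $ 1" and "b = A $ 1 $ 2" and "c = A $ 2 $ 2" and "\<tau> = sqrt (a + c + 2 * d)"
  have "transpose A $ 2 $ 1 = A $ 2 $ 1" by (simp only: sym)
  then have b': "A $ 2 $ 1 = b" by (simp add: transpose_def b_def)
  have q: "0 \<le> a * s\<^sup>2 + 2 * b * s * r + c * r\<^sup>2" for s r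
    using psd[of "vector [s, r]"] b'
    by (simp add: inner_vec_def matrix_vector_mult_def UNIV_2 a_def[symmetric] b_def[symmetric] c_def[symmetric]
        power2_eq_square algebra_simps)
  note a = nonneg_quadratic_form_discriminant(1)[OF q]
    and c = nonneg_quadratic_form_discriminant(2)[OF q]
    and disc = nonneg_quadratic_form_discriminant(3)[OF q]
  have d: "d \<ge> 0" "d\<^sup>2 = a * c - b\<^sup>2" using disc by (auto simp: d_def a_def b_def c_def)
  have \<tau>: "\<tau> \<ge> 0" "\<tau>\<^sup>2 = a + c + 2 * d" using a c d by (auto simp: \<tau>_def)
  \<comment> \<open>In the degenerate case \<open>A\<close> vanishes, and the formula still agrees
    because \<open>1 / 0 = 0\<close>.\<close>
  have zero: "a = 0 \<and> b = 0 \<and> c = 0 \<and> d = 0" if "\<tau> = 0"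
    using that \<tau>(2) a c d by (auto simp: add_nonneg_eq_0_iff)
  have S: "?S = (1 / \<tau>) *\<^sub>R (A + d *\<^sub>R mat 1)" by (simp add: \<tau>_def a_def c_def)
  let ?P = "\<lambda>S. transpose S = S \<and> (\<forall>v. 0 \<le> v \<bullet> (S *v v)) \<and> S ** S = A"
  have ex: "?P ?S"
  proof (intro conjI allI)
    show "transpose ?S = ?S" unfolding S using b'
      by (simp add: transpose_def vec_eq_iff mat_def forall_2 b_def)
    fix v
    have "v \<bullet> (?S *v v) = (1 / \<tau>) * (v \<bullet> (A *v v) + d * (v \<bullet> v))"
      unfolding S by (simp add: scaleR_matrix_vector_assoc[symmetric] matrix_vector_mult_add_rdistrib inner_add_right)
    then show "0 \<le> v \<bullet> (?S *v v)" using psd[of v] d \<tau> by simp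
  next
    have t: "(a + d)\<^sup>2 + b\<^sup>2 = \<tau>\<^sup>2 * a" "(a + d) * b + b * (c + d) = \<tau>\<^sup>2 * b" "b\<^sup>2 + (c + d)\<^sup>2 = \<tau>\<^sup>2 * c"
      unfolding \<tau>(2) using d(2) by (simp_all add: power2_eq_square algebra_simps)
    define B where "B = A + d *\<^sub>R mat 1"
    have B: "B $ 1 $ 1 = a + d" "B $ 1 $ 2 = b" "B $ 2 $ 1 = b" "B $ 2 $ 2 = c + d"
      using b' by (simp_all add: B_def mat_def a_def b_def c_def)
    have BB: "B ** B = \<tau>\<^sup>2 *\<^sub>R A"
      unfolding vec_eq_iff forall_2
      using t b' by (simp add: matrix_matrix_mult_def UNIV_2 B power2_eq_square[of "_ + _"] power2_eq_square[of b]
          a_def[symmetric] b_def[symmetric] c_def[symmetric] mult.commute)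
    have "?S ** ?S = (1 / \<tau>) *\<^sub>R B ** (1 / \<tau>) *\<^sub>R B" unfolding S B_def ..
    also have "\<dots> = (1 / \<tau>\<^sup>2) *\<^sub>R (B ** B)"
      by (simp add: matrix_matrix_mult_def vec_eq_iff UNIV_2 power2_eq_square add_divide_distrib)
    also note BB
    also have "(1 / \<tau>\<^sup>2) *\<^sub>R \<tau>\<^sup>2 *\<^sub>R A = A"
      using zero b' by (cases "\<tau> = 0") (auto simp: vec_eq_iff forall_2 a_def b_def c_def)
    finally show "?S ** ?S = A" .
  qed
  have uniq: "R = ?S" if R: "?P R" for R
  proof -
    define p s r where "p = R $ 1 $ 1" and "s = R $ 1 $ 2" and "r = R $ 2 $ 2"
    have "transpose R $ 2 $ 1 = R $ 2 $ 1" using R by (simp only:)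
    then have s': "R $ 2 $ 1 = s" by (simp add: transpose_def s_def)
    have q: "0 \<le> p * x\<^sup>2 + 2 * s * x * y + r * y\<^sup>2" for x y
      using R[THEN conjunct2, THEN conjunct1, rule_format, of "vector [x, y]"] s'
      by (simp add: inner_vec_def matrix_vector_mult_def UNIV_2 p_def[symmetric] s_def[symmetric] r_def[symmetric]
        power2_eq_square algebra_simps)
    note p = nonneg_quadratic_form_discriminant(1)[OF q]
      and r = nonneg_quadratic_form_discriminant(2)[OF q]
      and ds = nonneg_quadratic_form_discriminant(3)[OF q]
    have RR: "(R ** R) $ i $ j = A $ i $ j" for i j using R by simp
    have e: "p\<^sup>2 + s\<^sup>2 = a" "s * (p + r) = b" "s\<^sup>2 + r\<^sup>2 = c"
      using RR[of 1 1] RR[of 1 2] RR[of 2 2] s'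
      by (simp_all add: matrix_matrix_mult_def UNIV_2 p_def[symmetric] s_def[symmetric] r_def[symmetric]
          a_def[symmetric] b_def[symmetric] c_def[symmetric] power2_eq_square algebra_simps)
    \<comment> \<open>Identifies the determinant of \<open>R\<close>, and after it the trace;
      semidefiniteness fixes both signs.\<close>
    have "(p * r - s\<^sup>2)\<^sup>2 = d\<^sup>2" unfolding d(2) e[symmetric] by (simp add: power2_eq_square algebra_simps)
    then have ds': "p * r - s\<^sup>2 = d" using ds d(1) by (simp add: power2_eq_iff_nonneg)
    have "(p + r)\<^sup>2 = \<tau>\<^sup>2" unfolding \<tau>(2) e[symmetric] ds'[symmetric] by (simp add: power2_eq_square algebra_simps)
    then have tr: "p + r = \<tau>" using p r \<tau>(1) by (simp add: power2_eq_iff_nonneg)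
    have "p * \<tau> = a + d" "s * \<tau> = b" "r * \<tau> = c + d"
      unfolding tr[symmetric] e[symmetric] ds'[symmetric] by (simp_all add: power2_eq_square algebra_simps)
    moreover have "p = 0 \<and> s = 0 \<and> r = 0" if "\<tau> = 0"
      using that tr p r ds' zero by (simp add: add_nonneg_eq_0_iff)
    ultimately have "p = (a + d) / \<tau>" "s = b / \<tau>" "r = (c + d) / \<tau>"
      by (simp_all add: eq_divide_eq)
    then have "R $ 1 $ 1 = ?S $ 1 $ 1" "R $ 1 $ 2 = ?S $ 1 $ 2" "R $ 2 $ 1 = ?S $ 2 $ 1" "R $ 2 $ 2 = ?S $ 2 $ 2"
      unfolding S using b' s' by (simp_all add: mat_def a_def b_def c_def p_def s_def r_def)
    then show ?thesis by (simp only: vec_eq_iff forall_2 simp_thms)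
  qed
  have eq: "psd_sqrt A = ?S" unfolding psd_sqrt_def
    by (rule the_equality[where P = ?P, OF ex uniq])
  show "psd_sqrt A = ?S" by (rule eq)
  show "transpose (psd_sqrt A) = psd_sqrt A" unfolding eq by (rule ex[THEN conjunct1])
  show "psd_sqrt A ** psd_sqrt A = A" unfolding eq by (rule ex[THEN conjunct2, THEN conjunct2])
qed

section \<open>The quasi-likelihood estimator\<close>

text \<open>\<open>inv g\<close> inverts \<open>g\<close> only on its range, which may be smaller
  than the real line; the intermediate value theorem places \<open>u\<close> in it.\<close>

lemma strict_mono_inverse_on:
  fixes g :: "real \<Rightarrow> real"
  assumes mono: "strict_mono g" and cont: "\<And>z. isCont g z"
    and u: "g a \<le> u" "u \<le> g b"
  shows "g (inv g u) = u" "a \<le> inv g u" "inv g u \<le> b"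
proof -
  have "g a \<le> g b" using u by linarith
  then have ab: "a \<le> b" using strict_mono_less_eq[OF mono] by simp
  obtain v where v: "a \<le> v" "v \<le> b" "g v = u"
    using IVT[of g a u b] u ab cont by auto
  have "inv g u = v" using v(3) strict_mono_imp_inj_on[OF mono] by (auto intro: inv_f_eq)
  then show "g (inv g u) = u" "a \<le> inv g u" "inv g u \<le> b" using v by auto
qed

text \<open>The derivative may be discontinuous, but it is a pointwise limit of difference
  quotients.\<close>

lemma borel_measurable_deriv:
  fixes g :: "real \<Rightarrow> real"
  assumes diff: "\<And>z. g differentiable (at z)"
  shows "deriv g \<in> borel_measurable borel"
proof (rule borel_measurable_LIMSEQ_real)
  have "isCont g z" for z using diff differentiable_imp_continuous_within by blast
  then have [measurable]: "g \<in> borel_measurable borel"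
    by (intro borel_measurable_continuous_onI continuous_at_imp_continuous_on) auto
  show "(\<lambda>z. (g (z + 1 / real (Suc n)) - g z) / (1 / real (Suc n))) \<in> borel_measurable borel" for n by measurable
  fix z
  have "(g has_real_derivative deriv g z) (at z)"
    using diff[of z] by (simp add: DERIV_deriv_iff_real_differentiable)
  then have lim: "((\<lambda>h. (g (z + h) - g z) / h) \<longlongrightarrow> deriv g z) (at 0)" by (simp add: DERIV_def)
  have "filterlim (\<lambda>n. 1 / real (Suc n)) (at 0) sequentially"
    unfolding filterlim_at using LIMSEQ_inverse_real_of_nat by (simp add: inverse_eq_divide)
  from filterlim_compose[OF lim this]
  show "(\<lambda>n. (g (z + 1 / real (Suc n)) - g z) / (1 / real (Suc n))) \<longlonglongrightarrow> deriv g z" .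
qed

text \<open>Substituting \<open>u = g v\<close> reduces the integrand to \<open>g v - D\<close>.
  Since \<open>deriv g\<close> may be discontinuous, the value comes from the gauge integral of an
  antiderivative, and Lebesgue integrability from measurability and the lower bound
  \<open>m\<close>.\<close>

lemma LBINT_quasi_likelihood:
  fixes g \<Gamma> :: "real \<Rightarrow> real"
  assumes mono: "strict_mono g" and diff: "\<And>z. g differentiable (at z)"
    and \<Gamma>: "\<And>z. (\<Gamma> has_real_derivative g z) (at z)"
    and m: "0 < m" "\<And>z. z \<in> {a..b} \<Longrightarrow> m \<le> deriv g z" and ab: "a \<le> b"
  shows "(LBINT u=ereal (g a)..ereal (g b). (u - D) / deriv g (inv g u)) = \<Gamma> b - \<Gamma> a - D * (b - a)"
proof -
  have cont: "isCont g z" for z using diff differentiable_imp_continuous_within by blast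
  have dg: "(g has_real_derivative deriv g z) (at z)" for z
    using diff[of z] by (simp add: DERIV_deriv_iff_real_differentiable)
  have gab: "g a \<le> g b" using ab strict_mono_less_eq[OF mono] by simp
  note inv = strict_mono_inverse_on[OF mono cont]
  let ?f = "\<lambda>u. (u - D) / deriv g (inv g u)"
  have inv_g: "inv g (g v) = v" for v
    using strict_mono_imp_inj_on[OF mono] by (simp add: inv_f_f)
  have cont_inv: "isCont (inv g) (g v)" for v
    by (rule isCont_inverse_function[of 1]) (auto simp: inv_g cont)
  have dF: "((\<lambda>u. \<Gamma> (inv g u) - D * inv g u) has_real_derivative ?f u) (at u)" if u: "u \<in> {g a..g b}" for u
  proof -
    let ?v = "inv g u"
    have v: "g ?v = u" "?v \<in> {a..b}" using inv[of a u b] u by auto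
    have nz: "deriv g ?v \<noteq> 0" using m(1) m(2)[OF v(2)] by linarith
    have "g (a - 1) < u" "u < g (b + 1)"
      using u strict_mono_less[OF mono, of "a - 1" a] strict_mono_less[OF mono, of b "b + 1"] by auto
    then have "(inv g has_real_derivative inverse (deriv g ?v)) (at u)"
      using inv[of "a - 1" _ "b + 1"] dg[of ?v] nz cont_inv[of ?v] v(1)
      by (intro DERIV_inverse_function[of g]) auto
    moreover have "?f u = g ?v * inverse (deriv g ?v) - D * inverse (deriv g ?v)"
      using v(1) by (simp add: field_simps diff_divide_distrib)
    ultimately show ?thesis
      by (auto intro!: derivative_eq_intros DERIV_chain2[OF \<Gamma>])
  qed
  have "(?f has_integral (\<Gamma> (inv g (g b)) - D * inv g (g b)) - (\<Gamma> (inv g (g a)) - D * inv g (g a))) {g a..g b}"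
    using gab dF
    by (intro fundamental_theorem_of_calculus)
      (auto simp: has_real_derivative_iff_has_vector_derivative[symmetric] intro: DERIV_subset)
  then have int: "integral {g a..g b} ?f = \<Gamma> b - \<Gamma> a - D * (b - a)"
    by (simp add: inv_g integral_unique algebra_simps)
  have inv_meas: "(\<lambda>u. indicator {g a..g b} u *\<^sub>R inv g u) \<in> borel_measurable borel"
  proof (rule borel_measurable_continuous_on_indicator)
    have "isCont (inv g) u" if "u \<in> {g a..g b}" for u
      using cont_inv[of "inv g u"] inv(1)[of a u b] that by simp
    then show "continuous_on {g a..g b} (inv g)" by (intro continuous_at_imp_continuous_on) auto
  qed auto
  note borel_measurable_deriv[OF diff, measurable] inv_meas[unfolded real_scaleR_def, measurable]
  let ?C = "(\<bar>g a\<bar> + \<bar>g b\<bar> + \<bar>D\<bar>) / m"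
  \<comment> \<open>The indicator inside the argument of \<open>deriv g\<close> replaces
    \<open>inv g\<close> by a function known to be measurable on the whole line.\<close>
  let ?h = "\<lambda>u. indicator {g a..g b} u * ((u - D) / deriv g (indicator {g a..g b} u * inv g u))"
  have h: "indicator {g a..g b} u *\<^sub>R ?f u = ?h u" for u by (simp add: indicator_def)
  have bd: "norm (?h u) \<le> ?C * indicator {g a..g b} u" for u
  proof (cases "u \<in> {g a..g b}")
    case True
    then have v: "inv g u \<in> {a..b}" using inv[of a u b] by auto
    have "\<bar>u - D\<bar> / deriv g (inv g u) \<le> (\<bar>g a\<bar> + \<bar>g b\<bar> + \<bar>D\<bar>) / m"
      using m(1) m(2)[OF v] True by (intro frac_le) auto
    then show ?thesis using True m(1) m(2)[OF v] by simp
  qed simp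
  have "integrable lborel (\<lambda>u. ?C * indicator {g a..g b} u)" by (simp add: emeasure_lborel_Icc_eq)
  then have "integrable lborel ?h"
    by (rule Bochner_Integration.integrable_bound) (use bd m(1) in \<open>auto intro!: AE_I2\<close>)
  then have "set_integrable lborel {g a..g b} ?f"
    unfolding set_integrable_def h .
  then have "(LBINT u:{g a..g b}. ?f u) = integral {g a..g b} ?f"
    by (rule set_borel_integral_eq_integral(2))
  then show ?thesis using int gab by (simp add: interval_integral_Icc)
qed

lemma ex_antiderivative:
  fixes g :: "real \<Rightarrow> real"
  assumes "\<And>z. isCont g z"
  shows "\<exists>\<Gamma>. \<forall>z. (\<Gamma> has_real_derivative g z) (at z)"
  using einterval_antiderivative[of "-\<infinity>" "\<infinity>" g] assms
  by (auto simp: has_real_derivative_iff_has_vector_derivative)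

lemma borel_measurable_nat_fun:
  fixes f :: "'w \<Rightarrow> nat \<Rightarrow> real"
  assumes "\<And>s. (\<lambda>w. f w s) \<in> borel_measurable N"
  shows "f \<in> borel_measurable N"
proof -
  have "f \<in> measurable N (Pi\<^sub>M UNIV (\<lambda>_. borel))"
    using assms by (intro measurable_PiM_single') auto
  then show ?thesis using sets_PiM_equal_borel measurable_cong_sets by blast
qed

locale pricing_model =
  fixes \<X> :: "(real^'n) set"
    and g :: "real \<Rightarrow> real"
    and \<alpha> \<beta> :: "real^'n"
    and pmin pmax \<theta>max Dmax gmin gmax \<sigma> :: real
    and T :: nat
    and x :: "nat \<Rightarrow> real^'n"
  assumes prices: "0 \<le> pmin" "pmin \<le> pmax"
    and sigma: "0 \<le> \<sigma>"
    and horizon: "6 \<le> T"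
    and \<theta>max: "0 < \<theta>max"
    and true_param: "stack \<alpha> \<beta> \<in> cball 0 \<theta>max"
    and demand_bounds: "\<And>y q. y \<in> \<X> \<Longrightarrow> q \<in> {pmin..pmax} \<Longrightarrow>
          0 \<le> g (y \<bullet> \<alpha> + (y \<bullet> \<beta>) * q) \<and> g (y \<bullet> \<alpha> + (y \<bullet> \<beta>) * q) \<le> Dmax"
    and covariate_bounds: "\<And>y q. y \<in> \<X> \<Longrightarrow> q \<in> {pmin..pmax} \<Longrightarrow> norm (regressor y q) \<le> 1"
    and g_mono: "strict_mono g"
    and g_diff: "\<And>z. g differentiable (at z)"
    and gmin: "0 < gmin"
    and g_deriv: "\<And>y \<theta> q. y \<in> \<X> \<Longrightarrow> \<theta> \<in> enlarged_params gmin \<theta>max \<sigma> T \<Longrightarrow>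
          q \<in> {pmin..pmax} \<Longrightarrow>
          gmin \<le> deriv g (y \<bullet> upper \<theta> + (y \<bullet> lower \<theta>) * q) \<and>
          deriv g (y \<bullet> upper \<theta> + (y \<bullet> lower \<theta>) * q) \<le> gmax"
    and covariates: "\<And>t. t \<in> {1..T} \<Longrightarrow> x t \<in> \<X>"
begin

section \<open>Constants of the model and the range on which the slope of the link is
  controlled\<close>

definition ncov :: nat where "ncov = CARD('n)"
definition \<gamma> :: real where "\<gamma> = gamma_bar gmin \<theta>max \<sigma> ncov T"
text \<open>Truncation radius of the draws: \<open>\<gamma> * \<kappa>\<close> is the radius of the
  enlargement, and \<open>2 * exp (- \<kappa>\<^sup>2 / 4)\<close> equals 1 / (2 T^2).\<close>

definition \<kappa> :: real where "\<kappa> = 2 * sqrt (ln (4 * (real T)\<^sup>2))"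
text \<open>Squared confidence radius in units of \<open>\<sigma>\<close>:
  \<open>exp (\<rho> / 2)\<close> is \<open>T\<close> times the d-th power of 1 + T / 2d, where d is
  \<open>ncov\<close>.\<close>

definition \<rho> :: real where
  "\<rho> = 2 * ln (real T) + 2 * real ncov * ln ((2 * real ncov + real T) / (2 * real ncov))"

lemma ncov_pos: "0 < ncov"
  by (simp add: ncov_def)

lemma \<rho>_nonneg: "0 \<le> \<rho>"
  using horizon ncov_pos by (auto simp: \<rho>_def intro!: add_nonneg_nonneg mult_nonneg_nonneg ln_ge_zero)

lemma \<gamma>_eq: "\<gamma> = 2 * \<theta>max + 2 * \<sigma> / gmin * sqrt \<rho>"
  by (simp add: \<gamma>_def gamma_bar_def \<rho>_def)

lemma \<gamma>_pos: "0 < \<gamma>"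
  unfolding \<gamma>_eq using \<theta>max sigma gmin \<rho>_nonneg by (intro add_pos_nonneg) auto

text \<open>Lets numerical constants be absorbed by multiples of the square root of this logarithm,
  which is thus at least 2.\<close>

lemma ln_T: "4 \<le> ln (4 * (real T)\<^sup>2)"
proof -
  have "exp (4::real) = exp 1 ^ 4" by (simp add: exp_of_nat_mult[symmetric])
  also have "\<dots> \<le> 3 ^ 4" by (intro power_mono exp_le) auto
  also have "\<dots> \<le> 4 * (real T)\<^sup>2" using horizon power_mono[of 6 "real T" 2] by simp
  finally show ?thesis using horizon by (simp add: ln_ge_iff)
qed

lemma \<kappa>_nonneg: "0 \<le> \<kappa>"
  using ln_T by (simp add: \<kappa>_def)

text \<open>Turns a condition on parameter vectors into one on an interval of index values, to which
  the mean value theorem applies.\<close>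

lemma deriv_bounds:
  assumes y: "y \<in> \<X>" "q \<in> {pmin..pmax}" and v: "\<bar>v\<bar> \<le> (\<theta>max + \<gamma> * \<kappa>) * norm (regressor y q)"
  shows "gmin \<le> deriv g v" "deriv g v \<le> gmax"
proof -
  let ?z = "regressor y q"
  let ?R = "\<theta>max + \<gamma> * \<kappa>"
  \<comment> \<open>The shortest vector having inner product \<open>v\<close> with the regressor.
    For a zero regressor \<open>v\<close> is 0, and division by zero gives the zero vector.\<close>
  define \<theta> where "\<theta> = (v / (norm ?z)\<^sup>2) *\<^sub>R ?z"
  have zv: "?z \<bullet> \<theta> = v"
    using v by (cases "?z = 0") (auto simp: \<theta>_def dot_square_norm)
  have nonneg: "0 \<le> \<gamma> * \<kappa>" using \<gamma>_pos \<kappa>_nonneg by simp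
  have n: "norm \<theta> \<le> ?R"
  proof (cases "?z = 0")
    case False
    then have "norm \<theta> = \<bar>v\<bar> / norm ?z" by (simp add: \<theta>_def power2_eq_square)
    then show ?thesis using v False by (simp add: divide_le_eq)
  qed (use \<theta>max nonneg in \<open>auto simp: \<theta>_def\<close>)
  have "\<exists>\<theta>'\<in>cball 0 \<theta>max. norm (\<theta> - \<theta>') \<le> \<gamma> * \<kappa>"
  proof (cases "norm \<theta> \<le> \<theta>max")
    case True
    then show ?thesis using nonneg by (intro bexI[of _ \<theta>]) auto
  next
    case False
    then have n0: "norm \<theta> > 0" using \<theta>max by linarith
    \<comment> \<open>Radial projection onto the ball of radius \<open>\<theta>max\<close>.\<close>
    let ?\<theta>' = "(\<theta>max / norm \<theta>) *\<^sub>R \<theta>"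
    have "\<theta> - ?\<theta>' = (1 - \<theta>max / norm \<theta>) *\<^sub>R \<theta>" by (simp add: scaleR_diff_left)
    then have "norm (\<theta> - ?\<theta>') = \<bar>1 - \<theta>max / norm \<theta>\<bar> * norm \<theta>" by simp
    also have "\<dots> = norm \<theta> - \<theta>max" using False n0 by (simp add: abs_if field_simps)
    finally show ?thesis using n n0 \<theta>max by (intro bexI[of _ ?\<theta>']) auto
  qed
  moreover have "\<gamma> * \<kappa> = 4 * \<theta>max * sqrt (ln (4 * (real T)\<^sup>2)) + 4 * \<sigma> / gmin * sqrt (\<rho> * ln (4 * (real T)\<^sup>2))"
    by (simp add: \<gamma>_eq \<kappa>_def real_sqrt_mult algebra_simps)
  ultimately have "\<theta> \<in> enlarged_params gmin \<theta>max \<sigma> T"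
    by (simp add: enlarged_params_def \<rho>_def ncov_def)
  from g_deriv[OF y(1) this y(2)] show "gmin \<le> deriv g v" "deriv g v \<le> gmax"
    by (simp_all add: regressor_inner[symmetric] zv)
qed

text \<open>Points between two admissible index values are admissible, so
  \<open>deriv_bounds\<close> holds at the intermediate point of the mean value theorem.\<close>

lemma g_increment:
  assumes y: "y \<in> \<X>" "q \<in> {pmin..pmax}"
    and v: "\<bar>v\<bar> \<le> (\<theta>max + \<gamma> * \<kappa>) * norm (regressor y q)"
    and w: "\<bar>w\<bar> \<le> (\<theta>max + \<gamma> * \<kappa>) * norm (regressor y q)"
  shows "\<bar>g v - g w\<bar> \<le> gmax * \<bar>v - w\<bar>" "gmin * (v - w)\<^sup>2 \<le> (g v - g w) * (v - w)"
proof -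
  have *: "\<bar>g v - g w\<bar> \<le> gmax * \<bar>v - w\<bar> \<and> gmin * (v - w)\<^sup>2 \<le> (g v - g w) * (v - w)"
    if vw: "w < v" and v: "\<bar>v\<bar> \<le> (\<theta>max + \<gamma> * \<kappa>) * norm (regressor y q)"
    and w: "\<bar>w\<bar> \<le> (\<theta>max + \<gamma> * \<kappa>) * norm (regressor y q)" for v w
  proof -
    have "DERIV g z :> deriv g z" for z
      using g_diff[of z] by (simp add: DERIV_deriv_iff_real_differentiable)
    then obtain z where z: "w < z" "z < v" "g v - g w = (v - w) * deriv g z"
      using MVT2[OF vw, of g "deriv g"] by auto
    have "\<bar>z\<bar> \<le> (\<theta>max + \<gamma> * \<kappa>) * norm (regressor y q)" using z v w by linarith
    note b = deriv_bounds[OF y this]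
    have "gmin * ((v - w) * (v - w)) \<le> deriv g z * ((v - w) * (v - w))"
      using b by (intro mult_right_mono) auto
    then have "gmin * (v - w)\<^sup>2 \<le> (g v - g w) * (v - w)" unfolding z(3) by (simp add: power2_eq_square mult_ac)
    moreover have "\<bar>g v - g w\<bar> \<le> gmax * \<bar>v - w\<bar>"
      unfolding z(3) using b gmin vw by (simp add: abs_mult)
    ultimately show ?thesis by simp
  qed
  consider "w < v" | "w = v" | "v < w" by linarith
  then have "\<bar>g v - g w\<bar> \<le> gmax * \<bar>v - w\<bar> \<and> gmin * (v - w)\<^sup>2 \<le> (g v - g w) * (v - w)"
  proof cases
    case 3
    from *[OF 3 w v] show ?thesis
      by (simp add: abs_minus_commute power2_commute) (simp add: algebra_simps)
  qed (use *[of w v] v w in auto)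
  then show "\<bar>g v - g w\<bar> \<le> gmax * \<bar>v - w\<bar>" "gmin * (v - w)\<^sup>2 \<le> (g v - g w) * (v - w)" by auto
qed

lemma inner_ball_le:
  assumes "\<theta> \<in> cball 0 \<theta>max"
  shows "\<bar>regressor y q \<bullet> \<theta>\<bar> \<le> (\<theta>max + \<gamma> * \<kappa>) * norm (regressor y q)"
proof -
  have "\<bar>regressor y q \<bullet> \<theta>\<bar> \<le> norm (regressor y q) * norm \<theta>" by (rule Cauchy_Schwarz_ineq2)
  also have "\<dots> \<le> norm (regressor y q) * (\<theta>max + \<gamma> * \<kappa>)"
    using assms \<gamma>_pos \<kappa>_nonneg by (intro mult_left_mono) (auto intro: order_trans[of _ \<theta>max])
  finally show ?thesis by (simp add: mult.commute)
qed

text \<open>The gradient of the penalised quasi-likelihood.\<close>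

definition score :: "(nat \<Rightarrow> real) \<Rightarrow> (nat \<Rightarrow> real) \<Rightarrow> nat \<Rightarrow> real^('n + 'n) \<Rightarrow> real^('n + 'n)" where
  "score q D t \<theta> = - gmin *\<^sub>R \<theta> + (\<Sum>s=1..t. (D s - g (regressor (x s) (q s) \<bullet> \<theta>)) *\<^sub>R regressor (x s) (q s))"

text \<open>Strong concavity of the objective. The weight \<open>gmin\<close> of the penalty matches
  the lower bound on the slope, so both contributions combine to \<open>gmin\<close> times the
  design form.\<close>

lemma score_monotone:
  assumes t: "t \<le> T" and q: "\<And>s. s \<in> {1..t} \<Longrightarrow> q s \<in> {pmin..pmax}"
    and \<theta>: "\<theta> \<in> cball 0 \<theta>max" "\<theta>' \<in> cball 0 \<theta>max"
  shows "gmin * ((\<theta> - \<theta>') \<bullet> design_op (\<lambda>s. regressor (x s) (q s)) t (\<theta> - \<theta>'))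
    \<le> (score q D t \<theta>' - score q D t \<theta>) \<bullet> (\<theta> - \<theta>')"
proof -
  let ?z = "\<lambda>s. regressor (x s) (q s)"
  have "gmin * ((\<theta> - \<theta>') \<bullet> design_op ?z t (\<theta> - \<theta>'))
      = gmin * (norm (\<theta> - \<theta>'))\<^sup>2 + (\<Sum>s=1..t. gmin * (?z s \<bullet> \<theta> - ?z s \<bullet> \<theta>')\<^sup>2)"
    by (simp add: design_op_quad algebra_simps sum_distrib_left inner_diff_right)
  also have "\<dots> \<le> gmin * (norm (\<theta> - \<theta>'))\<^sup>2
      + (\<Sum>s=1..t. (g (?z s \<bullet> \<theta>) - g (?z s \<bullet> \<theta>')) * (?z s \<bullet> \<theta> - ?z s \<bullet> \<theta>'))"
  proof (intro add_left_mono sum_mono)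
    fix s assume s: "s \<in> {1..t}"
    then have "x s \<in> \<X>" using t covariates by auto
    from g_increment(2)[OF this q[OF s] inner_ball_le[OF \<theta>(1)] inner_ball_le[OF \<theta>(2)]]
    show "gmin * (?z s \<bullet> \<theta> - ?z s \<bullet> \<theta>')\<^sup>2
        \<le> (g (?z s \<bullet> \<theta>) - g (?z s \<bullet> \<theta>')) * (?z s \<bullet> \<theta> - ?z s \<bullet> \<theta>')" .
  qed
  also have "\<dots> = (score q D t \<theta>' - score q D t \<theta>) \<bullet> (\<theta> - \<theta>')"
    by (simp add: score_def inner_diff_left inner_add_left inner_sum_left power2_norm_eq_inner inner_diff_right
        algebra_simps sum_subtractf[symmetric] sum.distrib[symmetric] cong: sum.cong)
  finally show ?thesis .
qed

lemma isCont_g: "isCont g z"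
  using g_diff differentiable_imp_continuous_within by blast

text \<open>A maximiser over the ball may lie on its boundary, so the first-order condition is a
  variational inequality. Existence, without which \<open>arg_max_on\<close> says nothing, comes
  from continuity on the compact ball.\<close>

lemma qmle_first_order:
  fixes q D :: "nat \<Rightarrow> real"
  assumes t: "t \<le> T" and q: "\<And>s. s \<in> {1..t} \<Longrightarrow> q s \<in> {pmin..pmax}"
  shows "qmle g gmin \<theta>max 1 x q D t \<in> cball 0 \<theta>max"
    and "\<theta> \<in> cball 0 \<theta>max \<Longrightarrow>
      score q D t (qmle g gmin \<theta>max 1 x q D t) \<bullet> (\<theta> - qmle g gmin \<theta>max 1 x q D t) \<le> 0"
proof -
  let ?z = "\<lambda>s. regressor (x s) (q s)"
  obtain \<Gamma> where \<Gamma>: "\<And>z. (\<Gamma> has_real_derivative g z) (at z)"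
    using ex_antiderivative[of g] isCont_g by auto
  have cont\<Gamma>: "continuous_on A \<Gamma>" for A
    using \<Gamma> by (intro DERIV_continuous_on) (auto intro: DERIV_subset)
  define F where "F = (\<lambda>\<theta>. - (gmin / 2) * (norm \<theta>)\<^sup>2 - (\<Sum>s=1..t. \<Gamma> (?z s \<bullet> \<theta>) - \<Gamma> 0 - D s * (?z s \<bullet> \<theta>)))"
  let ?obj = "\<lambda>\<theta>. - (1 * gmin / 2) * (norm \<theta>)\<^sup>2 + (\<Sum>s=1..t. quasi_lik g (?z s) (D s) \<theta>)"
  have ql: "quasi_lik g (?z s) (D s) \<theta> = - (\<Gamma> (?z s \<bullet> \<theta>) - \<Gamma> 0 - D s * (?z s \<bullet> \<theta>))"
    if s: "s \<in> {1..t}" and \<theta>: "\<theta> \<in> cball 0 \<theta>max" for s \<theta>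
  proof -
    have xs: "x s \<in> \<X>" using s t covariates by auto
    have d: "gmin \<le> deriv g v" if "\<bar>v\<bar> \<le> \<bar>?z s \<bullet> \<theta>\<bar>" for v
      using deriv_bounds(1)[OF xs q[OF s]] order_trans[OF that inner_ball_le[OF \<theta>]] by blast
    note I = LBINT_quasi_likelihood[OF g_mono g_diff \<Gamma> gmin]
    show ?thesis
    \<comment> \<open>The sign of the index decides the orientation of the interval
      integral.\<close>
    proof (cases "0 \<le> ?z s \<bullet> \<theta>")
      case True
      have "(LBINT u=ereal (g 0)..ereal (g (?z s \<bullet> \<theta>)). (u - D s) / deriv g (inv g u)) = \<Gamma> (?z s \<bullet> \<theta>) - \<Gamma> 0 - D s * (?z s \<bullet> \<theta> - 0)"
        by (rule I) (use True d in auto)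
      then show ?thesis by (simp add: quasi_lik_def)
    next
      case False
      have "(LBINT u=ereal (g (?z s \<bullet> \<theta>))..ereal (g 0). (u - D s) / deriv g (inv g u)) = \<Gamma> 0 - \<Gamma> (?z s \<bullet> \<theta>) - D s * (0 - ?z s \<bullet> \<theta>)"
        by (rule I) (use False d in auto)
      then show ?thesis
        unfolding quasi_lik_def by (subst interval_integral_endpoints_reverse) simp
    qed
  qed
  have obj: "?obj \<theta> = F \<theta>" if "\<theta> \<in> cball 0 \<theta>max" for \<theta>
    using ql[OF _ that] by (simp add: F_def sum_negf[symmetric])
  have "continuous_on (cball 0 \<theta>max) F" unfolding F_def
    by (intro continuous_intros continuous_on_compose2[OF cont\<Gamma>[of UNIV]]) auto
  then obtain \<theta>0 where "\<theta>0 \<in> cball 0 \<theta>max" "\<forall>\<theta>\<in>cball 0 \<theta>max. F \<theta> \<le> F \<theta>0"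
    using continuous_attains_sup[of "cball 0 \<theta>max" F] \<theta>max by auto
  then have "is_arg_max ?obj (\<lambda>\<theta>. \<theta> \<in> cball 0 \<theta>max) \<theta>0"
    unfolding is_arg_max_linorder using obj by auto
  then have am: "is_arg_max ?obj (\<lambda>\<theta>. \<theta> \<in> cball 0 \<theta>max) (qmle g gmin \<theta>max 1 x q D t)"
    unfolding qmle_def arg_max_on_def arg_max_def by (rule someI)
  let ?h = "qmle g gmin \<theta>max 1 x q D t"
  show h: "?h \<in> cball 0 \<theta>max" using am by (simp add: is_arg_max_linorder)
  have max: "F \<theta> \<le> F ?h" if "\<theta> \<in> cball 0 \<theta>max" for \<theta>
    using am that obj[OF h] obj[OF that] unfolding is_arg_max_linorder by auto
  assume \<theta>: "\<theta> \<in> cball 0 \<theta>max"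
  let ?d = "\<theta> - ?h"
  let ?\<phi> = "\<lambda>r. F (?h + r *\<^sub>R ?d)"
  show "score q D t ?h \<bullet> ?d \<le> 0"
  proof (rule ccontr)
    assume neg: "\<not> ?thesis"
    have F': "F \<theta> = - (gmin / 2) * (\<theta> \<bullet> \<theta>) - (\<Sum>s=1..t. \<Gamma> (?z s \<bullet> \<theta>) - \<Gamma> 0 - D s * (?z s \<bullet> \<theta>))" for \<theta>
      by (simp add: F_def dot_square_norm)
    have \<phi>_eq: "?\<phi> = (\<lambda>r. - (gmin / 2) * (?h \<bullet> ?h + 2 * r * (?h \<bullet> ?d) + r\<^sup>2 * (?d \<bullet> ?d))
        - (\<Sum>s=1..t. \<Gamma> (?z s \<bullet> ?h + r * (?z s \<bullet> ?d)) - \<Gamma> 0 - D s * (?z s \<bullet> ?h + r * (?z s \<bullet> ?d))))"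
    proof
      fix r
      have "(?h + r *\<^sub>R ?d) \<bullet> (?h + r *\<^sub>R ?d) = ?h \<bullet> ?h + 2 * r * (?h \<bullet> ?d) + r\<^sup>2 * (?d \<bullet> ?d)"
        by (simp only: inner_add_left inner_add_right inner_scaleR_left inner_scaleR_right inner_commute[of ?d ?h])
          (simp add: power2_eq_square algebra_simps)
      then show "?\<phi> r = - (gmin / 2) * (?h \<bullet> ?h + 2 * r * (?h \<bullet> ?d) + r\<^sup>2 * (?d \<bullet> ?d))
        - (\<Sum>s=1..t. \<Gamma> (?z s \<bullet> ?h + r * (?z s \<bullet> ?d)) - \<Gamma> 0 - D s * (?z s \<bullet> ?h + r * (?z s \<bullet> ?d)))"
        by (simp only: F' inner_add_right inner_scaleR_right)
    qed
    have "(?\<phi> has_real_derivative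
        - (gmin / 2) * (2 * (?h \<bullet> ?d)) - (\<Sum>s=1..t. g (?z s \<bullet> ?h) * (?z s \<bullet> ?d) - D s * (?z s \<bullet> ?d))) (at 0)"
      unfolding \<phi>_eq
      by ((rule derivative_eq_intros DERIV_chain2[OF \<Gamma>] refl | simp)+, simp add: mult.commute)
    also have "- (gmin / 2) * (2 * (?h \<bullet> ?d)) - (\<Sum>s=1..t. g (?z s \<bullet> ?h) * (?z s \<bullet> ?d) - D s * (?z s \<bullet> ?d))
        = score q D t ?h \<bullet> ?d"
      by (simp only: score_def inner_add_left inner_sum_left inner_scaleR_left)
        (simp add: sum_negf[symmetric] left_diff_distrib mult.commute[of _ "D _"] del: inner_diff_right)
    finally have der: "(?\<phi> has_real_derivative score q D t ?h \<bullet> ?d) (at 0)" .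
    obtain e where e: "e > 0" "\<And>r. 0 < r \<Longrightarrow> r < e \<Longrightarrow> ?\<phi> 0 < ?\<phi> (0 + r)"
      using DERIV_pos_inc_right[OF der] neg by auto
    \<comment> \<open>The cap 1 keeps the point on the segment, hence in the ball.\<close>
    let ?r = "min (e / 2) 1"
    have r: "0 < ?r" "?r < e" "?r \<le> 1" using e(1) by auto
    have "?h + ?r *\<^sub>R ?d = (1 - ?r) *\<^sub>R ?h + ?r *\<^sub>R \<theta>" by (simp add: algebra_simps)
    also have "\<dots> \<in> cball 0 \<theta>max"
      using convex_cball[of 0 \<theta>max] h \<theta> r by (intro convexD_alt) auto
    finally have "?\<phi> ?r \<le> F ?h" by (rule max)
    with e(2)[OF r(1,2)] show False by simp
  qed
qed

text \<open>Strong monotonicity of the score between estimate and truth, divided by the norm of the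
  error: the penalty contributes \<open>\<theta>max\<close>, the noise \<open>r / gmin\<close>. The
  vector \<open>u\<close> is the inverse design applied to the noise.\<close>

lemma qmle_error:
  fixes q D :: "nat \<Rightarrow> real"
  assumes t: "t \<le> T" and q: "\<And>s. s \<in> {1..t} \<Longrightarrow> q s \<in> {pmin..pmax}"
    and u: "design_op (\<lambda>s. regressor (x s) (q s)) t u
        = (\<Sum>s=1..t. (D s - g (regressor (x s) (q s) \<bullet> stack \<alpha> \<beta>)) *\<^sub>R regressor (x s) (q s))"
    and r: "u \<bullet> design_op (\<lambda>s. regressor (x s) (q s)) t u \<le> r\<^sup>2" "0 \<le> r"
  defines "\<Delta> \<equiv> qmle g gmin \<theta>max 1 x q D t - stack \<alpha> \<beta>"
  shows "sqrt (\<Delta> \<bullet> design_op (\<lambda>s. regressor (x s) (q s)) t \<Delta>) \<le> \<theta>max + r / gmin"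
proof -
  let ?V = "design_op (\<lambda>s. regressor (x s) (q s)) t"
  let ?h = "qmle g gmin \<theta>max 1 x q D t"
  let ?S = "\<Sum>s=1..t. (D s - g (regressor (x s) (q s) \<bullet> stack \<alpha> \<beta>)) *\<^sub>R regressor (x s) (q s)"
  define n where "n = sqrt (\<Delta> \<bullet> ?V \<Delta>)"
  have V: "(norm \<Delta>)\<^sup>2 \<le> \<Delta> \<bullet> ?V \<Delta>" by (rule design_op_ge)
  then have nn: "0 \<le> \<Delta> \<bullet> ?V \<Delta>" using zero_le_power2 order_trans by blast
  have n: "norm \<Delta> \<le> n" "0 \<le> n" "n\<^sup>2 = \<Delta> \<bullet> ?V \<Delta>"
    using V nn real_le_rsqrt by (auto simp: n_def)
  note h = qmle_first_order[where q = q and D = D, OF t q]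
  have "0 \<le> score q D t ?h \<bullet> \<Delta>" using h(2)[OF _ true_param] by (simp add: \<Delta>_def inner_diff_right)
  moreover have "gmin * n\<^sup>2 \<le> (score q D t (stack \<alpha> \<beta>) - score q D t ?h) \<bullet> \<Delta>"
    unfolding n \<Delta>_def by (intro score_monotone t q h(1) true_param)
  ultimately have "gmin * n\<^sup>2 \<le> score q D t (stack \<alpha> \<beta>) \<bullet> \<Delta>" by (simp add: inner_diff_left)
  also have "\<dots> = - gmin * (stack \<alpha> \<beta> \<bullet> \<Delta>) + ?S \<bullet> \<Delta>" by (simp add: score_def inner_add_left inner_diff_left)
  also have "\<dots> \<le> gmin * (\<theta>max * n) + r * n"
  proof (rule add_mono)
    have "- (stack \<alpha> \<beta> \<bullet> \<Delta>) \<le> norm (stack \<alpha> \<beta>) * norm \<Delta>"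
      using Cauchy_Schwarz_ineq2[of "stack \<alpha> \<beta>" \<Delta>] by linarith
    also have "\<dots> \<le> \<theta>max * n" using true_param n \<theta>max by (intro mult_mono) auto
    finally have "gmin * (- (stack \<alpha> \<beta> \<bullet> \<Delta>)) \<le> gmin * (\<theta>max * n)" using gmin by (intro mult_left_mono) auto
    then show "- gmin * (stack \<alpha> \<beta> \<bullet> \<Delta>) \<le> gmin * (\<theta>max * n)" by simp
    have "(?S \<bullet> \<Delta>)\<^sup>2 \<le> (u \<bullet> ?V u) * (\<Delta> \<bullet> ?V \<Delta>)"
      using design_op_cauchy[of "\<lambda>s. regressor (x s) (q s)" t u \<Delta>] u by simp
    also have "\<dots> \<le> r\<^sup>2 * (\<Delta> \<bullet> ?V \<Delta>)" using r nn by (intro mult_right_mono) auto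
    also have "\<dots> = (r * n)\<^sup>2" by (simp add: n power_mult_distrib)
    finally show "?S \<bullet> \<Delta> \<le> r * n" using r n by (intro power2_le_imp_le[of "?S \<bullet> \<Delta>"]) auto
  qed
  finally have "n * (gmin * n) \<le> n * (gmin * \<theta>max + r)" by (simp add: power2_eq_square algebra_simps)
  then have "gmin * n \<le> gmin * \<theta>max + r"
    using n(2) r \<theta>max gmin by (cases "n = 0") (auto simp: mult_le_cancel_left)
  then show ?thesis using gmin by (simp add: n_def[symmetric] field_simps)
qed

text \<open>Used for measurability: the score at a fixed parameter depends continuously on prices and demands.\<close>

lemma qmle_lipschitz:
  fixes q q' D D' :: "nat \<Rightarrow> real"
  assumes t: "t \<le> T" and q: "\<And>s. s \<in> {1..t} \<Longrightarrow> q s \<in> {pmin..pmax}" "\<And>s. s \<in> {1..t} \<Longrightarrow> q' s \<in> {pmin..pmax}"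
  shows "gmin * norm (qmle g gmin \<theta>max 1 x q D t - qmle g gmin \<theta>max 1 x q' D' t)
    \<le> norm (score q D t (qmle g gmin \<theta>max 1 x q' D' t) - score q' D' t (qmle g gmin \<theta>max 1 x q' D' t))"
proof -
  let ?h = "qmle g gmin \<theta>max 1 x q D t" and ?h' = "qmle g gmin \<theta>max 1 x q' D' t"
  note h = qmle_first_order[where q = q and D = D, OF t q(1)] and h' = qmle_first_order[where q = q' and D = D', OF t q(2)]
  let ?\<Delta> = "?h - ?h'"
  have "gmin * (norm ?\<Delta>)\<^sup>2 \<le> gmin * (?\<Delta> \<bullet> design_op (\<lambda>s. regressor (x s) (q s)) t ?\<Delta>)"
    using gmin by (intro mult_left_mono design_op_ge) auto
  also have "\<dots> \<le> (score q D t ?h' - score q D t ?h) \<bullet> ?\<Delta>"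
    by (intro score_monotone t q h h')
  also have "\<dots> \<le> (score q D t ?h' - score q' D' t ?h') \<bullet> ?\<Delta>"
    using h(2)[OF _ h'(1)] h'(2)[OF _ h(1)] by (simp add: inner_diff_left inner_diff_right)
  also have "\<dots> \<le> norm (score q D t ?h' - score q' D' t ?h') * norm ?\<Delta>"
    by (rule norm_cauchy_schwarz)
  finally have "norm ?\<Delta> * (gmin * norm ?\<Delta>) \<le> norm ?\<Delta> * norm (score q D t ?h' - score q' D' t ?h')"
    by (simp add: power2_eq_square mult_ac)
  then show ?thesis by (cases "norm ?\<Delta> = 0") (auto simp: mult_le_cancel_left)
qed

text \<open>The estimator is picked by a choice operator, so measurability cannot be read off its
  definition; \<open>qmle_lipschitz\<close> makes it continuous in the data.\<close>

lemma borel_measurable_qmle: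
  assumes t: "t \<le> T" and q: "\<And>w s. q w s \<in> {pmin..pmax}"
    and meas: "\<And>s. (\<lambda>w. q w s) \<in> borel_measurable N" "\<And>s. (\<lambda>w. D w s) \<in> borel_measurable N"
  shows "(\<lambda>w. qmle g gmin \<theta>max 1 x (q w) (D w) t) \<in> borel_measurable N"
proof -
  \<comment> \<open>Clamping extends the price bounds to all sequences, so that continuity can be
    shown on the whole sequence space.\<close>
  define cl where "cl = (\<lambda>(f::nat \<Rightarrow> real) s. max pmin (min pmax (f s)))"
  have cl: "cl f s \<in> {pmin..pmax}" for f s using prices by (auto simp: cl_def)
  let ?Q = "\<lambda>y. qmle g gmin \<theta>max 1 x (cl (fst y)) (snd y) t"
  have "isCont ?Q y0" for y0
  proof -
    let ?h = "?Q y0"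
    let ?e = "\<lambda>y. norm (score (cl (fst y)) (snd y) t ?h - score (cl (fst y0)) (snd y0) t ?h) / gmin"
    have [continuous_intros]: "continuous_on UNIV (\<lambda>y::(nat \<Rightarrow> real) \<times> (nat \<Rightarrow> real). fst y s)"
      "continuous_on UNIV (\<lambda>y::(nat \<Rightarrow> real) \<times> (nat \<Rightarrow> real). snd y s)" for s
      by (auto intro!: continuous_on_compose2[OF continuous_on_product_coordinates[of s]]
          continuous_on_fst continuous_on_snd continuous_on_id)
    have cg: "continuous_on UNIV g" using isCont_g by (intro continuous_at_imp_continuous_on) auto
    have "continuous_on UNIV ?e"
      unfolding score_def regressor_eq cl_def using gmin
      by (intro continuous_intros continuous_on_compose2[OF cg]) auto
    then have "isCont ?e y0"
      using continuous_on_eq_continuous_at[OF open_UNIV] by blast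
    then have "?e \<midarrow>y0\<rightarrow> ?e y0" by (simp only: isCont_def)
    then have lim: "?e \<midarrow>y0\<rightarrow> 0" by (simp only: diff_self norm_zero div_0)
    have "dist (?Q y) ?h \<le> ?e y" for y
      using qmle_lipschitz[OF t, of "cl (fst y)" "cl (fst y0)" "snd y" "snd y0"] cl gmin
      by (simp add: dist_norm field_simps)
    then have "((\<lambda>y. dist (?Q y) ?h) \<longlongrightarrow> 0) (at y0)"
      by (intro tendsto_sandwich[OF _ _ tendsto_const lim]) (auto intro!: always_eventually)
    then show ?thesis unfolding isCont_def by (subst tendsto_dist_iff)
  qed
  then have [measurable]: "?Q \<in> borel_measurable borel"
    by (intro borel_measurable_continuous_onI continuous_at_imp_continuous_on) auto
  have [measurable]: "q \<in> borel_measurable N" "D \<in> borel_measurable N"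
    using meas by (auto intro!: borel_measurable_nat_fun)
  have "(\<lambda>w. ?Q (q w, D w)) \<in> borel_measurable N" by measurable
  moreover have "cl (q w) = q w" for w
  proof
    show "cl (q w) s = q w s" for s using q[of w s] by (simp add: cl_def)
  qed
  ultimately show ?thesis by simp
qed

end

section \<open>Information and sub-Gaussian shocks\<close>

text \<open>Doob-Dynkin factorisation, by induction over nonnegative measurable functions.\<close>

lemma factor_through_vimage_algebra:
  fixes X :: "'w \<Rightarrow> ennreal"
  assumes f: "f \<in> \<Omega> \<rightarrow> space N" and X: "X \<in> borel_measurable (vimage_algebra \<Omega> f N)"
  shows "\<exists>X'\<in>borel_measurable N. \<forall>\<omega>\<in>\<Omega>. X \<omega> = X' (f \<omega>)"
  using X
proof (induction rule: borel_measurable_induct)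
  case (cong h k)
  then show ?case by (simp cong: ball_cong)
next
  case (set A)
  then obtain B where "B \<in> sets N" "A = f -` B \<inter> \<Omega>"
    using f by (auto simp: sets_vimage_algebra2)
  then show ?case by (intro bexI[of _ "indicator B"]) (auto simp: indicator_def)
next
  case (mult u c)
  from mult.IH obtain u' where "u' \<in> borel_measurable N" "\<forall>\<omega>\<in>\<Omega>. u \<omega> = u' (f \<omega>)" by blast
  then show ?case by (intro bexI[of _ "\<lambda>y. c * u' y"]) auto
next
  case (add u v)
  from add.IH obtain u' v' where "u' \<in> borel_measurable N" "\<forall>\<omega>\<in>\<Omega>. u \<omega> = u' (f \<omega>)"
    "v' \<in> borel_measurable N" "\<forall>\<omega>\<in>\<Omega>. v \<omega> = v' (f \<omega>)" by blast
  then show ?case by (intro bexI[of _ "\<lambda>y. v' y + u' y"]) auto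
next
  case (seq U)
  from seq.IH have "\<forall>i. \<exists>u'\<in>borel_measurable N. \<forall>\<omega>\<in>\<Omega>. U i \<omega> = u' (f \<omega>)" by blast
  then obtain u' where u': "\<And>i. u' i \<in> borel_measurable N" "\<And>i \<omega>. \<omega> \<in> \<Omega> \<Longrightarrow> U i \<omega> = u' i (f \<omega>)"
    by metis
  have "(\<lambda>y. SUP i. u' i y) \<in> borel_measurable N" using u'(1) by measurable
  moreover have "(SUP i. U i) \<omega> = (SUP i. u' i (f \<omega>))" if "\<omega> \<in> \<Omega>" for \<omega>
    using u'(2)[OF that] by (simp add: image_comp)
  ultimately show ?case by (intro bexI[of _ "\<lambda>y. SUP i. u' i y"] ballI) (simp_all add: seq.hyps)
qed

text \<open>The library's \<open>indep_var\<close> requires both variables to have the same type.\<close>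

definition (in prob_space) indep_pair :: "'b measure \<Rightarrow> ('a \<Rightarrow> 'b) \<Rightarrow> 'c measure \<Rightarrow> ('a \<Rightarrow> 'c) \<Rightarrow> bool" where
  "indep_pair S A R B \<longleftrightarrow> A \<in> measurable M S \<and> B \<in> measurable M R \<and>
    (\<forall>a\<in>sets S. \<forall>b\<in>sets R. prob ((A -` a \<inter> space M) \<inter> (B -` b \<inter> space M))
      = prob (A -` a \<inter> space M) * prob (B -` b \<inter> space M))"

lemma (in prob_space) indep_pair_compose:
  assumes ind: "indep_pair S A R B" and f: "f \<in> measurable S S'"
  shows "indep_pair S' (\<lambda>\<omega>. f (A \<omega>)) R B"
proof -
  have A: "A \<in> measurable M S" using ind by (simp add: indep_pair_def)
  have eq: "(\<lambda>\<omega>. f (A \<omega>)) -` a \<inter> space M = A -` (f -` a \<inter> space S) \<inter> space M" for a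
    using measurable_space[OF A] by auto
  show ?thesis
    unfolding indep_pair_def eq
  proof (intro conjI ballI)
    fix a b assume "a \<in> sets S'" and b: "b \<in> sets R"
    then have "f -` a \<inter> space S \<in> sets S" using measurable_sets[OF f] by blast
    then show "prob (A -` (f -` a \<inter> space S) \<inter> space M \<inter> (B -` b \<inter> space M))
        = prob (A -` (f -` a \<inter> space S) \<inter> space M) * prob (B -` b \<inter> space M)"
      using ind b unfolding indep_pair_def by blast
  qed (use ind measurable_compose[OF A f] in \<open>auto simp: indep_pair_def\<close>)
qed

lemma (in prob_space) indep_pair_distr:
  assumes ind: "indep_pair S A R B"
  shows "distr M S A \<Otimes>\<^sub>M distr M R B = distr M (S \<Otimes>\<^sub>M R) (\<lambda>x. (A x, B x))"
proof -
  have [measurable]: "A \<in> measurable M S" "B \<in> measurable M R"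
    using ind by (auto simp: indep_pair_def)
  interpret A: prob_space "distr M S A" by (rule prob_space_distr) simp
  interpret B: prob_space "distr M R B" by (rule prob_space_distr) simp
  show ?thesis
  proof (rule pair_measure_eqI)
    fix a b assume "a \<in> sets (distr M S A)" "b \<in> sets (distr M R B)"
    then have ab [measurable]: "a \<in> sets S" "b \<in> sets R" by simp_all
    have "(\<lambda>x. (A x, B x)) -` (a \<times> b) \<inter> space M = (A -` a \<inter> space M) \<inter> (B -` b \<inter> space M)" by auto
    then show "emeasure (distr M S A) a * emeasure (distr M R B) b
        = emeasure (distr M (S \<Otimes>\<^sub>M R) (\<lambda>x. (A x, B x))) (a \<times> b)"
      using ind ab by (simp add: emeasure_distr emeasure_eq_measure ennreal_mult'[symmetric] indep_pair_def)
  qed (auto intro: A.sigma_finite_measure B.sigma_finite_measure simp: cong: sets_pair_measure_cong)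
qed

text \<open>The product law of an independent pair lets the two components be evaluated at different
  sample points, so an independent copy requires no enlargement of \<open>M\<close>.\<close>

lemma (in prob_space) nn_integral_indep_pair:
  assumes ind: "indep_pair S A R B" and F [measurable]: "F \<in> borel_measurable (S \<Otimes>\<^sub>M R)"
  shows "(\<integral>\<^sup>+\<omega>. F (A \<omega>, B \<omega>) \<partial>M) = (\<integral>\<^sup>+\<omega>'. (\<integral>\<^sup>+\<omega>. F (A \<omega>, B \<omega>') \<partial>M) \<partial>M)"
proof -
  have [measurable]: "A \<in> measurable M S" "B \<in> measurable M R"
    using ind by (auto simp: indep_pair_def)
  note eq = indep_pair_distr[OF ind]
  interpret A: prob_space "distr M S A" by (rule prob_space_distr) simp
  interpret B: prob_space "distr M R B" by (rule prob_space_distr) simp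
  interpret AB: pair_sigma_finite "distr M S A" "distr M R B" ..
  have "(\<integral>\<^sup>+\<omega>. F (A \<omega>, B \<omega>) \<partial>M) = (\<integral>\<^sup>+y. F y \<partial>(distr M S A \<Otimes>\<^sub>M distr M R B))"
    unfolding eq by (subst nn_integral_distr) auto
  also have "\<dots> = (\<integral>\<^sup>+b. (\<integral>\<^sup>+a. F (a, b) \<partial>distr M S A) \<partial>distr M R B)"
    by (rule AB.nn_integral_snd[symmetric]) simp
  also have "\<dots> = (\<integral>\<^sup>+b. (\<integral>\<^sup>+\<omega>. F (A \<omega>, b) \<partial>M) \<partial>distr M R B)"
    by (intro nn_integral_cong nn_integral_distr) auto
  also have "\<dots> = (\<integral>\<^sup>+\<omega>'. (\<integral>\<^sup>+\<omega>. F (A \<omega>, B \<omega>') \<partial>M) \<partial>M)"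
    by (rule nn_integral_distr) auto
  finally show ?thesis .
qed

text \<open>A bound on \<open>ln\<close> says something only where the conditional expectation is
  positive; elsewhere \<open>exp b\<close> is larger anyway. Finiteness almost everywhere matters
  because \<open>enn2real\<close> sends infinity to 0.\<close>

lemma (in prob_space) nn_integral_le_of_ln_cond_exp_le:
  assumes sub: "subalgebra M F" and Y: "\<And>\<omega>. 0 \<le> Y \<omega>" "integrable M Y"
    and ln: "AE \<omega> in M. ln (real_cond_exp M F Y \<omega>) \<le> b"
    and X: "X \<in> borel_measurable F"
  shows "(\<integral>\<^sup>+\<omega>. X \<omega> * ennreal (Y \<omega>) \<partial>M) \<le> ennreal (exp b) * (\<integral>\<^sup>+\<omega>. X \<omega> \<partial>M)"
proof -
  interpret finite_measure_subalgebra M F using sub by unfold_locales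
  have [measurable]: "Y \<in> borel_measurable M" using Y by auto
  have [measurable]: "X \<in> borel_measurable M" by (rule measurable_from_subalg[OF sub X])
  let ?c = "nn_cond_exp M F (\<lambda>\<omega>. ennreal (Y \<omega>))"
  have "(\<integral>\<^sup>+\<omega>. ?c \<omega> \<partial>M) = (\<integral>\<^sup>+\<omega>. ennreal (Y \<omega>) \<partial>M)"
    using nn_cond_exp_intg[of "\<lambda>_. 1" "\<lambda>\<omega>. ennreal (Y \<omega>)"] by simp
  also have "\<dots> < \<infinity>" using Y nn_integral_eq_integral[of M Y] by simp
  finally have fin: "AE \<omega> in M. ?c \<omega> \<noteq> \<infinity>"
    by (intro nn_integral_PInf_AE) (auto intro: measurable_from_subalg[OF sub])
  have "(\<lambda>\<omega>. ennreal (- Y \<omega>)) = (\<lambda>_. 0)" using Y(1) by (auto simp: ennreal_neg)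
  then have zero: "AE \<omega> in M. nn_cond_exp M F (\<lambda>\<omega>. ennreal (- Y \<omega>)) \<omega> = 0"
    using nn_cond_exp_F_meas[of "\<lambda>_. 0"] by (auto elim: eventually_mono)
  have le: "AE \<omega> in M. ?c \<omega> \<le> ennreal (exp b)"
    using fin zero ln
  proof eventually_elim
    case (elim \<omega>)
    have "enn2real (?c \<omega>) \<le> exp b"
    proof (cases "enn2real (?c \<omega>) > 0")
      case True
      then have "enn2real (?c \<omega>) = exp (ln (enn2real (?c \<omega>)))" by simp
      also have "\<dots> \<le> exp b" using elim by (simp add: real_cond_exp_def)
      finally show ?thesis .
    qed (simp add: not_less order_trans[OF _ exp_ge_zero])
    then show ?case using elim by (metis ennreal_enn2real ennreal_leI infinity_ennreal_def less_top)
  qed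
  have "(\<integral>\<^sup>+\<omega>. X \<omega> * ennreal (Y \<omega>) \<partial>M) = (\<integral>\<^sup>+\<omega>. X \<omega> * ?c \<omega> \<partial>M)"
    by (rule nn_cond_exp_intg[symmetric]) (use X in auto)
  also have "\<dots> \<le> (\<integral>\<^sup>+\<omega>. ennreal (exp b) * X \<omega> \<partial>M)"
    using le by (intro nn_integral_mono_AE) (auto elim!: eventually_mono simp: mult.commute[of "ennreal _"] intro: mult_left_mono)
  finally show ?thesis by (simp add: nn_integral_cmult)
qed

section \<open>Measurability of the inverse design matrix\<close>

lemma borel_measurable_vec:
  fixes f :: "'w \<Rightarrow> real^'k"
  assumes "\<And>k. (\<lambda>w. f w $ k) \<in> borel_measurable N"
  shows "f \<in> borel_measurable N"
  using assms by (subst borel_measurable_euclidean_space) (auto simp: Basis_vec_def inner_axis)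

lemma borel_measurable_det:
  fixes A :: "'w \<Rightarrow> real^'k^'k"
  assumes [measurable]: "\<And>i j. (\<lambda>w. A w $ i $ j) \<in> borel_measurable N"
  shows "(\<lambda>w. det (A w)) \<in> borel_measurable N"
  unfolding det_def by measurable

text \<open>By Cramer's rule every coordinate is a quotient of determinants, hence of polynomials in
  the entries.\<close>

lemma borel_measurable_design_inv:
  fixes x :: "nat \<Rightarrow> real^'n"
  assumes q: "\<And>s. s \<in> {1..t} \<Longrightarrow> (\<lambda>w. q w s) \<in> borel_measurable N"
    and v [measurable]: "v \<in> borel_measurable N"
  shows "(\<lambda>w. matrix_inv (design_matrix 1 x (q w) t) *v v w) \<in> borel_measurable N"
proof (rule borel_measurable_vec)
  fix k
  let ?A = "\<lambda>w. design_matrix 1 x (q w) t"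
  have r: "(\<lambda>w. regressor (x s) (q w s) $ i) \<in> borel_measurable N" if "s \<in> {1..t}" for s i
    unfolding regressor_eq using q[OF that] by simp
  have [measurable]: "(\<lambda>w. ?A w $ i $ j) \<in> borel_measurable N" for i j
    unfolding design_matrix_def using r by (simp add: sum_component)
  have [measurable]: "(\<lambda>w. v w $ i) \<in> borel_measurable N" for i

    by (intro measurable_compose[OF v] borel_measurable_continuous_onI continuous_intros)
  have "(matrix_inv (?A w) *v v w) = (\<chi> k. det (\<chi> i j. if j = k then v w $ i else ?A w $ i $ j) / det (?A w))" for w
    using cramer[OF design_matrix_det, of x "q w" t _ "v w"] design_matrix_inv[of x "q w" t "v w"]
    by (simp add: design_matrix_mult)
  then have eq: "(\<lambda>w. (matrix_inv (?A w) *v v w) $ k) = (\<lambda>w. det (\<chi> i j. if j = k then v w $ i else ?A w $ i $ j) / det (?A w))"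
    by simp
  show "(\<lambda>w. (matrix_inv (?A w) *v v w) $ k) \<in> borel_measurable N"
    unfolding eq by (intro borel_measurable_divide borel_measurable_det) auto
qed

locale thompson_sampling = pricing_model \<X> g \<alpha> \<beta> pmin pmax \<theta>max Dmax gmin gmax \<sigma> T x + prob_space M
  for \<X> :: "(real^'n) set" and g \<alpha> \<beta> pmin pmax \<theta>max Dmax gmin gmax \<sigma> T x and M :: "'w measure" +
  fixes p \<epsilon> :: "nat \<Rightarrow> 'w \<Rightarrow> real" and \<eta> :: "nat \<Rightarrow> 'w \<Rightarrow> real^2"
  assumes shocks: "shock_assumption M \<sigma> p \<epsilon> T"
    and draws: "randomization M p \<epsilon> \<eta> T"
    and policy: "ts_policy M g gmin \<theta>max \<sigma> pmin pmax 1 T \<alpha> \<beta> x p \<epsilon> \<eta>"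
begin

lemma eps_integrable: "t \<in> {1..T} \<Longrightarrow> integrable M (\<epsilon> t)"
  using shocks by (auto simp: shock_assumption_def)

lemma eps_measurable: "t \<in> {1..T} \<Longrightarrow> \<epsilon> t \<in> borel_measurable M"
  using eps_integrable by auto

lemma eta_measurable: "t \<in> {1..T} \<Longrightarrow> \<eta> t \<in> borel_measurable M"
  using draws by (auto simp: randomization_def distributed_def)

lemma price_range: "t \<in> {1..T} \<Longrightarrow> \<omega> \<in> space M \<Longrightarrow> p t \<omega> \<in> {pmin..pmax}"
  using policy by (auto simp: ts_policy_def Let_def is_arg_max_linorder)

text \<open>The two indices are separate so that draws can be adjoined one at a time;
  \<open>info t t\<close> is what is known when the price of period \<open>t\<close> is set.\<close>

definition info :: "nat \<Rightarrow> nat \<Rightarrow> 'w measure" where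
  "info t k = vimage_algebra (space M) (\<lambda>\<omega>. (\<lambda>s\<in>{1..<t}. \<epsilon> s \<omega>, \<lambda>s\<in>{1..k}. \<eta> s \<omega>))
     ((\<Pi>\<^sub>M s\<in>{1..<t}. borel) \<Otimes>\<^sub>M (\<Pi>\<^sub>M s\<in>{1..k}. borel))"

lemma space_info [simp]: "space (info t k) = space M"
  by (simp add: info_def)

lemma info_generator:
  "(\<lambda>\<omega>. (\<lambda>s\<in>{1..<t}. \<epsilon> s \<omega>, \<lambda>s\<in>{1..k}. \<eta> s \<omega>))
    \<in> measurable (info t k) ((\<Pi>\<^sub>M s\<in>{1..<t}. borel) \<Otimes>\<^sub>M (\<Pi>\<^sub>M s\<in>{1..k}. borel))"
  unfolding info_def by (rule measurable_vimage_algebra1) (auto simp: space_pair_measure space_PiM)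

lemma eps_info: "s \<in> {1..<t} \<Longrightarrow> \<epsilon> s \<in> borel_measurable (info t k)"
proof -
  assume s: "s \<in> {1..<t}"
  have "(\<lambda>\<omega>. fst (\<lambda>s\<in>{1..<t}. \<epsilon> s \<omega>, \<lambda>s\<in>{1..k}. \<eta> s \<omega>) s) \<in> borel_measurable (info t k)"
    by (rule measurable_compose[OF measurable_compose[OF info_generator measurable_fst] measurable_component_singleton[OF s]])
  then show ?thesis using s by simp
qed

lemma eta_info: "s \<in> {1..k} \<Longrightarrow> \<eta> s \<in> borel_measurable (info t k)"
proof -
  assume s: "s \<in> {1..k}"
  have "(\<lambda>\<omega>. snd (\<lambda>s\<in>{1..<t}. \<epsilon> s \<omega>, \<lambda>s\<in>{1..k}. \<eta> s \<omega>) s) \<in> borel_measurable (info t k)"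
    by (rule measurable_compose[OF measurable_compose[OF info_generator measurable_snd] measurable_component_singleton[OF s]])
  then show ?thesis using s by simp
qed

lemma info_subset:
  assumes "space N = space M" and "\<And>s. s \<in> {1..<t} \<Longrightarrow> \<epsilon> s \<in> borel_measurable N"
    and "\<And>s. s \<in> {1..k} \<Longrightarrow> \<eta> s \<in> borel_measurable N"
  shows "sets (info t k) \<subseteq> sets N"
  unfolding info_def using assms
  by (intro sets_image_in_sets measurable_Pair measurable_restrict) auto

lemma info_subalgebra: "t \<le> Suc T \<Longrightarrow> k \<le> T \<Longrightarrow> subalgebra M (info t k)"
  unfolding subalgebra_def by (intro conjI info_subset eps_measurable eta_measurable) auto

lemma info_mono: "t \<le> t' \<Longrightarrow> k \<le> k' \<Longrightarrow> f \<in> borel_measurable (info t k) \<Longrightarrow> f \<in> borel_measurable (info t' k')"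
  by (rule measurable_from_subalg[of _ "info t k"])
    (unfold subalgebra_def, intro conjI info_subset eps_info eta_info, auto)

text \<open>Past prices are functions of past shocks and draws, so the prices, which are not independent of the draws,
  can be dropped from the conditioning.\<close>

lemma price_info: "t \<in> {1..T} \<Longrightarrow> p t \<in> borel_measurable (info t t)"
proof (induction t rule: less_induct)
  case (less t)
  have "p t \<in> borel_measurable (price_info M p \<epsilon> \<eta> t)"
    using policy less by (auto simp: ts_policy_def Let_def)
  moreover have "subalgebra (info t t) (price_info M p \<epsilon> \<eta> t)"
    unfolding subalgebra_def price_info_def
  proof (intro conjI sets_image_in_sets measurable_Pair measurable_restrict)
    fix s assume s: "s \<in> {1..<t}"
    then have "p s \<in> borel_measurable (info s s)" using less by auto
    then have [measurable]: "p s \<in> borel_measurable (info t t)" by (rule info_mono[rotated 2]) (use s in auto)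
    have [measurable]: "\<epsilon> s \<in> borel_measurable (info t t)" using s by (rule eps_info)
    show "(\<lambda>\<omega>. (p s \<omega>, \<epsilon> s \<omega>)) \<in> borel_measurable (info t t)" by measurable
  qed (auto intro: eta_info)
  ultimately show ?case using measurable_from_subalg by blast
qed

lemma price_info_mono: "s \<in> {1..T} \<Longrightarrow> s \<le> t \<Longrightarrow> p s \<in> borel_measurable (info t t)"
  by (rule info_mono[OF _ _ price_info]) auto

lemma price_measurable: "t \<in> {1..T} \<Longrightarrow> p t \<in> borel_measurable M"
  by (rule measurable_from_subalg[OF info_subalgebra price_info]) auto

lemma history_generator:
  assumes "t \<in> {1..T}"
  shows "(\<lambda>\<omega>. ((\<lambda>s\<in>{1..<t}. (p s \<omega>, \<eta> s \<omega>)), (\<lambda>s\<in>{1..T}. \<epsilon> s \<omega>)))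
    \<in> measurable M ((\<Pi>\<^sub>M s\<in>{1..<t}. borel) \<Otimes>\<^sub>M (\<Pi>\<^sub>M s\<in>{1..T}. borel))"
proof (intro measurable_Pair measurable_restrict)
  fix s assume "s \<in> {1..<t}"
  then have [measurable]: "p s \<in> borel_measurable M" "\<eta> s \<in> borel_measurable M"
    using assms by (auto intro!: price_measurable eta_measurable)
  show "(\<lambda>\<omega>. (p s \<omega>, \<eta> s \<omega>)) \<in> borel_measurable M" by measurable
qed (auto intro: eps_measurable)

lemma history_indep:
  assumes t: "t \<in> {1..T}"
  shows "indep_pair ((\<Pi>\<^sub>M s\<in>{1..<t}. borel) \<Otimes>\<^sub>M (\<Pi>\<^sub>M s\<in>{1..T}. borel))
      (\<lambda>\<omega>. ((\<lambda>s\<in>{1..<t}. (p s \<omega>, \<eta> s \<omega>)), (\<lambda>s\<in>{1..T}. \<epsilon> s \<omega>))) borel (\<eta> t)"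
proof -
  have "indep_set (sets (vimage_algebra (space M) (\<eta> t) borel))
          (sets (vimage_algebra (space M)
            (\<lambda>\<omega>. ((\<lambda>s\<in>{1..<t}. (p s \<omega>, \<eta> s \<omega>)), (\<lambda>s\<in>{1..T}. \<epsilon> s \<omega>)))
            ((\<Pi>\<^sub>M s\<in>{1..<t}. borel) \<Otimes>\<^sub>M (\<Pi>\<^sub>M s\<in>{1..T}. borel))))"
    using draws t by (auto simp: randomization_def)
  note ind = indep_setD[OF this in_vimage_algebra in_vimage_algebra]
  show ?thesis
    unfolding indep_pair_def
  proof (intro conjI ballI history_generator[OF t] eta_measurable[OF t])
    fix a :: "((nat \<Rightarrow> real \<times> (real^2)) \<times> (nat \<Rightarrow> real)) set" and b
    assume a: "a \<in> sets ((\<Pi>\<^sub>M s\<in>{1..<t}. borel) \<Otimes>\<^sub>M (\<Pi>\<^sub>M s\<in>{1..T}. borel))" and b: "b \<in> sets (borel :: (real^2) measure)"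
    let ?H = "\<lambda>\<omega>. ((\<lambda>s\<in>{1..<t}. (p s \<omega>, \<eta> s \<omega>)), (\<lambda>s\<in>{1..T}. \<epsilon> s \<omega>))"
    show "prob ((?H -` a \<inter> space M) \<inter> (\<eta> t -` b \<inter> space M)) = prob (?H -` a \<inter> space M) * prob (\<eta> t -` b \<inter> space M)"
      using ind[OF b a] by (simp only: Int_commute[of "?H -` a \<inter> space M"] mult.commute)
  qed
qed

text \<open>The shock hypothesis does not condition on draws. Induction on \<open>k\<close> adjoins
  them: the newest draw is independent of the earlier draws together with all shocks, so it can be
  frozen and the induction hypothesis applied inside the integral.\<close>

lemma subgaussian_info:
  assumes t: "t \<in> {1..T}" and k: "k \<le> t" and X: "X \<in> borel_measurable (info t k)"
  shows "(\<integral>\<^sup>+\<omega>. X \<omega> * ennreal (exp (s * \<epsilon> t \<omega>)) \<partial>M) \<le> ennreal (exp (\<sigma>\<^sup>2 * s\<^sup>2 / 2)) * (\<integral>\<^sup>+\<omega>. X \<omega> \<partial>M)"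
  using k X
proof (induction k arbitrary: X)
  case 0
  let ?H = "shock_history M p \<epsilon> (t - 1)"
  have g: "(\<lambda>\<omega>. \<lambda>s\<in>{1..t - 1}. (p s \<omega>, \<epsilon> s \<omega>)) \<in> measurable ?H (\<Pi>\<^sub>M s\<in>{1..t - 1}. borel)"
    unfolding shock_history_def by (rule measurable_vimage_algebra1) (auto simp: space_PiM)
  have e: "\<epsilon> r \<in> borel_measurable ?H" if r: "r \<in> {1..<t}" for r
  proof -
    have r': "r \<in> {1..t - 1}" using r by auto
    have "(\<lambda>\<omega>. snd ((\<lambda>s\<in>{1..t - 1}. (p s \<omega>, \<epsilon> s \<omega>)) r)) \<in> borel_measurable ?H"
      using measurable_compose[OF measurable_compose[OF g measurable_component_singleton[OF r']], of snd borel]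
      by (simp add: borel_prod[symmetric])
    then show ?thesis using r' by simp
  qed
  \<comment> \<open>Without draws only past shocks remain, and these belong to the shock
    history.\<close>
  have "subalgebra ?H (info t 0)"
    unfolding subalgebra_def by (intro conjI info_subset e) (auto simp: shock_history_def)
  then have X': "X \<in> borel_measurable ?H" using 0 measurable_from_subalg by blast
  have "subalgebra M ?H"
    unfolding subalgebra_def shock_history_def
  proof (intro conjI sets_image_in_sets measurable_restrict)
    fix s assume "s \<in> {1..t - 1}"
    then have [measurable]: "p s \<in> borel_measurable M" "\<epsilon> s \<in> borel_measurable M"
      using t by (auto intro!: price_measurable eps_measurable)
    show "(\<lambda>\<omega>. (p s \<omega>, \<epsilon> s \<omega>)) \<in> borel_measurable M" by measurable
  qed auto
  then show ?case
    using shocks t by (intro nn_integral_le_of_ln_cond_exp_le[OF _ _ _ _ X']) (auto simp: shock_assumption_def)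
next
  case (Suc k)
  let ?N = "(\<Pi>\<^sub>M s\<in>{1..<t}. borel :: real measure) \<Otimes>\<^sub>M (\<Pi>\<^sub>M s\<in>{1..k}. borel :: (real^2) measure)"
  let ?f = "\<lambda>\<omega>. (\<lambda>s\<in>{1..<t}. \<epsilon> s \<omega>, \<lambda>s\<in>{1..k}. \<eta> s \<omega>)"
  let ?V = "vimage_algebra (space M) (\<lambda>\<omega>. (?f \<omega>, \<eta> (Suc k) \<omega>)) (?N \<Otimes>\<^sub>M borel)"
  have Suck: "Suc k \<in> {1..T}" using Suc t by auto
  have gV: "(\<lambda>\<omega>. (?f \<omega>, \<eta> (Suc k) \<omega>)) \<in> measurable ?V (?N \<Otimes>\<^sub>M borel)"
    by (rule measurable_vimage_algebra1) (auto simp: space_pair_measure space_PiM)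
  have fV: "?f \<in> measurable ?V ?N" and eV: "\<eta> (Suc k) \<in> borel_measurable ?V"
    using measurable_compose[OF gV measurable_fst] measurable_compose[OF gV measurable_snd] by simp_all
  have V1: "\<epsilon> r \<in> borel_measurable ?V" if r: "r \<in> {1..<t}" for r
    using measurable_compose[OF measurable_compose[OF fV measurable_fst] measurable_component_singleton[OF r]] r by simp
  have V2: "\<eta> r \<in> borel_measurable ?V" if r: "r \<in> {1..k}" for r
    using measurable_compose[OF measurable_compose[OF fV measurable_snd] measurable_component_singleton[OF r]] r by simp
  have "\<eta> r \<in> borel_measurable ?V" if r: "r \<in> {1..Suc k}" for r
    using V2[of r] eV r by (cases "r = Suc k") auto
  then have "subalgebra ?V (info t (Suc k))"
    unfolding subalgebra_def by (intro conjI info_subset V1) auto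
  then have XV: "X \<in> borel_measurable ?V" using Suc.prems measurable_from_subalg by blast
  have "(\<lambda>\<omega>. (?f \<omega>, \<eta> (Suc k) \<omega>)) \<in> space M \<rightarrow> space (?N \<Otimes>\<^sub>M borel)"
    by (auto simp: space_pair_measure space_PiM)
  from factor_through_vimage_algebra[OF this XV]
  obtain X' where X' [measurable]: "X' \<in> borel_measurable (?N \<Otimes>\<^sub>M borel)"
    and XX': "\<And>\<omega>. \<omega> \<in> space M \<Longrightarrow> X \<omega> = X' (?f \<omega>, \<eta> (Suc k) \<omega>)"
    by blast
  \<comment> \<open>Reads past shocks, earlier draws and the current shock off the history of period
    \<open>Suc k\<close>, whose shock part extends over the whole horizon.\<close>
  let ?\<phi> = "\<lambda>h. ((\<lambda>s\<in>{1..<t}. snd h s, \<lambda>s\<in>{1..k}. snd (fst h s)), snd h t)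
    :: ((nat \<Rightarrow> real) \<times> (nat \<Rightarrow> real^2)) \<times> real"
  let ?H = "\<lambda>\<omega>. ((\<lambda>s\<in>{1..<Suc k}. (p s \<omega>, \<eta> s \<omega>)), (\<lambda>s\<in>{1..T}. \<epsilon> s \<omega>))"
  let ?NH = "(\<Pi>\<^sub>M s\<in>{1..<Suc k}. borel :: (real \<times> (real^2)) measure) \<Otimes>\<^sub>M (\<Pi>\<^sub>M s\<in>{1..T}. borel :: real measure)"
  have phi: "?\<phi> \<in> measurable ?NH (?N \<Otimes>\<^sub>M borel)"
  proof (intro measurable_Pair measurable_restrict)
    fix s assume s: "s \<in> {1..<t}"
    then have "s \<in> {1..T}" using t by auto
    then show "(\<lambda>h. snd h s) \<in> borel_measurable ?NH" by measurable
  next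
    fix s assume s: "s \<in> {1..k}"
    then have "s \<in> {1..<Suc k}" by auto
    then have "(\<lambda>h. fst h s) \<in> measurable ?NH (borel \<Otimes>\<^sub>M borel)" unfolding borel_prod by measurable
    then show "(\<lambda>h. snd (fst h s)) \<in> borel_measurable ?NH" by measurable
  next
    show "(\<lambda>h. snd h t) \<in> borel_measurable ?NH" using t by measurable
  qed
  have "indep_pair (?N \<Otimes>\<^sub>M borel) (\<lambda>\<omega>. ?\<phi> (?H \<omega>)) borel (\<eta> (Suc k))"
    by (rule indep_pair_compose[OF history_indep[OF Suck] phi])
  moreover have "(\<lambda>\<omega>. ?\<phi> (?H \<omega>)) = (\<lambda>\<omega>. (?f \<omega>, \<epsilon> t \<omega>))"
    using t by (auto simp: fun_eq_iff restrict_def)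
  ultimately have ind: "indep_pair (?N \<Otimes>\<^sub>M borel) (\<lambda>\<omega>. (?f \<omega>, \<epsilon> t \<omega>)) borel (\<eta> (Suc k))"
    by (simp only:)
  have fM: "?f \<in> measurable M ?N"
    using t Suc.prems by (intro measurable_Pair measurable_restrict eps_measurable eta_measurable) auto
  note eps_measurable[OF t, measurable] eta_measurable[OF Suck, measurable]
  let ?c = "ennreal (exp (\<sigma>\<^sup>2 * s\<^sup>2 / 2))"
  have F1: "(\<lambda>y. X' (fst (fst y), snd y) * ennreal (exp (s * snd (fst y)))) \<in> borel_measurable ((?N \<Otimes>\<^sub>M borel) \<Otimes>\<^sub>M borel)"
    by measurable
  have F2: "(\<lambda>y. ?c * X' (fst (fst y), snd y)) \<in> borel_measurable ((?N \<Otimes>\<^sub>M (borel :: real measure)) \<Otimes>\<^sub>M borel)"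
    by measurable
  have "(\<integral>\<^sup>+\<omega>. X \<omega> * ennreal (exp (s * \<epsilon> t \<omega>)) \<partial>M)
      = (\<integral>\<^sup>+\<omega>. (\<lambda>y. X' (fst (fst y), snd y) * ennreal (exp (s * snd (fst y)))) ((?f \<omega>, \<epsilon> t \<omega>), \<eta> (Suc k) \<omega>) \<partial>M)"
    by (intro nn_integral_cong) (simp add: XX')
  also have "\<dots> = (\<integral>\<^sup>+\<omega>'. \<integral>\<^sup>+\<omega>. X' (?f \<omega>, \<eta> (Suc k) \<omega>') * ennreal (exp (s * \<epsilon> t \<omega>)) \<partial>M \<partial>M)"
    unfolding nn_integral_indep_pair[OF ind F1] by simp
  also have "\<dots> \<le> (\<integral>\<^sup>+\<omega>'. ?c * (\<integral>\<^sup>+\<omega>. X' (?f \<omega>, \<eta> (Suc k) \<omega>') \<partial>M) \<partial>M)"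
  proof (rule nn_integral_mono)
    fix \<omega>' assume "\<omega>' \<in> space M"
    have "(\<lambda>\<omega>. X' (?f \<omega>, \<eta> (Suc k) \<omega>')) \<in> borel_measurable (info t k)"
      by (rule measurable_compose[OF _ X']) (intro measurable_Pair info_generator, simp)
    then show "(\<integral>\<^sup>+\<omega>. X' (?f \<omega>, \<eta> (Suc k) \<omega>') * ennreal (exp (s * \<epsilon> t \<omega>)) \<partial>M)
        \<le> ?c * (\<integral>\<^sup>+\<omega>. X' (?f \<omega>, \<eta> (Suc k) \<omega>') \<partial>M)"
      using Suc by auto
  qed
  also have "\<dots> = (\<integral>\<^sup>+\<omega>'. \<integral>\<^sup>+\<omega>. ?c * X' (?f \<omega>, \<eta> (Suc k) \<omega>') \<partial>M \<partial>M)"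
    by (intro nn_integral_cong nn_integral_cmult[symmetric] measurable_compose[OF _ X'] measurable_Pair fM) auto
  also have "\<dots> = (\<integral>\<^sup>+\<omega>. (\<lambda>y. ?c * X' (fst (fst y), snd y)) ((?f \<omega>, \<epsilon> t \<omega>), \<eta> (Suc k) \<omega>) \<partial>M)"
    unfolding nn_integral_indep_pair[OF ind F2] by simp
  also have "\<dots> = (\<integral>\<^sup>+\<omega>. ?c * X \<omega> \<partial>M)"
    by (intro nn_integral_cong) (simp add: XX')
  also have "\<dots> = ?c * (\<integral>\<^sup>+\<omega>. X \<omega> \<partial>M)"
  proof (rule nn_integral_cmult)
    show "X \<in> borel_measurable M"
      by (rule measurable_from_subalg[OF info_subalgebra Suc.prems(2)]) (use Suck t in auto)
  qed
  finally show ?case .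
qed

end

section \<open>Self-normalised concentration\<close>

context thompson_sampling
begin

text \<open>On each of the finitely many level sets the multiplier is a constant, to which
  \<open>subgaussian_info\<close> applies.\<close>

lemma subgaussian_simple_multiplier:
  assumes t: "t \<in> {1..T}" and X: "X \<in> borel_measurable (info t t)" "\<And>\<omega>. 0 \<le> X \<omega>"
    and l: "l \<in> borel_measurable (info t t)" and fin: "finite (l ` space M)"
  shows "(\<integral>\<^sup>+\<omega>. ennreal (X \<omega> * exp (l \<omega> * \<epsilon> t \<omega> - \<sigma>\<^sup>2 * (l \<omega>)\<^sup>2 / 2)) \<partial>M) \<le> (\<integral>\<^sup>+\<omega>. ennreal (X \<omega>) \<partial>M)"
proof -
  have sub: "subalgebra M (info t t)" by (rule info_subalgebra) (use t in auto)
  note measurable_from_subalg[OF sub X(1), measurable] measurable_from_subalg[OF sub l, measurable]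
    eps_measurable[OF t, measurable]
  let ?L = "l ` space M"
  let ?I = "\<lambda>v \<omega>. ennreal (X \<omega>) * indicator (l -` {v} \<inter> space M) \<omega>"
  have I: "?I v \<in> borel_measurable (info t t)" for v
    using measurable_sets[OF l, of "{v}"] X(1) by (intro borel_measurable_times_ennreal borel_measurable_indicator measurable_compose[OF _ measurable_ennreal]) auto
  have IM: "?I v \<in> borel_measurable M" for v
    by (rule measurable_from_subalg[OF sub I])
  have sumI: "(\<Sum>v\<in>?L. ?I v \<omega> * F v) = ennreal (X \<omega>) * F (l \<omega>)" if \<omega>: "\<omega> \<in> space M" for \<omega> and F :: "real \<Rightarrow> ennreal"
  proof -
    have "(\<Sum>v\<in>?L. ?I v \<omega> * F v) = (\<Sum>v\<in>?L. if v = l \<omega> then ennreal (X \<omega>) * F v else 0)"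
      using \<omega> by (intro sum.cong) (auto simp: indicator_def)
    then show ?thesis using fin \<omega> by (simp add: sum.delta)
  qed
  let ?E = "\<lambda>v. ennreal (exp (- (\<sigma>\<^sup>2 * v\<^sup>2 / 2)))"
  have "(\<integral>\<^sup>+\<omega>. ennreal (X \<omega> * exp (l \<omega> * \<epsilon> t \<omega> - \<sigma>\<^sup>2 * (l \<omega>)\<^sup>2 / 2)) \<partial>M)
      = (\<integral>\<^sup>+\<omega>. (\<Sum>v\<in>?L. ?I v \<omega> * (ennreal (exp (v * \<epsilon> t \<omega>)) * ?E v)) \<partial>M)"
  proof (rule nn_integral_cong)
    fix \<omega> assume \<omega>: "\<omega> \<in> space M"
    have "ennreal (X \<omega> * exp (l \<omega> * \<epsilon> t \<omega> - \<sigma>\<^sup>2 * (l \<omega>)\<^sup>2 / 2))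
        = ennreal (X \<omega>) * (ennreal (exp (l \<omega> * \<epsilon> t \<omega>)) * ?E (l \<omega>))"
      using X(2) by (simp add: ennreal_mult'[symmetric] exp_add[symmetric])
    then show "ennreal (X \<omega> * exp (l \<omega> * \<epsilon> t \<omega> - \<sigma>\<^sup>2 * (l \<omega>)\<^sup>2 / 2))
        = (\<Sum>v\<in>?L. ?I v \<omega> * (ennreal (exp (v * \<epsilon> t \<omega>)) * ?E v))"
      using sumI[OF \<omega>, of "\<lambda>v. ennreal (exp (v * \<epsilon> t \<omega>)) * ?E v"] by simp
  qed
  also have "\<dots> = (\<Sum>v\<in>?L. (\<integral>\<^sup>+\<omega>. ?I v \<omega> * (ennreal (exp (v * \<epsilon> t \<omega>)) * ?E v) \<partial>M))"
    using IM by (intro nn_integral_sum) auto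
  also have "\<dots> \<le> (\<Sum>v\<in>?L. (\<integral>\<^sup>+\<omega>. ?I v \<omega> \<partial>M))"
  proof (rule sum_mono)
    fix v
    have "(\<integral>\<^sup>+\<omega>. ?I v \<omega> * (ennreal (exp (v * \<epsilon> t \<omega>)) * ?E v) \<partial>M)
        = (\<integral>\<^sup>+\<omega>. ?I v \<omega> * ennreal (exp (v * \<epsilon> t \<omega>)) \<partial>M) * ?E v"
      using IM by (subst nn_integral_multc[symmetric]) (auto simp: mult.assoc)
    also have "\<dots> \<le> (ennreal (exp (\<sigma>\<^sup>2 * v\<^sup>2 / 2)) * (\<integral>\<^sup>+\<omega>. ?I v \<omega> \<partial>M)) * ?E v"
      by (intro mult_right_mono subgaussian_info[OF t order_refl I]) auto
    also have "\<dots> = (\<integral>\<^sup>+\<omega>. ?I v \<omega> \<partial>M) * (ennreal (exp (\<sigma>\<^sup>2 * v\<^sup>2 / 2)) * ?E v)"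
      by (simp only: mult_ac)
    also have "ennreal (exp (\<sigma>\<^sup>2 * v\<^sup>2 / 2)) * ?E v = 1"
      by (simp add: ennreal_mult'[symmetric] exp_add[symmetric])
    finally show "(\<integral>\<^sup>+\<omega>. ?I v \<omega> * (ennreal (exp (v * \<epsilon> t \<omega>)) * ?E v) \<partial>M) \<le> (\<integral>\<^sup>+\<omega>. ?I v \<omega> \<partial>M)" by simp
  qed
  also have "\<dots> = (\<integral>\<^sup>+\<omega>. (\<Sum>v\<in>?L. ?I v \<omega>) \<partial>M)"
    using IM by (intro nn_integral_sum[symmetric]) auto
  also have "\<dots> = (\<integral>\<^sup>+\<omega>. ennreal (X \<omega>) \<partial>M)"
    using sumI[of _ "\<lambda>_. 1"] by (intro nn_integral_cong) simp
  finally show ?thesis .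
qed

text \<open>Boundedness makes the rounded multipliers finite-valued, and Fatou's lemma passes to the
  limit.\<close>

lemma subgaussian_multiplier:
  assumes t: "t \<in> {1..T}" and X: "X \<in> borel_measurable (info t t)" "\<And>\<omega>. 0 \<le> X \<omega>"
    and l: "l \<in> borel_measurable (info t t)" and bd: "\<And>\<omega>. \<omega> \<in> space M \<Longrightarrow> \<bar>l \<omega>\<bar> \<le> B"
  shows "(\<integral>\<^sup>+\<omega>. ennreal (X \<omega> * exp (l \<omega> * \<epsilon> t \<omega> - \<sigma>\<^sup>2 * (l \<omega>)\<^sup>2 / 2)) \<partial>M) \<le> (\<integral>\<^sup>+\<omega>. ennreal (X \<omega>) \<partial>M)"
proof -
  have sub: "subalgebra M (info t t)" by (rule info_subalgebra) (use t in auto)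
  note measurable_from_subalg[OF sub X(1), measurable] measurable_from_subalg[OF sub l, measurable]
    eps_measurable[OF t, measurable]
  \<comment> \<open>Rounding down to the grid of mesh \<open>1 / real (Suc n)\<close>.\<close>
  define r where "r = (\<lambda>n y. of_int \<lfloor>real (Suc n) * y\<rfloor> / real (Suc n))"
  have r [measurable]: "r n \<in> borel_measurable borel" for n unfolding r_def by measurable
  have r_lim: "(\<lambda>n. r n y) \<longlonglongrightarrow> y" for y
  proof (rule tendsto_sandwich)
    show "\<forall>\<^sub>F n in sequentially. y - inverse (real (Suc n)) \<le> r n y"
    proof (rule always_eventually, rule allI)
      fix n
      have "real (Suc n) * y - 1 \<le> of_int \<lfloor>real (Suc n) * y\<rfloor>" by linarith
      then have "(real (Suc n) * y - 1) / real (Suc n) \<le> r n y" unfolding r_def by (intro divide_right_mono) auto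
      then show "y - inverse (real (Suc n)) \<le> r n y" by (simp add: diff_divide_distrib inverse_eq_divide)
    qed
    show "\<forall>\<^sub>F n in sequentially. r n y \<le> y"
    proof (rule always_eventually, rule allI)
      fix n
      have "r n y \<le> (real (Suc n) * y) / real (Suc n)" unfolding r_def by (intro divide_right_mono) auto
      then show "r n y \<le> y" by simp
    qed
    show "(\<lambda>n. y - inverse (real (Suc n))) \<longlonglongrightarrow> y"
      using tendsto_diff[OF tendsto_const LIMSEQ_inverse_real_of_nat, of y] by simp
  qed auto
  let ?f = "\<lambda>l \<omega>. ennreal (X \<omega> * exp (l * \<epsilon> t \<omega> - \<sigma>\<^sup>2 * l\<^sup>2 / 2))"
  have step: "(\<integral>\<^sup>+\<omega>. ?f (r n (l \<omega>)) \<omega> \<partial>M) \<le> (\<integral>\<^sup>+\<omega>. ennreal (X \<omega>) \<partial>M)" for n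
  proof (rule subgaussian_simple_multiplier[OF t X])
    show "(\<lambda>\<omega>. r n (l \<omega>)) \<in> borel_measurable (info t t)" by (rule measurable_compose[OF l r])
    let ?K = "{\<lfloor>real (Suc n) * - B\<rfloor>..\<lfloor>real (Suc n) * B\<rfloor>}"
    have "r n (l \<omega>) \<in> (\<lambda>k. of_int k / real (Suc n)) ` ?K" if "\<omega> \<in> space M" for \<omega>
    proof -
      have b: "- B \<le> l \<omega>" "l \<omega> \<le> B" using bd[OF that] by auto
      have "\<lfloor>real (Suc n) * l \<omega>\<rfloor> \<in> ?K"
        using mult_left_mono[OF b(1), of "real (Suc n)"] mult_left_mono[OF b(2), of "real (Suc n)"]
        unfolding atLeastAtMost_iff by (intro conjI floor_mono) auto
      then show ?thesis by (auto simp: r_def)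
    qed
    then have "(\<lambda>\<omega>. r n (l \<omega>)) ` space M \<subseteq> (\<lambda>k. of_int k / real (Suc n)) ` ?K" by blast
    then show "finite ((\<lambda>\<omega>. r n (l \<omega>)) ` space M)" by (rule finite_subset) simp
  qed
  have lim: "(\<lambda>n. ?f (r n (l \<omega>)) \<omega>) \<longlonglongrightarrow> ?f (l \<omega>) \<omega>" for \<omega>
    by (intro tendsto_ennrealI tendsto_intros r_lim) simp
  have "(\<integral>\<^sup>+\<omega>. ?f (l \<omega>) \<omega> \<partial>M) = (\<integral>\<^sup>+\<omega>. liminf (\<lambda>n. ?f (r n (l \<omega>)) \<omega>) \<partial>M)"
    using lim_imp_Liminf[OF sequentially_bot lim] by simp
  also have "\<dots> \<le> liminf (\<lambda>n. \<integral>\<^sup>+\<omega>. ?f (r n (l \<omega>)) \<omega> \<partial>M)"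
    by (rule nn_integral_liminf) measurable
  also have "\<dots> \<le> (\<integral>\<^sup>+\<omega>. ennreal (X \<omega>) \<partial>M)"
    using Liminf_mono[of "\<lambda>n. \<integral>\<^sup>+\<omega>. ?f (r n (l \<omega>)) \<omega> \<partial>M" "\<lambda>_. \<integral>\<^sup>+\<omega>. ennreal (X \<omega>) \<partial>M" sequentially] step
    by (simp add: Liminf_const)
  finally show ?thesis .
qed

definition played :: "'w \<Rightarrow> nat \<Rightarrow> real^('n + 'n)" where
  "played \<omega> s = regressor (x s) (p s \<omega>)"

lemma played_info: "s \<in> {1..T} \<Longrightarrow> s \<le> t \<Longrightarrow> (\<lambda>\<omega>. played \<omega> s) \<in> borel_measurable (info t t)"
  unfolding played_def regressor_eq using price_info_mono by simp

lemma played_measurable: "s \<in> {1..T} \<Longrightarrow> (\<lambda>\<omega>. played \<omega> s) \<in> borel_measurable M"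
  unfolding played_def regressor_eq using price_measurable by simp

lemma played_norm: "s \<in> {1..T} \<Longrightarrow> \<omega> \<in> space M \<Longrightarrow> norm (played \<omega> s) \<le> 1"
  unfolding played_def using covariate_bounds covariates price_range by blast

text \<open>The regressor of a period depends on the draw of that period, so the multiplier is
  measurable for \<open>info t t\<close> rather than for the shock history.\<close>

lemma exp_supermartingale:
  assumes "t \<le> T"
  shows "(\<integral>\<^sup>+\<omega>. ennreal (exp (\<Sum>s=1..t. (w \<bullet> played \<omega> s) * \<epsilon> s \<omega> - \<sigma>\<^sup>2 * (w \<bullet> played \<omega> s)\<^sup>2 / 2)) \<partial>M) \<le> 1"
  using assms
proof (induction t)
  case 0
  then show ?case by (simp add: emeasure_space_1)
next
  case (Suc t)
  let ?X = "\<lambda>\<omega>. exp (\<Sum>s=1..t. (w \<bullet> played \<omega> s) * \<epsilon> s \<omega> - \<sigma>\<^sup>2 * (w \<bullet> played \<omega> s)\<^sup>2 / 2)"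
  have St: "Suc t \<in> {1..T}" using Suc by simp
  have m: "(\<lambda>\<omega>. w \<bullet> played \<omega> s) \<in> borel_measurable (info (Suc t) (Suc t))" if "s \<in> {1..Suc t}" for s
    using played_info[of s "Suc t"] that Suc by simp
  have "?X \<in> borel_measurable (info (Suc t) (Suc t))"
    using m eps_info[of _ "Suc t" "Suc t"]
    by (intro borel_measurable_sum borel_measurable_exp[THEN measurable_compose[rotated]] borel_measurable_diff
        borel_measurable_times borel_measurable_divide borel_measurable_power) auto
  moreover have "\<bar>w \<bullet> played \<omega> (Suc t)\<bar> \<le> norm w" if "\<omega> \<in> space M" for \<omega>
    using Cauchy_Schwarz_ineq2[of w "played \<omega> (Suc t)"] mult_left_mono[OF played_norm[OF St that], of "norm w"] by simp
  ultimately have "(\<integral>\<^sup>+\<omega>. ennreal (?X \<omega> * exp ((w \<bullet> played \<omega> (Suc t)) * \<epsilon> (Suc t) \<omega> - \<sigma>\<^sup>2 * (w \<bullet> played \<omega> (Suc t))\<^sup>2 / 2)) \<partial>M)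
      \<le> (\<integral>\<^sup>+\<omega>. ennreal (?X \<omega>) \<partial>M)"
    using m[of "Suc t"] by (intro subgaussian_multiplier[OF St]) auto
  also have "\<dots> \<le> 1" using Suc by simp
  finally show ?case by (simp add: exp_add[symmetric] add.commute)
qed

definition noise :: "nat \<Rightarrow> 'w \<Rightarrow> real^('n + 'n)" where
  "noise t \<omega> = (\<Sum>s=1..t. \<epsilon> s \<omega> *\<^sub>R played \<omega> s)"

text \<open>Its inner product with \<open>noise\<close> is the squared norm of the noise for the
  inverse design, the self-normalised quantity to be controlled.\<close>

definition noise_dual :: "nat \<Rightarrow> 'w \<Rightarrow> real^('n + 'n)" where
  "noise_dual t \<omega> = matrix_inv (design_matrix 1 x (\<lambda>s. p s \<omega>) t) *v noise t \<omega>"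

lemma design_noise_dual: "design_op (played \<omega>) t (noise_dual t \<omega>) = noise t \<omega>"
  unfolding noise_dual_def played_def[abs_def] by (rule design_matrix_inv)

lemma noise_measurable: "t \<le> T \<Longrightarrow> noise t \<in> borel_measurable M"
  unfolding noise_def[abs_def] by (intro borel_measurable_sum borel_measurable_scaleR eps_measurable played_measurable) auto

lemma noise_dual_measurable: "t \<le> T \<Longrightarrow> noise_dual t \<in> borel_measurable M"
  unfolding noise_dual_def[abs_def] by (intro borel_measurable_design_inv noise_measurable price_measurable) auto

text \<open>The exponential moments at 1 and -1 are at most 1, and \<open>cosh_ge\<close> leaves no
  room for a second moment. The case is separate because \<open>confidence\<close> rescales by
  \<open>1 / \<sigma>\<close>.\<close>

lemma eps_zero_if_sigma_zero:
  assumes t: "t \<in> {1..T}" and "\<sigma> = 0"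
  shows "AE \<omega> in M. \<epsilon> t \<omega> = 0"
proof -
  note eps_measurable[OF t, measurable]
  have e: "(\<integral>\<^sup>+\<omega>. ennreal (exp (s * \<epsilon> t \<omega>)) \<partial>M) \<le> 1" for s
    using subgaussian_info[OF t, of 0 "\<lambda>_. 1" s] \<open>\<sigma> = 0\<close> by (simp add: emeasure_space_1)
  have "2 + (\<integral>\<^sup>+\<omega>. ennreal ((\<epsilon> t \<omega>)\<^sup>2) \<partial>M) = (\<integral>\<^sup>+\<omega>. ennreal (2 + (\<epsilon> t \<omega>)\<^sup>2) \<partial>M)"
    by (simp add: nn_integral_add emeasure_space_1)
  also have "\<dots> \<le> (\<integral>\<^sup>+\<omega>. ennreal (exp (1 * \<epsilon> t \<omega>)) + ennreal (exp (- 1 * \<epsilon> t \<omega>)) \<partial>M)"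
  proof (rule nn_integral_mono)
    fix \<omega>
    have "2 + (\<epsilon> t \<omega>)\<^sup>2 \<le> exp (1 * \<epsilon> t \<omega>) + exp (- 1 * \<epsilon> t \<omega>)"
      using cosh_ge[of "\<epsilon> t \<omega>"] by (simp add: cosh_field_def field_simps)
    then show "ennreal (2 + (\<epsilon> t \<omega>)\<^sup>2) \<le> ennreal (exp (1 * \<epsilon> t \<omega>)) + ennreal (exp (- 1 * \<epsilon> t \<omega>))"
      by (simp only: ennreal_plus[symmetric] exp_ge_zero ennreal_leI)
  qed
  also have "\<dots> = (\<integral>\<^sup>+\<omega>. ennreal (exp (1 * \<epsilon> t \<omega>)) \<partial>M) + (\<integral>\<^sup>+\<omega>. ennreal (exp (- 1 * \<epsilon> t \<omega>)) \<partial>M)"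
    by (rule nn_integral_add) auto
  also have "\<dots> \<le> 1 + 1" by (intro add_mono e)
  finally have "2 + (\<integral>\<^sup>+\<omega>. ennreal ((\<epsilon> t \<omega>)\<^sup>2) \<partial>M) \<le> 2 + 0" by (simp only: one_add_one add_0_right)
  then have "(\<integral>\<^sup>+\<omega>. ennreal ((\<epsilon> t \<omega>)\<^sup>2) \<partial>M) = 0"
    unfolding ennreal_add_left_cancel_le by simp
  then show ?thesis by (simp add: nn_integral_0_iff_AE)
qed

lemma DIM_params: "DIM(real^('n + 'n)) = 2 * ncov"
  by (simp add: ncov_def)

lemma confidence:
  assumes t: "t \<le> T"
  shows "prob {\<omega>\<in>space M. \<sigma>\<^sup>2 * \<rho> < noise_dual t \<omega> \<bullet> noise t \<omega>} \<le> 1 / T"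
proof (cases "\<sigma> = 0")
  case True
  have "AE \<omega> in M. \<forall>s\<in>{1..T}. \<epsilon> s \<omega> = 0"
    using eps_zero_if_sigma_zero[OF _ True] by (intro AE_finite_allI) auto
  then have "AE \<omega> in M. \<not> \<sigma>\<^sup>2 * \<rho> < noise_dual t \<omega> \<bullet> noise t \<omega>"
  proof eventually_elim
    case (elim \<omega>)
    then have "noise t \<omega> = 0" using t by (simp add: noise_def)
    then show ?case using True by simp
  qed
  then have "prob {\<omega>\<in>space M. \<sigma>\<^sup>2 * \<rho> < noise_dual t \<omega> \<bullet> noise t \<omega>} = 0"
    using noise_measurable[OF t] noise_dual_measurable[OF t] by (intro prob_eq_0[THEN iffD2]) auto
  then show ?thesis by simp
next
  case False
  then have \<sigma>: "0 < \<sigma>" using sigma by simp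
  note noise_measurable[OF t, measurable] noise_dual_measurable[OF t, measurable]
  let ?Q = "\<lambda>\<omega>. noise_dual t \<omega> \<bullet> noise t \<omega>"
  define c where "c = 1 + real T / real (2 * ncov)"
  define C where "C = sqrt c ^ (2 * ncov)"
  have c: "c \<ge> 1" by (simp add: c_def)
  have C: "C = c ^ ncov" "C > 0" using c by (auto simp: C_def power_mult)
  \<comment> \<open>The direction is divided by \<open>\<sigma>\<close> so that the quadratic
    correction becomes the rank-one part of the design form.\<close>
  let ?f = "\<lambda>\<omega> w. exp (\<Sum>s=1..t. ((1 / \<sigma>) *\<^sub>R w \<bullet> played \<omega> s) * \<epsilon> s \<omega> - \<sigma>\<^sup>2 * ((1 / \<sigma>) *\<^sub>R w \<bullet> played \<omega> s)\<^sup>2 / 2)"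
  let ?Z = "gauss_mass (\<lambda>w::real^('n + 'n). w)"
  have Z: "?Z = ennreal (sqrt (2 * pi) ^ (2 * ncov))"
    using gauss_mass_scaleR[of 1, where 'a="real^('n + 'n)", unfolded DIM_params] by simp
  \<comment> \<open>Completing the square at the scaled \<open>noise_dual\<close> produces the
    exponential of the noise; the trace bound replaces the mass of the random design by a
    deterministic one.\<close>
  have pt: "ennreal (exp (?Q \<omega> / (2 * \<sigma>\<^sup>2))) * ?Z \<le> ennreal C * (\<integral>\<^sup>+w. ennreal (?f \<omega> w * exp (- (w \<bullet> w) / 2)) \<partial>lborel)"
    if \<omega>: "\<omega> \<in> space M" for \<omega>
  proof -
    let ?A = "design_op (played \<omega>) t"
    let ?u = "(1 / \<sigma>) *\<^sub>R noise_dual t \<omega>"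
    have Au: "?A ?u = (1 / \<sigma>) *\<^sub>R noise t \<omega>"
      by (simp add: linear_scale[OF design_op_linear] design_noise_dual)
    have Auu: "?A ?u \<bullet> ?u / 2 = ?Q \<omega> / (2 * \<sigma>\<^sup>2)"
      unfolding Au by (simp add: power2_eq_square inner_commute)
    have "ennreal (exp (?Q \<omega> / (2 * \<sigma>\<^sup>2))) * ?Z \<le> ennreal (exp (?Q \<omega> / (2 * \<sigma>\<^sup>2))) * (ennreal C * gauss_mass ?A)"
    proof (rule mult_left_mono)
      show "?Z \<le> ennreal C * gauss_mass ?A"
        using gauss_mass_trace_bound[of "{1..t}" "played \<omega>" "real T"] played_norm[OF _ \<omega>] t
        unfolding DIM_params C_def c_def design_op_def[abs_def] by simp
    qed simp
    also have "\<dots> = ennreal C * (ennreal (exp (?A ?u \<bullet> ?u / 2)) * gauss_mass ?A)"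
      unfolding Auu by (simp only: mult_ac)
    also have "\<dots> = ennreal C * (\<integral>\<^sup>+w. ennreal (exp (?A ?u \<bullet> w - (w \<bullet> ?A w) / 2)) \<partial>lborel)"
      by (simp only: nn_integral_exp_linear_quadratic[OF design_op_linear design_op_sym])
    also have "(\<lambda>w. exp (?A ?u \<bullet> w - (w \<bullet> ?A w) / 2)) = (\<lambda>w. ?f \<omega> w * exp (- (w \<bullet> w) / 2))"
    proof
      fix w
      have "(\<Sum>s=1..t. ((1 / \<sigma>) *\<^sub>R w \<bullet> played \<omega> s) * \<epsilon> s \<omega> - \<sigma>\<^sup>2 * ((1 / \<sigma>) *\<^sub>R w \<bullet> played \<omega> s)\<^sup>2 / 2)
          = (\<Sum>s=1..t. (\<epsilon> s \<omega> * (played \<omega> s \<bullet> w)) / \<sigma> - (played \<omega> s \<bullet> w)\<^sup>2 / 2)"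
        using \<sigma> by (intro sum.cong) (auto simp: power_divide inner_commute)
      also have "\<dots> = ?A ?u \<bullet> w - (\<Sum>s=1..t. (played \<omega> s \<bullet> w)\<^sup>2) / 2"
        unfolding Au by (simp add: noise_def inner_sum_left sum_subtractf sum_divide_distrib)
      finally show "exp (?A ?u \<bullet> w - (w \<bullet> ?A w) / 2) = ?f \<omega> w * exp (- (w \<bullet> w) / 2)"
        by (simp only: design_op_quad exp_add[symmetric] power2_norm_eq_inner) (simp add: add_divide_distrib)
    qed
    finally show ?thesis .
  qed
  have fm: "(\<lambda>y. ?f (fst y) (snd y)) \<in> borel_measurable (M \<Otimes>\<^sub>M lborel)"
  proof (rule measurable_compose[OF _ borel_measurable_exp], rule borel_measurable_sum)
    fix s assume "s \<in> {1..t}"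
    then have s: "s \<in> {1..T}" using t by auto
    have [measurable]: "(\<lambda>y. played (fst y) s) \<in> borel_measurable (M \<Otimes>\<^sub>M lborel)"
      "(\<lambda>y. \<epsilon> s (fst y)) \<in> borel_measurable (M \<Otimes>\<^sub>M lborel)"
      "snd \<in> borel_measurable (M \<Otimes>\<^sub>M lborel)"
      using measurable_compose[OF measurable_fst played_measurable[OF s]]
        measurable_compose[OF measurable_fst eps_measurable[OF s]] measurable_snd[of M lborel] by simp_all
    show "(\<lambda>y. ((1 / \<sigma>) *\<^sub>R snd y \<bullet> played (fst y) s) * \<epsilon> s (fst y)
        - \<sigma>\<^sup>2 * ((1 / \<sigma>) *\<^sub>R snd y \<bullet> played (fst y) s)\<^sup>2 / 2) \<in> borel_measurable (M \<Otimes>\<^sub>M lborel)"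
      by measurable
  qed
  have Gm: "(\<lambda>y. ennreal (?f (fst y) (snd y) * exp (- (snd y \<bullet> snd y) / 2))) \<in> borel_measurable (M \<Otimes>\<^sub>M lborel)"
    by (intro measurable_compose[OF _ measurable_ennreal] borel_measurable_times fm) measurable
  have Gm': "(\<lambda>(\<omega>, w). ennreal (?f \<omega> w * exp (- (w \<bullet> w) / 2))) \<in> borel_measurable (M \<Otimes>\<^sub>M lborel)"
    using Gm by (simp add: case_prod_beta)
  interpret P: pair_sigma_finite M lborel ..
  have "(\<integral>\<^sup>+\<omega>. ennreal (exp (?Q \<omega> / (2 * \<sigma>\<^sup>2))) \<partial>M) * ?Z = (\<integral>\<^sup>+\<omega>. ennreal (exp (?Q \<omega> / (2 * \<sigma>\<^sup>2))) * ?Z \<partial>M)"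
    by (rule nn_integral_multc[symmetric]) measurable
  also have "\<dots> \<le> (\<integral>\<^sup>+\<omega>. ennreal C * (\<integral>\<^sup>+w. ennreal (?f \<omega> w * exp (- (w \<bullet> w) / 2)) \<partial>lborel) \<partial>M)"
    by (intro nn_integral_mono pt) simp
  also have "\<dots> = ennreal C * (\<integral>\<^sup>+\<omega>. (\<integral>\<^sup>+w. ennreal (?f \<omega> w * exp (- (w \<bullet> w) / 2)) \<partial>lborel) \<partial>M)"
    by (rule nn_integral_cmult) (rule lborel.borel_measurable_nn_integral[OF Gm'])
  also have "(\<integral>\<^sup>+\<omega>. (\<integral>\<^sup>+w. ennreal (?f \<omega> w * exp (- (w \<bullet> w) / 2)) \<partial>lborel) \<partial>M)
      = (\<integral>\<^sup>+w. (\<integral>\<^sup>+\<omega>. ennreal (?f \<omega> w * exp (- (w \<bullet> w) / 2)) \<partial>M) \<partial>lborel)"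
    by (rule P.Fubini'[OF Gm', symmetric])
  also have "\<dots> \<le> (\<integral>\<^sup>+w. ennreal (exp (- (w \<bullet> w) / 2)) \<partial>(lborel :: (real^('n + 'n)) measure))"
  proof (rule nn_integral_mono)
    fix w :: "real^('n + 'n)"
    have [measurable]: "(\<lambda>\<omega>. ?f \<omega> w) \<in> borel_measurable M"
      using measurable_compose[OF measurable_Pair2'[of w lborel M] fm] by simp
    have "(\<integral>\<^sup>+\<omega>. ennreal (?f \<omega> w * exp (- (w \<bullet> w) / 2)) \<partial>M) = (\<integral>\<^sup>+\<omega>. ennreal (?f \<omega> w) \<partial>M) * ennreal (exp (- (w \<bullet> w) / 2))"
      by (subst nn_integral_multc[symmetric], measurable) (simp only: ennreal_mult' exp_ge_zero)
    also have "\<dots> \<le> 1 * ennreal (exp (- (w \<bullet> w) / 2))"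
      by (intro mult_right_mono exp_supermartingale t) auto
    finally show "(\<integral>\<^sup>+\<omega>. ennreal (?f \<omega> w * exp (- (w \<bullet> w) / 2)) \<partial>M) \<le> ennreal (exp (- (w \<bullet> w) / 2))" by simp
  qed
  also have "\<dots> = ?Z" by (simp add: gauss_mass_def)
  finally have "(\<integral>\<^sup>+\<omega>. ennreal (exp (?Q \<omega> / (2 * \<sigma>\<^sup>2))) \<partial>M) * ?Z \<le> ennreal C * ?Z"
    by (simp add: mult_left_mono)
  \<comment> \<open>Division by the mass of the standard Gaussian, which is finite and
    positive.\<close>
  then have E: "(\<integral>\<^sup>+\<omega>. ennreal (exp (?Q \<omega> / (2 * \<sigma>\<^sup>2))) \<partial>M) \<le> ennreal C"
    unfolding Z by (subst (asm) (1 2) mult.commute, subst (asm) ennreal_mult_le_mult_iff) auto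
  have Tp: "real T > 0" using horizon by simp
  \<comment> \<open>The identity behind the choice of \<open>\<rho>\<close>: with it the Markov
    bound becomes exactly \<open>1 / T\<close>.\<close>
  have "\<rho> / 2 = ln (real T) + real ncov * ln c"
    using ncov_pos by (simp add: \<rho>_def c_def add_divide_distrib)
  also have "\<dots> = ln (real T * C)" using Tp c by (simp add: C(1) ln_mult ln_realpow)
  finally have exp_rho: "exp (\<rho> / 2) = real T * C" using Tp C by simp
  have "emeasure M {\<omega>\<in>space M. \<sigma>\<^sup>2 * \<rho> < ?Q \<omega>}
      \<le> emeasure M {\<omega>\<in>space M. 1 \<le> ennreal (exp (- \<rho> / 2)) * ennreal (exp (?Q \<omega> / (2 * \<sigma>\<^sup>2)))}"
  proof (rule emeasure_mono)
    show "{\<omega>\<in>space M. \<sigma>\<^sup>2 * \<rho> < ?Q \<omega>} \<subseteq> {\<omega>\<in>space M. 1 \<le> ennreal (exp (- \<rho> / 2)) * ennreal (exp (?Q \<omega> / (2 * \<sigma>\<^sup>2)))}"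
    proof safe
      fix \<omega> assume "\<sigma>\<^sup>2 * \<rho> < ?Q \<omega>"
      then have "0 \<le> - \<rho> / 2 + ?Q \<omega> / (2 * \<sigma>\<^sup>2)" using \<sigma> by (simp add: field_simps)
      then have "1 \<le> exp (- \<rho> / 2) * exp (?Q \<omega> / (2 * \<sigma>\<^sup>2))"
        unfolding exp_add[symmetric] by (rule one_le_exp_iff[THEN iffD2])
      then show "1 \<le> ennreal (exp (- \<rho> / 2)) * ennreal (exp (?Q \<omega> / (2 * \<sigma>\<^sup>2)))"
        by (simp only: ennreal_mult'[symmetric] exp_ge_zero ennreal_1[symmetric] ennreal_leI)
    qed
  qed measurable
  also have "\<dots> \<le> ennreal (exp (- \<rho> / 2)) * (\<integral>\<^sup>+\<omega>. ennreal (exp (?Q \<omega> / (2 * \<sigma>\<^sup>2))) \<partial>M)"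
  proof -
    have "emeasure M ({\<omega>\<in>space M. 1 \<le> ennreal (exp (- \<rho> / 2)) * ennreal (exp (?Q \<omega> / (2 * \<sigma>\<^sup>2)))})
        \<le> ennreal (exp (- \<rho> / 2)) * (\<integral>\<^sup>+\<omega>. ennreal (exp (?Q \<omega> / (2 * \<sigma>\<^sup>2))) * indicator (space M) \<omega> \<partial>M)"
      by (rule nn_integral_Markov_inequality) measurable
    also have "(\<integral>\<^sup>+\<omega>. ennreal (exp (?Q \<omega> / (2 * \<sigma>\<^sup>2))) * indicator (space M) \<omega> \<partial>M)
        = (\<integral>\<^sup>+\<omega>. ennreal (exp (?Q \<omega> / (2 * \<sigma>\<^sup>2))) \<partial>M)"
      by (intro nn_integral_cong) simp
    finally show ?thesis .
  qed
  also have "\<dots> \<le> ennreal (exp (- \<rho> / 2)) * ennreal C" by (intro mult_left_mono E) auto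
  also have "\<dots> = ennreal (1 / T)"
    using C c Tp exp_rho by (simp add: ennreal_mult'[symmetric] exp_minus field_simps)
  finally show ?thesis by (simp add: emeasure_eq_measure)
qed

text \<open>The inequality suffices for an upper bound on the regret and follows from the exponential moments alone,
  by letting \<open>s\<close> tend to 0 from below.\<close>

lemma expected_price_noise_nonneg:
  assumes t: "t \<in> {1..T}"
  shows "integrable M (\<lambda>\<omega>. p t \<omega> * \<epsilon> t \<omega>)" "0 \<le> (\<integral>\<omega>. p t \<omega> * \<epsilon> t \<omega> \<partial>M)"
proof -
  note eps_measurable[OF t, measurable] price_measurable[OF t, measurable]
  have pb: "AE \<omega> in M. norm (p t \<omega>) \<le> pmax"
    using price_range[OF t] prices by (intro AE_I2) force
  have mult_int: "integrable M (\<lambda>\<omega>. p t \<omega> * f \<omega>)" if "integrable M f" for f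
  proof (rule Bochner_Integration.integrable_bound[of _ "\<lambda>\<omega>. pmax * f \<omega>"])
    show "AE \<omega> in M. norm (p t \<omega> * f \<omega>) \<le> norm (pmax * f \<omega>)"
      using pb by eventually_elim (auto simp: abs_mult intro!: mult_right_mono)
  qed (use that in auto)
  show int: "integrable M (\<lambda>\<omega>. p t \<omega> * \<epsilon> t \<omega>)" by (rule mult_int[OF eps_integrable[OF t]])
  have pint: "integrable M (p t)" using mult_int[of "\<lambda>_. 1"] by simp
  let ?P = "\<integral>\<omega>. p t \<omega> \<partial>M" and ?I = "\<integral>\<omega>. p t \<omega> * \<epsilon> t \<omega> \<partial>M"
  have p0: "AE \<omega> in M. 0 \<le> p t \<omega>" using price_range[OF t] prices by (intro AE_I2) force
  then have P0: "0 \<le> ?P" by (rule integral_nonneg_AE)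
  \<comment> \<open>The lower bound \<open>1 + y \<le> exp y\<close> and the sub-Gaussian upper
    bound differ at second order in \<open>h\<close>, so dividing by \<open>h\<close> leaves a
    linear error. The condition on \<open>h\<close> allows \<open>exp_bound\<close>.\<close>
  have main: "- ?I \<le> h * (\<sigma>\<^sup>2 * ?P)" if h: "0 < h" "\<sigma>\<^sup>2 * h\<^sup>2 / 2 \<le> 1" for h
  proof -
    have eint: "integrable M (\<lambda>\<omega>. exp (- h * \<epsilon> t \<omega>))"
      using shocks t unfolding shock_assumption_def by blast
    note peint = mult_int[OF eint]
    have pe0: "AE \<omega> in M. 0 \<le> p t \<omega> * exp (- h * \<epsilon> t \<omega>)" using p0 by eventually_elim simp
    have "ennreal (\<integral>\<omega>. p t \<omega> * exp (- h * \<epsilon> t \<omega>) \<partial>M) = (\<integral>\<^sup>+\<omega>. ennreal (p t \<omega> * exp (- h * \<epsilon> t \<omega>)) \<partial>M)"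
      by (rule nn_integral_eq_integral[OF peint pe0, symmetric])
    also have "\<dots> = (\<integral>\<^sup>+\<omega>. ennreal (p t \<omega>) * ennreal (exp (- h * \<epsilon> t \<omega>)) \<partial>M)"
      using p0 by (intro nn_integral_cong_AE) (auto elim!: eventually_mono simp: ennreal_mult')
    also have "\<dots> \<le> ennreal (exp (\<sigma>\<^sup>2 * (- h)\<^sup>2 / 2)) * (\<integral>\<^sup>+\<omega>. ennreal (p t \<omega>) \<partial>M)"
      using price_info[OF t] by (intro subgaussian_info[OF t order_refl]) auto
    also have "\<dots> = ennreal (exp (\<sigma>\<^sup>2 * h\<^sup>2 / 2) * ?P)"
      using nn_integral_eq_integral[OF pint p0] by (simp add: ennreal_mult')
    finally have "(\<integral>\<omega>. p t \<omega> * exp (- h * \<epsilon> t \<omega>) \<partial>M) \<le> exp (\<sigma>\<^sup>2 * h\<^sup>2 / 2) * ?P"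
      using P0 by (subst (asm) ennreal_le_iff) auto
    moreover have "?P - h * ?I \<le> (\<integral>\<omega>. p t \<omega> * exp (- h * \<epsilon> t \<omega>) \<partial>M)"
    proof -
      have "?P - h * ?I = (\<integral>\<omega>. p t \<omega> - h * (p t \<omega> * \<epsilon> t \<omega>) \<partial>M)" using pint int by simp
      also have "\<dots> \<le> (\<integral>\<omega>. p t \<omega> * exp (- h * \<epsilon> t \<omega>) \<partial>M)"
      proof (rule integral_mono_AE)
        show "AE \<omega> in M. p t \<omega> - h * (p t \<omega> * \<epsilon> t \<omega>) \<le> p t \<omega> * exp (- h * \<epsilon> t \<omega>)"
          using p0
        proof eventually_elim
          case (elim \<omega>)
          have "p t \<omega> * (1 + - h * \<epsilon> t \<omega>) \<le> p t \<omega> * exp (- h * \<epsilon> t \<omega>)"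
            using elim exp_ge_add_one_self[of "- h * \<epsilon> t \<omega>"] by (intro mult_left_mono) auto
          then show ?case by (simp add: algebra_simps)
        qed
      qed (use pint int peint in auto)
      finally show ?thesis .
    qed
    moreover have "exp (\<sigma>\<^sup>2 * h\<^sup>2 / 2) \<le> 1 + \<sigma>\<^sup>2 * h\<^sup>2"
    proof -
      let ?y = "\<sigma>\<^sup>2 * h\<^sup>2 / 2"
      have "exp ?y \<le> 1 + ?y + ?y\<^sup>2" using h by (intro exp_bound) auto
      also have "?y\<^sup>2 \<le> ?y" unfolding power2_eq_square[of ?y] using h(2) by (intro mult_left_le) auto
      finally show ?thesis by simp
    qed
    then have "exp (\<sigma>\<^sup>2 * h\<^sup>2 / 2) * ?P \<le> (1 + \<sigma>\<^sup>2 * h\<^sup>2) * ?P" using P0 by (rule mult_right_mono)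
    ultimately have "?P - h * ?I \<le> (1 + \<sigma>\<^sup>2 * h\<^sup>2) * ?P" by linarith
    then have "h * (- ?I) \<le> h * (h * (\<sigma>\<^sup>2 * ?P))" by (simp add: algebra_simps power2_eq_square)
    then show ?thesis by (rule mult_left_le_imp_le[OF _ h(1)])
  qed
  let ?h = "\<lambda>n. inverse (real (Suc n))"
  have h0: "?h \<longlonglongrightarrow> 0" by (rule LIMSEQ_inverse_real_of_nat)
  have "(\<lambda>n. \<sigma>\<^sup>2 * (?h n)\<^sup>2 / 2) \<longlonglongrightarrow> \<sigma>\<^sup>2 * 0\<^sup>2 / 2"
    by (intro tendsto_intros h0) simp
  then have "\<forall>\<^sub>F n in sequentially. \<sigma>\<^sup>2 * (?h n)\<^sup>2 / 2 < 1"
    by (rule order_tendstoD(2)) simp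
  then have ev: "\<forall>\<^sub>F n in sequentially. - ?I \<le> ?h n * (\<sigma>\<^sup>2 * ?P)"
    by eventually_elim (auto intro!: main)
  have "(\<lambda>n. ?h n * (\<sigma>\<^sup>2 * ?P)) \<longlonglongrightarrow> 0 * (\<sigma>\<^sup>2 * ?P)"
    by (intro tendsto_intros h0)
  from tendsto_lowerbound[OF this ev] show "0 \<le> ?I" by simp
qed

end

section \<open>The planar Gaussian draw\<close>

lemma nn_integral_lborel_vec_prod:
  fixes f :: "'k::finite \<Rightarrow> real \<Rightarrow> ennreal"
  assumes f [measurable]: "\<And>i. f i \<in> borel_measurable borel"
  shows "(\<integral>\<^sup>+v. (\<Prod>i\<in>UNIV. f i (v $ i)) \<partial>(lborel :: (real^'k) measure)) = (\<Prod>i\<in>UNIV. (\<integral>\<^sup>+y. f i y \<partial>lborel))"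
proof -
  let ?a = "\<lambda>i. axis i 1 :: real^'k"
  have inj: "inj ?a" by (auto simp: inj_def axis_eq_axis)
  have B: "(Basis :: (real^'k) set) = ?a ` UNIV" by (auto simp: Basis_vec_def)
  have re: "(\<Prod>b\<in>Basis. h b) = (\<Prod>i\<in>UNIV. h (?a i))" for h :: "real^'k \<Rightarrow> ennreal"
    unfolding B by (rule prod.reindex_cong[OF inj refl]) simp
  have "(\<integral>\<^sup>+v. (\<Prod>b\<in>Basis. f (inv ?a b) (v \<bullet> b)) \<partial>lborel) = (\<Prod>b\<in>(Basis::(real^'k) set). (\<integral>\<^sup>+y. f (inv ?a b) y \<partial>lborel))"
    by (rule nn_integral_lborel_prod) auto
  then show ?thesis unfolding re by (simp add: inv_f_f[OF inj] inner_axis)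
qed

lemma norm_vec2: "(norm (v :: real^2))\<^sup>2 = (v $ 1)\<^sup>2 + (v $ 2)\<^sup>2"
  unfolding power2_norm_eq_inner by (simp add: inner_vec_def UNIV_2 power2_eq_square)

definition gauss2 :: "(real^2) measure" where
  "gauss2 = density lborel (\<lambda>v. ennreal (\<Prod>i\<in>UNIV. std_normal_density (v $ i)))"

lemma nn_integral_gauss2_prod:
  assumes [measurable]: "\<And>i. f i \<in> borel_measurable borel"
  shows "(\<integral>\<^sup>+v. (\<Prod>i\<in>UNIV. f i (v $ i)) \<partial>gauss2)
    = (\<Prod>i\<in>UNIV. (\<integral>\<^sup>+y. ennreal (std_normal_density y) * f i y \<partial>lborel))"
proof -
  have [measurable]: "(\<lambda>v::real^2. v $ i) \<in> borel_measurable borel" for i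
    by (intro borel_measurable_continuous_onI continuous_intros)
  have "(\<integral>\<^sup>+v. (\<Prod>i\<in>UNIV. f i (v $ i)) \<partial>gauss2)
      = (\<integral>\<^sup>+v. (\<Prod>i\<in>UNIV. ennreal (std_normal_density (v $ i)) * f i (v $ i)) \<partial>(lborel :: (real^2) measure))"
    unfolding gauss2_def by (subst nn_integral_density) (auto simp: prod_ennreal[symmetric] prod.distrib)
  also have "\<dots> = (\<Prod>i\<in>UNIV. (\<integral>\<^sup>+y. ennreal (std_normal_density y) * f i y \<partial>lborel))"
    by (rule nn_integral_lborel_vec_prod) auto
  finally show ?thesis .
qed

lemma sets_gauss2 [measurable_cong, simp]: "sets gauss2 = sets borel"
  by (simp add: gauss2_def)

text \<open>Each coordinate contributes \<open>sqrt 2\<close>, since the weight halves the precision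
  of the Gaussian.\<close>

lemma gauss2_exp_norm: "(\<integral>\<^sup>+v. ennreal (exp ((norm v)\<^sup>2 / 4)) \<partial>gauss2) = 2"
proof -
  have n: "ennreal (exp ((norm v)\<^sup>2 / 4)) = (\<Prod>i\<in>UNIV. ennreal (exp ((v $ i)\<^sup>2 / 4)))" for v :: "real^2"
    by (simp add: norm_vec2 UNIV_2 add_divide_distrib exp_add ennreal_mult')
  have "(\<integral>\<^sup>+y. ennreal (std_normal_density y) * ennreal (exp (y\<^sup>2 / 4)) \<partial>lborel)
      = (\<integral>\<^sup>+y. ennreal (1 / sqrt (2 * pi)) * ennreal (exp (- (1/2) * y\<^sup>2 / 2)) \<partial>lborel)"
  proof (rule nn_integral_cong)
    fix y :: real
    have "exp (- y\<^sup>2 / 2) * exp (y\<^sup>2 / 4) = exp (- (1/2) * y\<^sup>2 / 2)" unfolding exp_add[symmetric] by simp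
    then have "std_normal_density y * exp (y\<^sup>2 / 4) = 1 / sqrt (2 * pi) * exp (- (1/2) * y\<^sup>2 / 2)"
      by (simp only: std_normal_density_def mult.assoc)
    then show "ennreal (std_normal_density y) * ennreal (exp (y\<^sup>2 / 4)) = ennreal (1 / sqrt (2 * pi)) * ennreal (exp (- (1/2) * y\<^sup>2 / 2))"
      by (metis ennreal_mult' normal_density_nonneg zero_le_divide_1_iff real_sqrt_ge_0_iff pi_ge_zero zero_le_mult_iff zero_le_numeral)
  qed
  also have "\<dots> = ennreal (1 / sqrt (2 * pi)) * ennreal (sqrt (2 * pi / (1/2)))"
    by (subst nn_integral_gauss_1d(1)[symmetric], simp) (rule nn_integral_cmult, simp)
  also have "\<dots> = ennreal (sqrt 2)"
    by (subst ennreal_mult'[symmetric]) (auto simp: real_sqrt_mult real_sqrt_divide real_div_sqrt)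
  finally have one: "(\<integral>\<^sup>+y. ennreal (std_normal_density y) * ennreal (exp (y\<^sup>2 / 4)) \<partial>lborel) = ennreal (sqrt 2)" .
  have "(\<integral>\<^sup>+v. ennreal (exp ((norm v)\<^sup>2 / 4)) \<partial>gauss2) = (\<Prod>i\<in>(UNIV::2 set). ennreal (sqrt 2))"
    unfolding n by (subst nn_integral_gauss2_prod) (auto simp: one)
  also have "\<dots> = 2" by (simp add: UNIV_2 ennreal_mult'[symmetric])
  finally show ?thesis .
qed

text \<open>Markov's inequality with the weight of \<open>gauss2_exp_norm\<close>. The exact
  exponent would be twice as large; \<open>\<kappa>\<close> is calibrated to this one.\<close>

lemma gauss2_tail:
  assumes "0 \<le> r"
  shows "emeasure gauss2 {v. r < norm v} \<le> ennreal (2 * exp (- r\<^sup>2 / 4))"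
proof -
  let ?c = "ennreal (exp (- r\<^sup>2 / 4))"
  have "emeasure gauss2 {v. r < norm v} \<le> emeasure gauss2 {v\<in>UNIV. 1 \<le> ?c * ennreal (exp ((norm v)\<^sup>2 / 4))}"
  proof (rule emeasure_mono)
    show "{v :: real^2. r < norm v} \<subseteq> {v\<in>UNIV. 1 \<le> ?c * ennreal (exp ((norm v)\<^sup>2 / 4))}"
    proof
      fix v :: "real^2" assume "v \<in> {v. r < norm v}"
      then have "r\<^sup>2 \<le> (norm v)\<^sup>2" using assms by (intro power_mono) auto
      then have "1 \<le> exp (- r\<^sup>2 / 4) * exp ((norm v)\<^sup>2 / 4)" unfolding exp_add[symmetric] by (intro one_le_exp_iff[THEN iffD2]) simp
      then have "1 \<le> ?c * ennreal (exp ((norm v)\<^sup>2 / 4))"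
        by (simp only: ennreal_mult'[symmetric] exp_ge_zero ennreal_1[symmetric] ennreal_leI)
      then show "v \<in> {v\<in>UNIV. 1 \<le> ?c * ennreal (exp ((norm v)\<^sup>2 / 4))}" by blast
    qed
  qed measurable
  also have "\<dots> \<le> ?c * (\<integral>\<^sup>+v. ennreal (exp ((norm v)\<^sup>2 / 4)) * indicator UNIV v \<partial>gauss2)"
    by (intro nn_integral_Markov_inequality) auto
  also have "\<dots> = ennreal (2 * exp (- r\<^sup>2 / 4))"
    using ennreal_mult'[of 2 "exp (- r\<^sup>2 / 4)"] by (simp add: gauss2_exp_norm mult.commute)
  finally show ?thesis .
qed

text \<open>The tangent at 1/2 bounds the convex function \<open>exp (- u)\<close>, \<open>u = y\<^sup>2 / 2\<close>, from below; only \<open>e \<le> 3\<close>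
  and \<open>pi < 4\<close> are used.\<close>

lemma std_normal_interval_ge:
  assumes lr: "l \<le> r"
  shows "ennreal (exp (- 1/2) / sqrt (2 * pi) * (3/2 * (r - l) - (r ^ 3 - l ^ 3) / 6))
    \<le> (\<integral>\<^sup>+y. ennreal (std_normal_density y) * indicator {l..r} y \<partial>lborel)"
proof -
  define C where "C = exp (- 1/2) / sqrt (2 * pi)"
  let ?f = "\<lambda>y::real. C * (3/2 - y\<^sup>2 / 2)"
  have le: "?f y \<le> std_normal_density y" for y
  proof -
    have "exp (- 1/2) * (1 + (1/2 - y\<^sup>2 / 2)) \<le> exp (- 1/2) * exp (1/2 - y\<^sup>2 / 2)"
      by (intro mult_left_mono exp_ge_add_one_self) auto
    also have "\<dots> = exp (- y\<^sup>2 / 2)" unfolding exp_add[symmetric] by simp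
    finally show ?thesis
      using divide_right_mono[of _ _ "sqrt (2 * pi)"] by (fastforce simp: std_normal_density_def C_def)
  qed
  have hi: "(?f has_integral C * (3/2 * r - r ^ 3 / 6) - C * (3/2 * l - l ^ 3 / 6)) {l..r}"
  proof (rule fundamental_theorem_of_calculus[OF lr])
    fix y assume "y \<in> {l..r}"
    have "((\<lambda>y. C * (3/2 * y - y ^ 3 / 6)) has_real_derivative ?f y) (at y)"
      by (auto intro!: derivative_eq_intros simp: field_simps)
    then show "((\<lambda>y. C * (3/2 * y - y ^ 3 / 6)) has_vector_derivative ?f y) (at y within {l..r})"
      by (simp add: has_real_derivative_iff_has_vector_derivative has_vector_derivative_at_within)
  qed
  have si: "set_integrable lborel {l..r} ?f"
    by (rule borel_integrable_atLeastAtMost') (auto intro!: continuous_intros)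
  have sd: "set_integrable lborel {l..r} std_normal_density"
    unfolding set_integrable_def by (rule integrable_mult_indicator) auto
  have "C * (3/2 * (r - l) - (r ^ 3 - l ^ 3) / 6) = (LBINT y:{l..r}. ?f y)"
    using set_borel_integral_eq_integral(2)[OF si] integral_unique[OF hi] by (simp add: algebra_simps diff_divide_distrib)
  also have "\<dots> \<le> (LBINT y:{l..r}. std_normal_density y)"
    by (rule set_integral_mono[OF si sd]) (rule le)
  finally have "ennreal (C * (3/2 * (r - l) - (r ^ 3 - l ^ 3) / 6)) \<le> ennreal (LBINT y:{l..r}. std_normal_density y)"
    by (rule ennreal_leI)
  also have "\<dots> = (\<integral>\<^sup>+y. ennreal (indicator {l..r} y *\<^sub>R std_normal_density y) \<partial>lborel)"
    unfolding set_lebesgue_integral_def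
    by (rule nn_integral_eq_integral[symmetric]) (use sd in \<open>auto simp: set_integrable_def\<close>)
  also have "\<dots> = (\<integral>\<^sup>+y. ennreal (std_normal_density y) * indicator {l..r} y \<partial>lborel)"
    by (intro nn_integral_cong) (simp add: indicator_def)
  finally show ?thesis unfolding C_def .
qed

text \<open>The set contains a coordinate box, whose Gaussian mass factorises. The coordinate in
  which \<open>u\<close> is larger gets the side away from 0, and the signs follow those of
  \<open>u\<close>.\<close>

lemma gauss2_halfplane_ge:
  fixes u :: "real^2"
  shows "ennreal (1/20) \<le> emeasure gauss2 {e. norm e \<le> 5/2 \<and> norm u / 2 \<le> u \<bullet> e}"
proof -
  have main: "ennreal (1/20) \<le> emeasure gauss2 {e. norm e \<le> 5/2 \<and> norm u / 2 \<le> u \<bullet> e}"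
    if ij: "(i, j) \<in> {(1, 2), (2, 1)}" and big: "\<bar>u $ j\<bar> \<le> \<bar>u $ i\<bar>" for i j :: 2
  proof -
    \<comment> \<open>71/100 exceeds half of \<open>sqrt 2\<close>, which suffices because the norm
      of \<open>u\<close> is at most \<open>sqrt 2\<close> times its larger coordinate; the other
      end points keep the box within radius 5/2.\<close>
    define l r where "l = (\<lambda>k. if k = i then (if 0 \<le> u $ i then 71/100 else - 171/100) else (if 0 \<le> u $ j then 0 else - 17/10 :: real))"
      and "r = (\<lambda>k. if k = i then (if 0 \<le> u $ i then 171/100 else - 71/100) else (if 0 \<le> u $ j then 17/10 else 0 :: real))"
    have two: "(\<Prod>k\<in>UNIV. h k) = h i * h j" for h :: "2 \<Rightarrow> ennreal"
      using ij by (auto simp: UNIV_2 mult.commute)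
    have nij: "i \<noteq> j" using ij by auto
    have inn: "u \<bullet> e = u $ i * e $ i + u $ j * e $ j" and nn: "(norm e)\<^sup>2 = (e $ i)\<^sup>2 + (e $ j)\<^sup>2" for e u :: "real^2"
      using ij by (auto simp: inner_vec_def UNIV_2 norm_vec2)
    have sub: "{e. \<forall>k. e $ k \<in> {l k..r k}} \<subseteq> {e. norm e \<le> 5/2 \<and> norm u / 2 \<le> u \<bullet> e}"
    proof safe
      fix e assume e: "\<forall>k. e $ k \<in> {l k..r k}"
      have ei: "71/100 \<le> \<bar>e $ i\<bar>" "\<bar>e $ i\<bar> \<le> 171/100" "u $ i * e $ i = \<bar>u $ i\<bar> * \<bar>e $ i\<bar>"
        using e[rule_format, of i] by (auto simp: l_def r_def abs_if split: if_splits)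
      have ej: "\<bar>e $ j\<bar> \<le> 17/10" "u $ j * e $ j \<ge> 0"
        using e[rule_format, of j] nij by (auto simp: l_def r_def mult_nonpos_nonpos split: if_splits)
      have "(norm e)\<^sup>2 \<le> (171/100)\<^sup>2 + (17/10)\<^sup>2"
        unfolding nn using ei ej by (intro add_mono) (auto intro: abs_le_square_iff[THEN iffD1])
      also have "\<dots> \<le> (5/2)\<^sup>2" by (simp add: power2_eq_square)
      finally show "norm e \<le> 5/2" by (rule power2_le_imp_le) simp
      have "(norm u)\<^sup>2 \<le> 2 * (u $ i)\<^sup>2" unfolding nn using abs_le_square_iff[THEN iffD1, OF big] by simp
      also have "\<dots> \<le> (2 * (71/100 * \<bar>u $ i\<bar>))\<^sup>2" by (simp add: power2_eq_square)
      finally have "norm u \<le> 2 * (71/100 * \<bar>u $ i\<bar>)" by (rule power2_le_imp_le) simp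
      also have "71/100 * \<bar>u $ i\<bar> \<le> \<bar>e $ i\<bar> * \<bar>u $ i\<bar>" using ei by (intro mult_right_mono) auto
      finally show "norm u / 2 \<le> u \<bullet> e" unfolding inn using ei(3) ej(2) by (simp add: mult.commute)
    qed
    define C where "C = exp (- 1/2) / sqrt (2 * pi)"
    have C0: "0 \<le> C" by (simp add: C_def)
    let ?I = "\<lambda>k. \<integral>\<^sup>+y. ennreal (std_normal_density y) * indicator {l k..r k} y \<partial>lborel"
    \<comment> \<open>363/500 and 173/100 round down the tangent bound on the two sides. As
      \<open>C * C\<close> is at least 1/24, their product still leaves more than 1/20.\<close>
    have I: "ennreal (C * (363/500)) \<le> ?I i" "ennreal (C * (173/100)) \<le> ?I j"
    proof -
      have "ennreal (C * (363/500)) \<le> ennreal (C * (3/2 * (r i - l i) - (r i ^ 3 - l i ^ 3) / 6))"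
        using C0 by (intro ennreal_leI mult_left_mono) (auto simp: l_def r_def power3_eq_cube)
      also have "\<dots> \<le> ?I i" unfolding C_def by (rule std_normal_interval_ge) (auto simp: l_def r_def)
      finally show "ennreal (C * (363/500)) \<le> ?I i" .
      have "ennreal (C * (173/100)) \<le> ennreal (C * (3/2 * (r j - l j) - (r j ^ 3 - l j ^ 3) / 6))"
        using nij using C0 by (intro ennreal_leI mult_left_mono) (auto simp: l_def r_def power3_eq_cube)
      also have "\<dots> \<le> ?I j" unfolding C_def by (rule std_normal_interval_ge) (auto simp: l_def r_def)
      finally show "ennreal (C * (173/100)) \<le> ?I j" .
    qed
    have "1/20 \<le> C * (363/500) * (C * (173/100))"
    proof -
      have "C * C = exp (- 1) / (2 * pi)"
        by (simp add: C_def exp_add[symmetric])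
      also have "\<dots> \<ge> (1/3) / (2 * 4)"
        using exp_le pi_less_4 pi_gt_zero by (intro frac_le) (auto simp: exp_minus field_simps)
      finally show ?thesis by simp
    qed
    then have "ennreal (1/20) \<le> ennreal (C * (363/500)) * ennreal (C * (173/100))"
      using C0 by (subst ennreal_mult'[symmetric]) (auto intro!: ennreal_leI)
    also have "\<dots> \<le> ?I i * ?I j" by (intro mult_mono I) auto
    also have "\<dots> = (\<Prod>k\<in>UNIV. ?I k)" by (simp only: two)
    also have "\<dots> = (\<integral>\<^sup>+v. (\<Prod>k\<in>UNIV. indicator {l k..r k} (v $ k)) \<partial>gauss2)"
      by (rule nn_integral_gauss2_prod[symmetric]) simp
    also have "\<dots> = (\<integral>\<^sup>+v. indicator {e. \<forall>k. e $ k \<in> {l k..r k}} v \<partial>gauss2)"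
    proof (rule nn_integral_cong)
      fix v
      have "(\<forall>k. v $ k \<in> {l k..r k}) \<longleftrightarrow> v $ i \<in> {l i..r i} \<and> v $ j \<in> {l j..r j}"
        unfolding forall_2 using ij by blast
      then have "(indicator {e. \<forall>k. e $ k \<in> {l k..r k}} v :: ennreal) = indicator {l i..r i} (v $ i) * indicator {l j..r j} (v $ j)"
        unfolding indicator_def mem_Collect_eq by (simp only: if_distrib of_bool_def) (simp split: if_split)
      also have "\<dots> = (\<Prod>k\<in>UNIV. indicator {l k..r k} (v $ k))" by (rule two[symmetric])
      finally show "(\<Prod>k\<in>UNIV. indicator {l k..r k} (v $ k)) = (indicator {e. \<forall>k. e $ k \<in> {l k..r k}} v :: ennreal)" ..
    qed
    also have "\<dots> \<le> (\<integral>\<^sup>+v. indicator {e. norm e \<le> 5/2 \<and> norm u / 2 \<le> u \<bullet> e} v \<partial>gauss2)"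
      using sub by (intro nn_integral_mono) (auto simp: indicator_def)
    also have "\<dots> = emeasure gauss2 {e. norm e \<le> 5/2 \<and> norm u / 2 \<le> u \<bullet> e}"
      by (rule nn_integral_indicator) measurable
    finally show ?thesis .
  qed
  show ?thesis
    using main[of 1 2] main[of 2 1] by (cases "\<bar>u $ 2\<bar> \<le> \<bar>u $ 1\<bar>") auto
qed

section \<open>Optimism of the sampled pair\<close>

lemma matrix_inv_design_sym:
  "(matrix_inv (design_matrix 1 x q t) *v a) \<bullet> b = a \<bullet> (matrix_inv (design_matrix 1 x q t) *v b)"
proof -
  let ?z = "\<lambda>s. regressor (x s) (q s)" and ?i = "\<lambda>v. matrix_inv (design_matrix 1 x q t) *v v"
  have "?i a \<bullet> design_op ?z t (?i b) = design_op ?z t (?i a) \<bullet> ?i b" by (rule design_op_sym)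
  then show ?thesis by (simp only: design_matrix_inv)
qed

text \<open>The design is at least the identity, so its inverse lies between 0 and the
  identity.\<close>

lemma matrix_inv_design_quad:
  "v \<bullet> (matrix_inv (design_matrix 1 x q t) *v v) \<ge> 0"
  "v \<bullet> (matrix_inv (design_matrix 1 x q t) *v v) \<le> (norm v)\<^sup>2"
proof -
  let ?z = "\<lambda>s. regressor (x s) (q s)"
  let ?u = "matrix_inv (design_matrix 1 x q t) *v v"
  have le: "(norm ?u)\<^sup>2 \<le> v \<bullet> ?u"
    using design_op_ge[of ?u ?z t] by (simp add: design_matrix_inv inner_commute)
  then show "v \<bullet> ?u \<ge> 0" using zero_le_power2 order_trans by blast
  have cs: "v \<bullet> ?u \<le> norm v * norm ?u" by (rule norm_cauchy_schwarz)
  with le have "norm ?u * norm ?u \<le> norm ?u * norm v" by (simp add: power2_eq_square mult.commute)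
  then have "norm ?u \<le> norm v" by (cases "norm ?u = 0") (auto simp: mult_le_cancel_left)
  then have "norm v * norm ?u \<le> norm v * norm v" by (intro mult_left_mono) auto
  with cs show "v \<bullet> ?u \<le> (norm v)\<^sup>2" by (simp add: power2_eq_square)
qed

text \<open>Up to the squared scale, the covariance of the sampled pair given the history.\<close>

definition sampling_cov :: "(nat \<Rightarrow> real^'n) \<Rightarrow> (nat \<Rightarrow> real) \<Rightarrow> nat \<Rightarrow> real^2^2" where
  "sampling_cov x q t = transpose (block_covariate (x t)) ** matrix_inv (design_matrix 1 x q (t - 1)) ** block_covariate (x t)"

lemma sampling_cov_inner:
  "v \<bullet> (sampling_cov x q t *v w)
    = (block_covariate (x t) *v v) \<bullet> (matrix_inv (design_matrix 1 x q (t - 1)) *v (block_covariate (x t) *v w))"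
  unfolding sampling_cov_def matrix_vector_mul_assoc[symmetric]
  by (metis dot_lmul_matrix inner_commute transpose_matrix_vector)

lemma sampling_cov_sym: "transpose (sampling_cov x q t) = sampling_cov x q t"
proof -
  have "transpose (sampling_cov x q t) *v v = sampling_cov x q t *v v" for v
  proof (rule vector_eq_ldot[THEN iffD1], rule allI)
    fix w
    have "w \<bullet> (transpose (sampling_cov x q t) *v v) = v \<bullet> (sampling_cov x q t *v w)"
      by (metis dot_lmul_matrix inner_commute transpose_matrix_vector)
    also have "\<dots> = w \<bullet> (sampling_cov x q t *v v)"
      unfolding sampling_cov_inner by (subst matrix_inv_design_sym[symmetric]) (rule inner_commute)
    finally show "w \<bullet> (transpose (sampling_cov x q t) *v v) = w \<bullet> (sampling_cov x q t *v v)" .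
  qed
  then show ?thesis by (simp add: matrix_eq)
qed

lemma sampling_cov_psd: "0 \<le> v \<bullet> (sampling_cov x q t *v v)"
  unfolding sampling_cov_inner by (rule matrix_inv_design_quad)

text \<open>Pairing with this vector evaluates a pair \<open>(a, b)\<close> as the index
  \<open>a + b * r\<close>.\<close>

definition price_vec :: "real \<Rightarrow> real^2" where
  "price_vec r = vector [1, r]"

lemma block_covariate_price_vec: "block_covariate y *v price_vec r = regressor y r"
  by (simp add: block_covariate_mult regressor_eq price_vec_def)

definition width :: "(nat \<Rightarrow> real^'n) \<Rightarrow> (nat \<Rightarrow> real) \<Rightarrow> nat \<Rightarrow> real \<Rightarrow> real" where
  "width x q t r = sqrt (regressor (x t) r \<bullet> (matrix_inv (design_matrix 1 x q (t - 1)) *v regressor (x t) r))"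

lemma width_nonneg: "0 \<le> width x q t r"
  unfolding width_def using matrix_inv_design_quad(1) by simp

lemma width_le: "width x q t r \<le> norm (regressor (x t) r)"
  unfolding width_def using matrix_inv_design_quad(2) by (metis norm_ge_zero real_sqrt_abs real_sqrt_le_mono abs_of_nonneg)

text \<open>The sampled index at price \<open>r\<close> thus fluctuates by \<open>\<gamma>\<close>
  times the width at \<open>r\<close>, the same quantity that controls the estimation error
  there.\<close>

lemma norm_psd_sqrt_price_vec: "norm (psd_sqrt (sampling_cov x q t) *v price_vec r) = width x q t r"
proof -
  let ?S = "psd_sqrt (sampling_cov x q t)" and ?w = "price_vec r"
  note S = psd_sqrt_2x2(2,3)[OF sampling_cov_sym[of x q t] sampling_cov_psd[of _ x q t]]
  have "(?S *v ?w) \<bullet> (?S *v ?w) = ?w \<bullet> (?S *v (?S *v ?w))"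
    using S(1) by (metis dot_lmul_matrix transpose_matrix_vector)
  also have "\<dots> = ?w \<bullet> (sampling_cov x q t *v ?w)" by (simp add: matrix_vector_mul_assoc S(2))
  finally show ?thesis
    by (simp add: norm_eq_sqrt_inner width_def sampling_cov_inner block_covariate_price_vec)
qed

context pricing_model
begin

text \<open>Symmetry moves the root from the draw to the price vector, so the sampled index is the
  estimated one plus an inner product with the draw.\<close>

lemma ts_sample_price:
  "ts_sample g gmin \<theta>max \<sigma> 1 T x q D t e $ 1 + ts_sample g gmin \<theta>max \<sigma> 1 T x q D t e $ 2 * r
    = regressor (x t) r \<bullet> qmle g gmin \<theta>max 1 x q D (t - 1)
      + \<gamma> * ((psd_sqrt (sampling_cov x q t) *v price_vec r) \<bullet> e)"
proof -
  let ?S = "psd_sqrt (sampling_cov x q t)"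
  have sc: "ts_scale gmin \<theta>max \<sigma> 1 CARD('n) T = \<gamma>"
    by (simp add: ts_scale_def \<gamma>_def gamma_bar_def ncov_def)
  have S: "transpose ?S = ?S"
    by (rule psd_sqrt_2x2(2)[OF sampling_cov_sym sampling_cov_psd])
  have "(?S *v price_vec r) \<bullet> e = price_vec r \<bullet> (?S *v e)"
    using S by (metis dot_lmul_matrix transpose_matrix_vector)
  also have "\<dots> = (?S *v e) $ 1 + (?S *v e) $ 2 * r"
    by (simp add: price_vec_def inner_vec_def UNIV_2)
  finally show ?thesis
    unfolding ts_sample_def Let_def sc sampling_cov_def[symmetric]
    by (simp add: regressor_inner algebra_simps)
qed

lemma opt_revenue_attained:
  "\<exists>r\<in>{pmin..pmax}. opt_revenue g pmin pmax a b = revenue g a b r"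
proof -
  have "continuous_on UNIV g" using isCont_g by (intro continuous_at_imp_continuous_on) auto
  then have "continuous_on {pmin..pmax} (revenue g a b)"
    unfolding revenue_def[abs_def]
    by (intro continuous_intros continuous_on_compose2[OF \<open>continuous_on UNIV g\<close>]) auto
  then obtain r where r: "r \<in> {pmin..pmax}" "\<forall>y\<in>{pmin..pmax}. revenue g a b y \<le> revenue g a b r"
    using continuous_attains_sup[of "{pmin..pmax}" "revenue g a b"] prices by auto
  then have "opt_revenue g pmin pmax a b = revenue g a b r"
    unfolding opt_revenue_def by (intro cSup_eq_maximum) auto
  then show ?thesis using r by blast
qed

lemma revenue_le_opt:
  assumes "r \<in> {pmin..pmax}"
  shows "revenue g a b r \<le> opt_revenue g pmin pmax a b"
proof -
  have "continuous_on UNIV g" using isCont_g by (intro continuous_at_imp_continuous_on) auto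
  then have "continuous_on {pmin..pmax} (revenue g a b)"
    unfolding revenue_def[abs_def]
    by (intro continuous_intros continuous_on_compose2[OF \<open>continuous_on UNIV g\<close>]) auto
  then have "bdd_above (revenue g a b ` {pmin..pmax})"
    by (intro compact_imp_bounded[THEN bounded_imp_bdd_above] compact_continuous_image) auto
  then show ?thesis unfolding opt_revenue_def using assms by (intro cSUP_upper) auto
qed

abbreviation true_revenue :: "nat \<Rightarrow> real \<Rightarrow> real" where
  "true_revenue t \<equiv> revenue g (x t \<bullet> \<alpha>) (x t \<bullet> \<beta>)"

abbreviation best_revenue :: "nat \<Rightarrow> real" where
  "best_revenue t \<equiv> opt_revenue g pmin pmax (x t \<bullet> \<alpha>) (x t \<bullet> \<beta>)"

lemma true_revenue_eq: "true_revenue t r = r * g (regressor (x t) r \<bullet> stack \<alpha> \<beta>)"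
  by (simp add: revenue_def regressor_inner)

lemma true_revenue_bounds:
  assumes "t \<in> {1..T}" "r \<in> {pmin..pmax}"
  shows "0 \<le> true_revenue t r" "true_revenue t r \<le> Dmax * pmax"
proof -
  have d: "0 \<le> g (x t \<bullet> \<alpha> + (x t \<bullet> \<beta>) * r)" "g (x t \<bullet> \<alpha> + (x t \<bullet> \<beta>) * r) \<le> Dmax"
    using demand_bounds[OF covariates[OF assms(1)] assms(2)] by auto
  have r: "0 \<le> r" "r \<le> pmax" using assms(2) prices by auto
  show "0 \<le> true_revenue t r" using d r by (simp add: revenue_def)
  have "r * g (x t \<bullet> \<alpha> + (x t \<bullet> \<beta>) * r) \<le> pmax * Dmax" using d r by (intro mult_mono) auto
  then show "true_revenue t r \<le> Dmax * pmax" by (simp add: revenue_def mult.commute)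
qed

lemma best_revenue_le: "t \<in> {1..T} \<Longrightarrow> best_revenue t \<le> Dmax * pmax"
  using opt_revenue_attained[of "x t \<bullet> \<alpha>" "x t \<bullet> \<beta>"] true_revenue_bounds(2) by metis

lemma gmax_nonneg: "0 \<le> gmax"
proof -
  have "x 1 \<in> \<X>" using horizon covariates by auto
  moreover have "pmin \<in> {pmin..pmax}" using prices by simp
  ultimately have "gmin \<le> deriv g 0" "deriv g 0 \<le> gmax"
    using \<theta>max \<gamma>_pos \<kappa>_nonneg by (intro deriv_bounds[of "x 1" pmin]; simp)+
  then show ?thesis using gmin by linarith
qed

lemma \<kappa>_ge: "4 \<le> \<kappa>"
proof -
  have "2 \<le> sqrt (ln (4 * (real T)\<^sup>2))" using ln_T by (intro real_le_rsqrt) simp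
  then show ?thesis by (simp add: \<kappa>_def)
qed

text \<open>A property of the data alone, hence a function of the history. The radius is half the
  sampling scale.\<close>

definition confident :: "(nat \<Rightarrow> real) \<Rightarrow> (nat \<Rightarrow> real) \<Rightarrow> nat \<Rightarrow> bool" where
  "confident q D t \<longleftrightarrow> (let \<Delta> = qmle g gmin \<theta>max 1 x q D t - stack \<alpha> \<beta> in
     \<Delta> \<bullet> design_op (\<lambda>s. regressor (x s) (q s)) t \<Delta> \<le> (\<gamma> / 2)\<^sup>2)"

text \<open>Since the pair sampled with \<open>e2\<close> is optimistic, it may replace the optimum; passing to the pair sampled
  with \<open>e1\<close> at the price \<open>p2\<close> costs a multiple of the width at \<open>p2\<close>, and \<open>p1\<close> is optimal for that pair.\<close>

lemma optimism_step:
  fixes q D :: "nat \<Rightarrow> real"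
  assumes t: "t \<in> {1..T}" and q: "\<And>s. s \<in> {1..t - 1} \<Longrightarrow> q s \<in> {pmin..pmax}"
    and conf: "confident q D (t - 1)"
    and p1: "p1 \<in> {pmin..pmax}" and p2: "p2 \<in> {pmin..pmax}" and pst: "pst \<in> {pmin..pmax}"
    and opt: "best_revenue t = true_revenue t pst"
    and e1: "norm e1 \<le> \<kappa>" and e2: "norm e2 \<le> 5/2"
    and e2': "norm (psd_sqrt (sampling_cov x q t) *v price_vec pst) / 2 \<le> (psd_sqrt (sampling_cov x q t) *v price_vec pst) \<bullet> e2"
  defines "ab \<equiv> ts_sample g gmin \<theta>max \<sigma> 1 T x q D t"
  assumes m1: "revenue g (ab e1 $ 1) (ab e1 $ 2) p2 \<le> revenue g (ab e1 $ 1) (ab e1 $ 2) p1"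
    and m2: "revenue g (ab e2 $ 1) (ab e2 $ 2) pst \<le> revenue g (ab e2 $ 1) (ab e2 $ 2) p2"
  shows "best_revenue t - true_revenue t p1
    \<le> pmax * gmax * \<gamma> * ((\<kappa> + 1/2) * width x q t p1 + (\<kappa> + 5/2) * width x q t p2)"
proof -
  let ?h = "qmle g gmin \<theta>max 1 x q D (t - 1)"
  let ?z = "\<lambda>r. regressor (x t) r"
  let ?u = "\<lambda>r. psd_sqrt (sampling_cov x q t) *v price_vec r"
  let ?W = "width x q t"
  define v where "v = (\<lambda>e r. ?z r \<bullet> ?h + \<gamma> * (?u r \<bullet> e))"
  have rev: "revenue g (ab e $ 1) (ab e $ 2) r = r * g (v e r)" for e r
    by (simp add: revenue_def ab_def ts_sample_price v_def)
  have xt: "x t \<in> \<X>" by (rule covariates[OF t])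
  have tT: "t - 1 \<le> T" using t by auto
  have h: "?h \<in> cball 0 \<theta>max" by (rule qmle_first_order(1)[OF tT q])
  have nu: "norm (?u r) = ?W r" for r by (rule norm_psd_sqrt_price_vec)
  \<comment> \<open>Cauchy-Schwarz for the design form, between the inverse design of the regressor
    and the estimation error.\<close>
  have err: "\<bar>?z r \<bullet> ?h - ?z r \<bullet> stack \<alpha> \<beta>\<bar> \<le> \<gamma> / 2 * ?W r" for r
  proof -
    let ?\<Delta> = "?h - stack \<alpha> \<beta>" and ?V = "design_op (\<lambda>s. regressor (x s) (q s)) (t - 1)"
    let ?s = "matrix_inv (design_matrix 1 x q (t - 1)) *v ?z r"
    have "(?z r \<bullet> ?\<Delta>)\<^sup>2 \<le> (?s \<bullet> ?z r) * (?\<Delta> \<bullet> ?V ?\<Delta>)"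
      using design_op_cauchy[of "\<lambda>s. regressor (x s) (q s)" "t - 1" ?s ?\<Delta>] by (simp only: design_matrix_inv)
    also have "\<dots> \<le> (?s \<bullet> ?z r) * (\<gamma> / 2)\<^sup>2"
      using conf matrix_inv_design_quad(1)[of "?z r" x q "t - 1"]
      by (intro mult_left_mono) (auto simp: confident_def Let_def inner_commute)
    also have "\<dots> = (\<gamma> / 2 * ?W r)\<^sup>2"
      using matrix_inv_design_quad(1)[of "?z r" x q "t - 1"]
      unfolding width_def power_mult_distrib by (simp add: inner_commute mult.commute)
    finally have "\<bar>?z r \<bullet> ?\<Delta>\<bar> \<le> \<bar>\<gamma> / 2 * ?W r\<bar>" by (simp only: abs_le_square_iff)
    then show ?thesis using \<gamma>_pos width_nonneg[of x q t r] by (simp add: inner_diff_right abs_mult)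
  qed
  have ue: "\<bar>?u r \<bullet> e\<bar> \<le> ?W r * norm e" for r e
    using Cauchy_Schwarz_ineq2[of "?u r" e] by (simp add: nu)
  \<comment> \<open>Draws of norm at most \<open>\<kappa>\<close> keep sampled indices where the
    slope bounds hold, because the width is at most the norm of the regressor.\<close>
  have range_v: "\<bar>v e r\<bar> \<le> (\<theta>max + \<gamma> * \<kappa>) * norm (?z r)" if e: "norm e \<le> \<kappa>" for e r
  proof -
    have "\<bar>?z r \<bullet> ?h\<bar> \<le> norm (?z r) * \<theta>max"
      using Cauchy_Schwarz_ineq2[of "?z r" ?h] mult_left_mono[of "norm ?h" \<theta>max "norm (?z r)"] h by simp
    moreover have "\<bar>\<gamma> * (?u r \<bullet> e)\<bar> \<le> \<gamma> * (norm (?z r) * \<kappa>)"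
    proof -
      have "\<bar>?u r \<bullet> e\<bar> \<le> norm (?z r) * \<kappa>"
        using ue[of r e] mult_mono[OF width_le[of x q t r] e] width_nonneg[of x q t r] by simp
      then show ?thesis using \<gamma>_pos by (simp add: abs_mult)
    qed
    ultimately show ?thesis unfolding v_def by (simp add: algebra_simps)
  qed
  have range_true: "\<bar>?z r \<bullet> stack \<alpha> \<beta>\<bar> \<le> (\<theta>max + \<gamma> * \<kappa>) * norm (?z r)" for r
    by (rule inner_ball_le[OF true_param])
  have e2\<kappa>: "norm e2 \<le> \<kappa>" using e2 \<kappa>_ge by simp
  have W0: "0 \<le> ?W r" for r by (rule width_nonneg)
  have pos: "0 \<le> p1" "p1 \<le> pmax" "0 \<le> p2" "p2 \<le> pmax" "0 \<le> pst" using p1 p2 pst prices by auto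
  \<comment> \<open>The optimistic draw adds at least \<open>\<gamma> / 2\<close> times the width at
    \<open>pst\<close>, exactly the largest possible underestimate there.\<close>
  have "?z pst \<bullet> stack \<alpha> \<beta> \<le> v e2 pst"
  proof -
    have "\<gamma> * (?W pst / 2) \<le> \<gamma> * (?u pst \<bullet> e2)" using e2' \<gamma>_pos unfolding nu by (intro mult_left_mono) auto
    then show ?thesis using err[of pst] unfolding v_def abs_le_iff by linarith
  qed
  then have "pst * g (?z pst \<bullet> stack \<alpha> \<beta>) \<le> pst * g (v e2 pst)"
    using pos strict_mono_less_eq[OF g_mono] by (intro mult_left_mono) auto
  also have "\<dots> \<le> p2 * g (v e2 p2)" using m2 unfolding rev .
  finally have s1: "best_revenue t \<le> p2 * g (v e2 p2)" unfolding opt true_revenue_eq .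
  have gi: "r * g a - r * g b \<le> pmax * gmax * d"
    if r: "r \<in> {pmin..pmax}" and a: "\<bar>a\<bar> \<le> (\<theta>max + \<gamma> * \<kappa>) * norm (?z r)" and b: "\<bar>b\<bar> \<le> (\<theta>max + \<gamma> * \<kappa>) * norm (?z r)"
      and d: "\<bar>a - b\<bar> \<le> d" for r a b d
  proof -
    have "g a - g b \<le> gmax * \<bar>a - b\<bar>" using g_increment(1)[OF xt r a b] by linarith
    also have "\<dots> \<le> gmax * d" using d gmax_nonneg by (rule mult_left_mono)
    finally have "r * (g a - g b) \<le> r * (gmax * d)" using r prices by (intro mult_left_mono) auto
    also have "\<dots> \<le> pmax * (gmax * d)" using r d gmax_nonneg by (intro mult_right_mono) auto
    finally show ?thesis by (simp add: algebra_simps)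
  qed
  \<comment> \<open>Exchange of draws at a fixed price: 5/2 comes from \<open>e2\<close> and
    \<open>\<kappa>\<close> from \<open>e1\<close>.\<close>
  have "p2 * g (v e2 p2) - p2 * g (v e1 p2) \<le> pmax * gmax * (\<gamma> * ((\<kappa> + 5/2) * ?W p2))"
  proof (rule gi[OF p2 range_v[OF e2\<kappa>] range_v[OF e1]])
    have "v e2 p2 - v e1 p2 = \<gamma> * (?u p2 \<bullet> e2 - ?u p2 \<bullet> e1)" by (simp add: v_def algebra_simps)
    then have "\<bar>v e2 p2 - v e1 p2\<bar> = \<gamma> * \<bar>?u p2 \<bullet> e2 - ?u p2 \<bullet> e1\<bar>" using \<gamma>_pos by (simp only: abs_mult abs_of_pos)
    also have "\<dots> \<le> \<gamma> * (?W p2 * (5/2) + ?W p2 * \<kappa>)"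
      using ue[of p2 e2] ue[of p2 e1] mult_left_mono[OF e2 W0[of p2]] mult_left_mono[OF e1 W0[of p2]] \<gamma>_pos
      by (intro mult_left_mono) linarith+
    finally show "\<bar>v e2 p2 - v e1 p2\<bar> \<le> \<gamma> * ((\<kappa> + 5/2) * ?W p2)" by (simp add: algebra_simps)
  qed
  moreover have "p2 * g (v e1 p2) \<le> p1 * g (v e1 p1)" using m1 unfolding rev .
  \<comment> \<open>Return to the true curve: \<open>\<kappa>\<close> comes from the draw and 1/2
    from the estimation error.\<close>
  moreover have "p1 * g (v e1 p1) - p1 * g (?z p1 \<bullet> stack \<alpha> \<beta>) \<le> pmax * gmax * (\<gamma> * ((\<kappa> + 1/2) * ?W p1))"
  proof (rule gi[OF p1 range_v[OF e1] range_true])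
    have "\<bar>\<gamma> * (?u p1 \<bullet> e1)\<bar> \<le> \<gamma> * (?W p1 * \<kappa>)"
      using ue[of p1 e1] mult_left_mono[OF e1 W0[of p1]] \<gamma>_pos by (simp add: abs_mult)
    then show "\<bar>v e1 p1 - ?z p1 \<bullet> stack \<alpha> \<beta>\<bar> \<le> \<gamma> * ((\<kappa> + 1/2) * ?W p1)"
      using err[of p1] unfolding v_def abs_le_iff by (simp add: algebra_simps)
  qed
  ultimately have "best_revenue t - true_revenue t p1
      \<le> pmax * gmax * (\<gamma> * ((\<kappa> + 5/2) * ?W p2)) + pmax * gmax * (\<gamma> * ((\<kappa> + 1/2) * ?W p1))"
    using s1 unfolding true_revenue_eq by linarith
  then show ?thesis by (simp add: algebra_simps)
qed

text \<open>With \<open>r = \<sigma> * sqrt \<rho>\<close> the bound of \<open>qmle_error\<close> is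
  \<open>\<gamma> / 2\<close>.\<close>

lemma confident_if_noise_small:
  fixes q D :: "nat \<Rightarrow> real"
  assumes t: "t \<le> T" and q: "\<And>s. s \<in> {1..t} \<Longrightarrow> q s \<in> {pmin..pmax}"
    and u: "design_op (\<lambda>s. regressor (x s) (q s)) t u
        = (\<Sum>s=1..t. (D s - g (regressor (x s) (q s) \<bullet> stack \<alpha> \<beta>)) *\<^sub>R regressor (x s) (q s))"
    and r: "u \<bullet> design_op (\<lambda>s. regressor (x s) (q s)) t u \<le> \<sigma>\<^sup>2 * \<rho>"
  shows "confident q D t"
proof -
  let ?\<Delta> = "qmle g gmin \<theta>max 1 x q D t - stack \<alpha> \<beta>"
  let ?V = "design_op (\<lambda>s. regressor (x s) (q s)) t"
  have "sqrt (?\<Delta> \<bullet> ?V ?\<Delta>) \<le> \<theta>max + (\<sigma> * sqrt \<rho>) / gmin"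
    using r sigma \<rho>_nonneg by (intro qmle_error[OF t q u]) (auto simp: power_mult_distrib)
  also have "\<dots> = \<gamma> / 2" by (simp add: \<gamma>_eq)
  finally have "?\<Delta> \<bullet> ?V ?\<Delta> \<le> (\<gamma> / 2)\<^sup>2" by (rule sqrt_le_D)
  then show ?thesis by (simp add: confident_def Let_def)
qed

end

section \<open>Thompson sampling given the history\<close>

lemma (in prob_space) nn_integral_indep_pair_fst:
  assumes ind: "indep_pair S A R B" and F [measurable]: "F \<in> borel_measurable (S \<Otimes>\<^sub>M R)"
  shows "(\<integral>\<^sup>+\<omega>. F (A \<omega>, B \<omega>) \<partial>M) = (\<integral>\<^sup>+\<omega>. (\<integral>\<^sup>+\<omega>'. F (A \<omega>, B \<omega>') \<partial>M) \<partial>M)"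
proof -
  have [measurable]: "A \<in> measurable M S" "B \<in> measurable M R"
    using ind by (auto simp: indep_pair_def)
  interpret P: pair_sigma_finite M M ..
  have "(\<lambda>(\<omega>, \<omega>'). F (A \<omega>, B \<omega>')) \<in> borel_measurable (M \<Otimes>\<^sub>M M)" by measurable
  from P.Fubini'[OF this] show ?thesis
    unfolding nn_integral_indep_pair[OF ind F] by simp
qed

text \<open>A relation between history and draw that is known only when both come from the same
  sample point survives, for almost all pairs, the replacement of the draw by an independent
  copy.\<close>

lemma (in prob_space) AE_indep_pair:
  assumes ind: "indep_pair S A R B" and K [measurable]: "Measurable.pred (S \<Otimes>\<^sub>M R) K"
    and all: "\<And>\<omega>. \<omega> \<in> space M \<Longrightarrow> K (A \<omega>, B \<omega>)"
  shows "AE \<omega> in M. AE \<omega>' in M. K (A \<omega>, B \<omega>')"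
proof -
  have [measurable]: "A \<in> measurable M S" "B \<in> measurable M R"
    using ind by (auto simp: indep_pair_def)
  define F where "F = (\<lambda>y. indicator {y \<in> space (S \<Otimes>\<^sub>M R). \<not> K y} y :: ennreal)"
  have F [measurable]: "F \<in> borel_measurable (S \<Otimes>\<^sub>M R)" unfolding F_def by measurable
  have "(\<integral>\<^sup>+\<omega>. (\<integral>\<^sup>+\<omega>'. F (A \<omega>, B \<omega>') \<partial>M) \<partial>M) = (\<integral>\<^sup>+\<omega>. F (A \<omega>, B \<omega>) \<partial>M)"
    by (rule nn_integral_indep_pair_fst[OF ind F, symmetric])
  also have "\<dots> = (\<integral>\<^sup>+\<omega>. 0 \<partial>M)"
    using all by (intro nn_integral_cong) (simp add: F_def)
  finally have "(\<integral>\<^sup>+\<omega>. (\<integral>\<^sup>+\<omega>'. F (A \<omega>, B \<omega>') \<partial>M) \<partial>M) = 0" by simp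
  then have AE0: "AE \<omega> in M. (\<integral>\<^sup>+\<omega>'. F (A \<omega>, B \<omega>') \<partial>M) = 0"
    by (subst (asm) nn_integral_0_iff_AE) measurable
  show ?thesis
  proof (rule AE_mp[OF AE0], rule AE_I2, rule impI)
    fix \<omega> assume \<omega>: "\<omega> \<in> space M" and zero: "(\<integral>\<^sup>+\<omega>'. F (A \<omega>, B \<omega>') \<partial>M) = 0"
    have A\<omega>: "A \<omega> \<in> space S" using measurable_space[OF \<open>A \<in> measurable M S\<close> \<omega>] .
    then have m: "(\<lambda>\<omega>'. F (A \<omega>, B \<omega>')) \<in> borel_measurable M" by measurable
    have AE1: "AE \<omega>' in M. F (A \<omega>, B \<omega>') = 0"
      using zero by (subst (asm) nn_integral_0_iff_AE[OF m]) auto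
    show "AE \<omega>' in M. K (A \<omega>, B \<omega>')"
    proof (rule AE_mp[OF AE1], rule AE_I2, rule impI)
      fix \<omega>' assume "\<omega>' \<in> space M" "F (A \<omega>, B \<omega>') = 0"
      moreover have "(A \<omega>, B \<omega>') \<in> space (S \<Otimes>\<^sub>M R)"
        using A\<omega> measurable_space[OF \<open>B \<in> measurable M R\<close> \<open>\<omega>' \<in> space M\<close>]
        by (simp add: space_pair_measure)
      ultimately show "K (A \<omega>, B \<omega>')" by (simp add: F_def indicator_def split: if_splits)
    qed
  qed
qed

section \<open>Dependence on past data, and measurability of sampling and confidence\<close>

lemma qmle_cong:
  assumes "\<And>s. s \<in> {1..k} \<Longrightarrow> q s = q' s" "\<And>s. s \<in> {1..k} \<Longrightarrow> D s = D' s"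
  shows "qmle g gmin \<theta>max lam x q D k = qmle g gmin \<theta>max lam x q' D' k"
proof -
  have "(\<Sum>s=1..k. quasi_lik g (regressor (x s) (q s)) (D s) \<theta>)
      = (\<Sum>s=1..k. quasi_lik g (regressor (x s) (q' s)) (D' s) \<theta>)" for \<theta>
    by (rule sum.cong[OF refl]) (simp only: assms)
  then show ?thesis unfolding qmle_def by (simp only:)
qed

lemma design_matrix_cong:
  assumes "\<And>s. s \<in> {1..k} \<Longrightarrow> q s = q' s"
  shows "design_matrix lam x q k = design_matrix lam x q' k"
  unfolding design_matrix_def by (rule arg_cong, rule sum.cong[OF refl]) (simp only: assms)

lemma ts_sample_cong:
  assumes q: "\<And>s. s \<in> {1..t - 1} \<Longrightarrow> q s = q' s" and D: "\<And>s. s \<in> {1..t - 1} \<Longrightarrow> D s = D' s"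
  shows "ts_sample g gmin \<theta>max \<sigma> lam T x q D t e = ts_sample g gmin \<theta>max \<sigma> lam T x q' D' t e"
proof -
  have "qmle g gmin \<theta>max lam x q D (t - 1) = qmle g gmin \<theta>max lam x q' D' (t - 1)"
    by (rule qmle_cong) (erule q D)+
  moreover have "design_matrix lam x q (t - 1) = design_matrix lam x q' (t - 1)"
    by (rule design_matrix_cong) (erule q)
  ultimately show ?thesis unfolding ts_sample_def by (simp only:)
qed

lemma width_cong:
  assumes q: "\<And>s. s \<in> {1..t - 1} \<Longrightarrow> q s = q' s"
  shows "width x q t r = width x q' t r"
proof -
  have "design_matrix 1 x q (t - 1) = design_matrix 1 x q' (t - 1)"
    by (rule design_matrix_cong) (erule q)
  then show ?thesis unfolding width_def by (simp only:)
qed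

text \<open>Uses the closed formula of \<open>psd_sqrt_2x2\<close>; the definite description alone
  gives no measurability.\<close>

lemma borel_measurable_sampling_sqrt:
  assumes q: "\<And>s. s \<in> {1..t - 1} \<Longrightarrow> (\<lambda>w. q w s) \<in> borel_measurable N"
    and e [measurable]: "e \<in> borel_measurable N"
  shows "(\<lambda>w. (psd_sqrt (sampling_cov x (q w) t) *v v) \<bullet> e w) \<in> borel_measurable N"
proof -
  let ?A = "\<lambda>w. sampling_cov x (q w) t"
  have A [measurable]: "(\<lambda>w. ?A w $ i $ j) \<in> borel_measurable N" for i j
  proof -
    have "?A w $ i $ j = axis i 1 \<bullet> (?A w *v axis j 1)" for w
      by (simp add: inner_axis' matrix_vector_mult_basis column_def)
    then have "(\<lambda>w. ?A w $ i $ j) = (\<lambda>w. (block_covariate (x t) *v axis i 1)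
        \<bullet> (matrix_inv (design_matrix 1 x (q w) (t - 1)) *v (block_covariate (x t) *v axis j 1)))"
      by (simp only: sampling_cov_inner)
    then show ?thesis
      by (simp only:) (intro borel_measurable_inner borel_measurable_const borel_measurable_design_inv q)
  qed
  have [measurable]: "(\<lambda>w. e w $ i) \<in> borel_measurable N" for i
    by (intro measurable_compose[OF e] borel_measurable_continuous_onI continuous_intros)
  note S = psd_sqrt_2x2(1)[OF sampling_cov_sym sampling_cov_psd]
  show ?thesis
    unfolding S by (simp add: inner_vec_def matrix_vector_mult_def UNIV_2 mat_def)
qed

lemma (in pricing_model) borel_measurable_confident:
  assumes q: "\<And>w s. q w s \<in> {pmin..pmax}" and t: "t \<le> T"
    and m: "\<And>s. (\<lambda>w. q w s) \<in> borel_measurable N" "\<And>s. (\<lambda>w. D w s) \<in> borel_measurable N"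
  shows "Measurable.pred N (\<lambda>w. confident (q w) (D w) t)"
proof -
  have [measurable]: "(\<lambda>w. qmle g gmin \<theta>max 1 x (q w) (D w) t) \<in> borel_measurable N"
    by (rule borel_measurable_qmle[OF t q m])
  have [measurable]: "(\<lambda>w. regressor (x s) (q w s)) \<in> borel_measurable N" for s
    unfolding regressor_eq using m(1) by simp
  show ?thesis unfolding confident_def Let_def design_op_quad by measurable
qed

context thompson_sampling
begin

lemma nn_integral_eta:
  assumes t: "t \<in> {1..T}" and [measurable]: "f \<in> borel_measurable borel"
  shows "(\<integral>\<^sup>+\<omega>. f (\<eta> t \<omega>) \<partial>M) = (\<integral>\<^sup>+e. f e \<partial>gauss2)"
proof -
  have "distributed M lborel (\<eta> t) (\<lambda>v. ennreal (\<Prod>i\<in>UNIV. std_normal_density (v $ i)))"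
    using draws t by (auto simp: randomization_def)
  then have eq: "gauss2 = distr M lborel (\<eta> t)" and m: "\<eta> t \<in> measurable M lborel"
    by (auto simp: distributed_def gauss2_def)
  show ?thesis
    unfolding eq by (rule nn_integral_distr[OF m, symmetric]) simp
qed

text \<open>Has the form of the conditioning variable in \<open>randomization\<close>, so that
  independence from \<open>\<eta> t\<close> is immediate.\<close>

definition hist :: "nat \<Rightarrow> 'w \<Rightarrow> (nat \<Rightarrow> real \<times> (real^2)) \<times> (nat \<Rightarrow> real)" where
  "hist t \<omega> = ((\<lambda>s\<in>{1..<t}. (p s \<omega>, \<eta> s \<omega>)), (\<lambda>s\<in>{1..T}. \<epsilon> s \<omega>))"

abbreviation hist_space :: "nat \<Rightarrow> ((nat \<Rightarrow> real \<times> (real^2)) \<times> (nat \<Rightarrow> real)) measure" where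
  "hist_space t \<equiv> (\<Pi>\<^sub>M s\<in>{1..<t}. borel) \<Otimes>\<^sub>M (\<Pi>\<^sub>M s\<in>{1..T}. borel)"

text \<open>Clamping makes the price bounds hold on the whole history space, not only on realised histories.\<close>

definition hist_price :: "nat \<Rightarrow> (nat \<Rightarrow> real \<times> (real^2)) \<times> (nat \<Rightarrow> real) \<Rightarrow> nat \<Rightarrow> real" where
  "hist_price t h s = (if s \<in> {1..<t} then max pmin (min pmax (fst (fst h s))) else pmin)"

definition hist_demand :: "nat \<Rightarrow> (nat \<Rightarrow> real \<times> (real^2)) \<times> (nat \<Rightarrow> real) \<Rightarrow> nat \<Rightarrow> real" where
  "hist_demand t h s = (if s \<in> {1..<t} then g (x s \<bullet> \<alpha> + (x s \<bullet> \<beta>) * hist_price t h s) + snd h s else 0)"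

lemma hist_measurable [measurable]: "t \<in> {1..T} \<Longrightarrow> hist t \<in> measurable M (hist_space t)"
  unfolding hist_def[abs_def] by (rule history_generator)

lemma hist_indep: "t \<in> {1..T} \<Longrightarrow> indep_pair (hist_space t) (hist t) borel (\<eta> t)"
  unfolding hist_def[abs_def] by (rule history_indep)

lemma hist_price_range: "hist_price t h s \<in> {pmin..pmax}"
  using prices by (auto simp: hist_price_def)

lemma hist_price_measurable: "(\<lambda>h. hist_price t h s) \<in> borel_measurable (hist_space t)"
proof (cases "s \<in> {1..<t}")
  case True
  have "(\<lambda>h. fst h s) \<in> borel_measurable (hist_space t)"
    by (rule measurable_compose[OF measurable_fst measurable_component_singleton[OF True]])
  from measurable_compose[OF this borel_measurable_continuous_onI[OF continuous_on_fst[OF continuous_on_id]]]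
  have [measurable]: "(\<lambda>h. fst (fst h s)) \<in> borel_measurable (hist_space t)" .
  have eq: "(\<lambda>h. hist_price t h s) = (\<lambda>h. max pmin (min pmax (fst (fst h s))))" using True by (simp add: hist_price_def fun_eq_iff)
  show ?thesis unfolding eq by measurable
next
  case False
  then have eq: "(\<lambda>h. hist_price t h s) = (\<lambda>h. pmin)" by (auto simp: hist_price_def fun_eq_iff)
  show ?thesis unfolding eq by simp
qed

lemma hist_demand_measurable: "t \<in> {1..T} \<Longrightarrow> (\<lambda>h. hist_demand t h s) \<in> borel_measurable (hist_space t)"
proof (cases "s \<in> {1..<t}")
  case True
  assume "t \<in> {1..T}"
  then have sT: "s \<in> {1..T}" using True by auto
  have [measurable]: "(\<lambda>h. snd h s) \<in> borel_measurable (hist_space t)"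
    by (rule measurable_compose[OF measurable_snd measurable_component_singleton[OF sT]])
  have [measurable]: "g \<in> borel_measurable borel"
    using isCont_g by (intro borel_measurable_continuous_onI continuous_at_imp_continuous_on) auto
  note hist_price_measurable[measurable]
  have eq: "(\<lambda>h. hist_demand t h s) = (\<lambda>h. g (x s \<bullet> \<alpha> + (x s \<bullet> \<beta>) * hist_price t h s) + snd h s)"
    using True by (simp add: hist_demand_def fun_eq_iff)
  show ?thesis unfolding eq by measurable
next
  case False
  then have eq: "(\<lambda>h. hist_demand t h s) = (\<lambda>h. 0)" by (auto simp: hist_demand_def fun_eq_iff)
  show ?thesis unfolding eq by simp
qed

lemma hist_price_eq: "t \<in> {1..T} \<Longrightarrow> \<omega> \<in> space M \<Longrightarrow> s \<in> {1..t - 1} \<Longrightarrow> hist_price t (hist t \<omega>) s = p s \<omega>"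
  using price_range[of s \<omega>] by (auto simp: hist_price_def hist_def)

lemma hist_demand_eq: "t \<in> {1..T} \<Longrightarrow> \<omega> \<in> space M \<Longrightarrow> s \<in> {1..t - 1} \<Longrightarrow> hist_demand t (hist t \<omega>) s = demand g \<alpha> \<beta> x p \<epsilon> s \<omega>"
  using hist_price_eq[of t \<omega> s] by (auto simp: hist_demand_def demand_def) (auto simp: hist_def)

text \<open>Gives meaning to the price that another draw would have produced with the same history.
  Clamping makes the bounds hold for every argument.\<close>

lemma price_factor:
  assumes t: "t \<in> {1..T}"
  shows "\<exists>P\<in>borel_measurable (hist_space t \<Otimes>\<^sub>M borel).
    (\<forall>y. P y \<in> {pmin..pmax}) \<and> (\<forall>\<omega>\<in>space M. p t \<omega> = P (hist t \<omega>, \<eta> t \<omega>))"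
proof -
  let ?g = "\<lambda>\<omega>. (hist t \<omega>, \<eta> t \<omega>)"
  let ?V = "vimage_algebra (space M) ?g (hist_space t \<Otimes>\<^sub>M borel)"
  have gsp: "?g \<in> space M \<rightarrow> space (hist_space t \<Otimes>\<^sub>M borel)"
    using measurable_space[OF hist_measurable[OF t]] by (auto simp: space_pair_measure)
  have gV: "?g \<in> measurable ?V (hist_space t \<Otimes>\<^sub>M borel)" by (rule measurable_vimage_algebra1[OF gsp])
  have hV: "hist t \<in> measurable ?V (hist_space t)" and eV: "\<eta> t \<in> borel_measurable ?V"
    using measurable_compose[OF gV measurable_fst] measurable_compose[OF gV measurable_snd] by simp_all
  have pe: "(\<lambda>\<omega>. (p s \<omega>, \<eta> s \<omega>)) \<in> borel_measurable ?V" if s: "s \<in> {1..<t}" for s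
    using measurable_compose[OF measurable_compose[OF hV measurable_fst] measurable_component_singleton[OF s]] s
    by (simp add: hist_def)
  have ps: "p s \<in> borel_measurable ?V" "\<eta> s \<in> borel_measurable ?V" if s: "s \<in> {1..<t}" for s
    using measurable_compose[OF pe[OF s] borel_measurable_continuous_onI[OF continuous_on_fst[OF continuous_on_id]]]
      measurable_compose[OF pe[OF s] borel_measurable_continuous_onI[OF continuous_on_snd[OF continuous_on_id]]] by simp_all
  have es: "\<epsilon> s \<in> borel_measurable ?V" if s: "s \<in> {1..T}" for s
    using measurable_compose[OF measurable_compose[OF hV measurable_snd] measurable_component_singleton[OF s]] s
    by (simp add: hist_def)
  have "subalgebra ?V (price_info M p \<epsilon> \<eta> t)"
    unfolding subalgebra_def price_info_def
  proof (intro conjI sets_image_in_sets measurable_Pair measurable_restrict)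
    fix s assume s: "s \<in> {1..<t}"
    then show "(\<lambda>\<omega>. (p s \<omega>, \<epsilon> s \<omega>)) \<in> borel_measurable ?V" using ps es t by (intro borel_measurable_Pair) auto
  next
    fix s assume "s \<in> {1..t}"
    then show "\<eta> s \<in> borel_measurable ?V" using ps(2)[of s] eV by (cases "s = t") auto
  qed auto
  then have "p t \<in> borel_measurable ?V"
    using policy t measurable_from_subalg unfolding ts_policy_def Let_def by blast
  \<comment> \<open>The factorisation is stated for extended nonnegative reals; prices are
    nonnegative, so nothing is lost.\<close>
  then have "(\<lambda>\<omega>. ennreal (p t \<omega>)) \<in> borel_measurable ?V" by simp
  from factor_through_vimage_algebra[OF gsp this]
  obtain P where [measurable]: "P \<in> borel_measurable (hist_space t \<Otimes>\<^sub>M borel)"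
    and P: "\<And>\<omega>. \<omega> \<in> space M \<Longrightarrow> ennreal (p t \<omega>) = P (hist t \<omega>, \<eta> t \<omega>)" by blast
  let ?P = "\<lambda>y. max pmin (min pmax (enn2real (P y)))"
  have "p t \<omega> = ?P (hist t \<omega>, \<eta> t \<omega>)" if "\<omega> \<in> space M" for \<omega>
    using P[OF that] price_range[OF t that] prices by (simp flip: P[OF that])
  moreover have "?P \<in> borel_measurable (hist_space t \<Otimes>\<^sub>M borel)" by measurable
  moreover have "\<forall>y. ?P y \<in> {pmin..pmax}" using prices by auto
  ultimately show ?thesis by (intro bexI[of _ ?P]) auto
qed

end

section \<open>Regret\<close>

text \<open>Reduces optimality over an interval of prices to countably many conditions, which keeps
  it a measurable event.\<close>

lemma le_of_rational_le:
  fixes f :: "real \<Rightarrow> real"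
  assumes "continuous_on UNIV f" "\<And>r::rat. f (of_rat r) \<le> c"
  shows "f y \<le> c"
proof -
  have "\<And>z. z \<in> \<rat> \<Longrightarrow> f z \<le> c" using assms(2) by (auto elim!: Rats_cases)
  then show ?thesis
    using continuous_le_on_closure[of \<rat> f y c] assms(1) by (simp add: Rats_closure_real)
qed

context thompson_sampling
begin

definition played_width :: "nat \<Rightarrow> 'w \<Rightarrow> real" where
  "played_width t \<omega> = width x (\<lambda>s. p s \<omega>) t (p t \<omega>)"

definition gap :: "nat \<Rightarrow> 'w \<Rightarrow> real" where
  "gap t \<omega> = best_revenue t - true_revenue t (p t \<omega>)"

lemma played_width_measurable: "t \<in> {1..T} \<Longrightarrow> played_width t \<in> borel_measurable M"
  unfolding played_width_def[abs_def] width_def regressor_eq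
  by (intro measurable_compose[OF _ borel_measurable_sqrt] borel_measurable_inner borel_measurable_design_inv
      borel_measurable_add borel_measurable_scaleR borel_measurable_const price_measurable) auto

lemma played_width_bounds: "t \<in> {1..T} \<Longrightarrow> \<omega> \<in> space M \<Longrightarrow> 0 \<le> played_width t \<omega> \<and> played_width t \<omega> \<le> 1"
  unfolding played_width_def using width_nonneg width_le covariate_bounds[OF covariates price_range] order_trans by blast

lemma gap_bounds: "t \<in> {1..T} \<Longrightarrow> \<omega> \<in> space M \<Longrightarrow> 0 \<le> gap t \<omega> \<and> gap t \<omega> \<le> Dmax * pmax"
  unfolding gap_def using revenue_le_opt[OF price_range, of t \<omega>] best_revenue_le[of t]
    true_revenue_bounds(1)[OF _ price_range, of t t \<omega>] by auto

lemma borel_measurable_g [measurable]: "g \<in> borel_measurable borel"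
  using isCont_g by (intro borel_measurable_continuous_onI continuous_at_imp_continuous_on) auto

lemma gap_measurable: "t \<in> {1..T} \<Longrightarrow> gap t \<in> borel_measurable M"
  unfolding gap_def[abs_def] revenue_def using price_measurable[of t, measurable] by measurable

lemma gap_integrable: "t \<in> {1..T} \<Longrightarrow> integrable M (gap t)"
  using gap_bounds gap_measurable by (intro integrable_const_bound[of _ "Dmax * pmax"] AE_I2) auto

lemma played_width_integrable: "t \<in> {1..T} \<Longrightarrow> integrable M (played_width t)"
  using played_width_bounds played_width_measurable by (intro integrable_const_bound[of _ 1] AE_I2) auto

lemma eta_tail:
  assumes t: "t \<in> {1..T}"
  shows "(\<integral>\<^sup>+\<omega>. indicator {e. \<kappa> < norm e} (\<eta> t \<omega>) \<partial>M) \<le> ennreal (1 / (real T)\<^sup>2)"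
proof -
  have T: "0 < (real T)\<^sup>2" using horizon by simp
  have "(\<integral>\<^sup>+\<omega>. indicator {e. \<kappa> < norm e} (\<eta> t \<omega>) \<partial>M) = (\<integral>\<^sup>+e. indicator {e. \<kappa> < norm e} e \<partial>gauss2)"
    by (rule nn_integral_eta[OF t]) measurable
  also have "\<dots> = emeasure gauss2 {e. \<kappa> < norm e}" by (rule nn_integral_indicator) measurable
  also have "\<dots> \<le> ennreal (2 * exp (- \<kappa>\<^sup>2 / 4))" by (rule gauss2_tail[OF \<kappa>_nonneg])
  also have "- \<kappa>\<^sup>2 / 4 = - ln (4 * (real T)\<^sup>2)"
    using ln_T by (simp add: \<kappa>_def power_mult_distrib)
  also have "2 * exp (- ln (4 * (real T)\<^sup>2)) = 1 / (2 * (real T)\<^sup>2)"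
    using T by (simp add: exp_minus field_simps)
  also have "ennreal (1 / (2 * (real T)\<^sup>2)) \<le> ennreal (1 / (real T)\<^sup>2)"
    using T by (intro ennreal_leI divide_left_mono) auto
  finally show ?thesis .
qed

lemma confident_hist:
  assumes t: "t \<in> {1..T}" and \<omega>: "\<omega> \<in> space M"
    and Q: "noise_dual (t - 1) \<omega> \<bullet> noise (t - 1) \<omega> \<le> \<sigma>\<^sup>2 * \<rho>"
  shows "confident (hist_price t (hist t \<omega>)) (hist_demand t (hist t \<omega>)) (t - 1)"
proof (rule confident_if_noise_small)
  let ?q = "hist_price t (hist t \<omega>)" and ?D = "hist_demand t (hist t \<omega>)"
  have z: "regressor (x s) (?q s) = played \<omega> s" if "s \<in> {1..t - 1}" for s
    using hist_price_eq[OF t \<omega> that] by (simp add: played_def)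
  have dop: "design_op (\<lambda>s. regressor (x s) (?q s)) (t - 1) v = design_op (played \<omega>) (t - 1) v" for v
    unfolding design_op_def by (rule arg_cong, rule sum.cong[OF refl]) (simp only: z)
  have S: "(\<Sum>s=1..t - 1. (?D s - g (regressor (x s) (?q s) \<bullet> stack \<alpha> \<beta>)) *\<^sub>R regressor (x s) (?q s)) = noise (t - 1) \<omega>"
    unfolding noise_def
  proof (rule sum.cong[OF refl])
    fix s assume s: "s \<in> {1..t - 1}"
    show "(?D s - g (regressor (x s) (?q s) \<bullet> stack \<alpha> \<beta>)) *\<^sub>R regressor (x s) (?q s) = \<epsilon> s \<omega> *\<^sub>R played \<omega> s"
      unfolding z[OF s] hist_demand_eq[OF t \<omega> s] by (simp add: demand_def played_def regressor_inner)
  qed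
  show "t - 1 \<le> T" using t by auto
  show "?q s \<in> {pmin..pmax}" for s by (rule hist_price_range)
  show "design_op (\<lambda>s. regressor (x s) (?q s)) (t - 1) (noise_dual (t - 1) \<omega>)
      = (\<Sum>s=1..t - 1. (?D s - g (regressor (x s) (?q s) \<bullet> stack \<alpha> \<beta>)) *\<^sub>R regressor (x s) (?q s))"
    unfolding S dop by (rule design_noise_dual)
  show "noise_dual (t - 1) \<omega> \<bullet> design_op (\<lambda>s. regressor (x s) (?q s)) (t - 1) (noise_dual (t - 1) \<omega>) \<le> \<sigma>\<^sup>2 * \<rho>"
    unfolding dop design_noise_dual by (rule Q)
qed

text \<open>The constants are those of \<open>optimism_step\<close>: \<open>C1\<close> multiplies
  the width at the price played, \<open>C2\<close> the width at the price of the independent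
  copy.\<close>

lemma expected_gap_le:
  assumes t: "t \<in> {1..T}"
  defines "C1 \<equiv> pmax * gmax * \<gamma> * (\<kappa> + 1/2)" and "C2 \<equiv> pmax * gmax * \<gamma> * (\<kappa> + 5/2)"
  shows "(\<integral>\<omega>. gap t \<omega> \<partial>M) \<le> Dmax * pmax * (1 / T + 1 / (real T)\<^sup>2) + (C1 + 20 * C2) * (\<integral>\<omega>. played_width t \<omega> \<partial>M)"
proof -
  let ?N = "hist_space t \<Otimes>\<^sub>M (borel :: (real^2) measure)"
  obtain P where P [measurable]: "P \<in> borel_measurable ?N" and Pr: "\<And>y. P y \<in> {pmin..pmax}"
    and pP: "\<And>\<omega>. \<omega> \<in> space M \<Longrightarrow> p t \<omega> = P (hist t \<omega>, \<eta> t \<omega>)"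
    using price_factor[OF t] by blast
  note hist_measurable[OF t, measurable] eta_measurable[OF t, measurable] gap_measurable[OF t, measurable] played_width_measurable[OF t, measurable]
  define ab where "ab = (\<lambda>h. ts_sample g gmin \<theta>max \<sigma> 1 T x (hist_price t h) (hist_demand t h) t)"
  define rev where "rev = (\<lambda>h e. revenue g (ab h e $ 1) (ab h e $ 2))"
  define W where "W = (\<lambda>h. width x (hist_price t h) t)"
  define cl where "cl = (\<lambda>r::real. max pmin (min pmax r))"
  have cl: "cl r \<in> {pmin..pmax}" "r \<in> {pmin..pmax} \<Longrightarrow> cl r = r" for r using prices by (auto simp: cl_def)
  have tT: "t - 1 \<le> T" using t by auto
  have nonneg: "0 \<le> pmax * gmax * \<gamma>" using prices gmax_nonneg \<gamma>_pos by simp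
  have C: "0 \<le> C1" "0 \<le> C2" using nonneg \<kappa>_nonneg by (simp_all add: C1_def C2_def)
  have hp_fst: "(\<lambda>y. hist_price t (fst y) s) \<in> borel_measurable ?N" for s
    by (rule measurable_compose[OF measurable_fst hist_price_measurable])
  have hd_fst: "(\<lambda>y. hist_demand t (fst y) s) \<in> borel_measurable ?N" for s
    by (rule measurable_compose[OF measurable_fst hist_demand_measurable[OF t]])
  have [measurable]: "(\<lambda>y. qmle g gmin \<theta>max 1 x (hist_price t (fst y)) (hist_demand t (fst y)) (t - 1)) \<in> borel_measurable ?N"
    by (rule borel_measurable_qmle[OF tT hist_price_range hp_fst hd_fst])
  have [measurable]: "(\<lambda>y. (psd_sqrt (sampling_cov x (hist_price t (fst y)) t) *v v) \<bullet> snd y) \<in> borel_measurable ?N" for v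
    by (rule borel_measurable_sampling_sqrt[OF hp_fst measurable_snd])
  have price_vec: "price_vec r = (1 - r) *\<^sub>R price_vec 0 + r *\<^sub>R price_vec 1" for r
    by (simp add: price_vec_def vec_eq_iff forall_2)
  have rev_eq: "rev h e r = r * g (regressor (x t) r \<bullet> qmle g gmin \<theta>max 1 x (hist_price t h) (hist_demand t h) (t - 1)
      + \<gamma> * ((1 - r) * ((psd_sqrt (sampling_cov x (hist_price t h) t) *v price_vec 0) \<bullet> e)
        + r * ((psd_sqrt (sampling_cov x (hist_price t h) t) *v price_vec 1) \<bullet> e)))" for h e r
    unfolding rev_def revenue_def ab_def ts_sample_price
    by (subst price_vec[of r]) (simp add: matrix_vector_right_distrib matrix_vector_mult_scaleR inner_add_left)
  have rev_m: "(\<lambda>y. rev (fst y) (snd y) (f y)) \<in> borel_measurable ?N" if [measurable]: "f \<in> borel_measurable ?N" for f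
    unfolding rev_eq regressor_eq by measurable
  have W_m [measurable]: "(\<lambda>y. W (fst y) (P y)) \<in> borel_measurable ?N"
    unfolding W_def width_def regressor_eq
    by (intro measurable_compose[OF _ borel_measurable_sqrt] borel_measurable_inner borel_measurable_design_inv
        borel_measurable_add borel_measurable_scaleR borel_measurable_const P hp_fst)
  \<comment> \<open>Optimality against rational prices, clamped to the interval: a countable
    conjunction.\<close>
  define K where "K = (\<lambda>y. \<forall>r::rat. rev (fst y) (snd y) (cl (of_rat r)) \<le> rev (fst y) (snd y) (P y))"
  have K_m: "Measurable.pred ?N K"
  proof -
    have [measurable]: "(\<lambda>y. rev (fst y) (snd y) (cl (of_rat r))) \<in> borel_measurable ?N"
      "(\<lambda>y. rev (fst y) (snd y) (P y)) \<in> borel_measurable ?N" for r :: rat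
      by (rule rev_m[OF borel_measurable_const], rule rev_m[OF P])
    show ?thesis unfolding K_def by measurable
  qed
  have K_real: "rev h e r \<le> rev h e (P (h, e))" if "K (h, e)" "r \<in> {pmin..pmax}" for h e r
  proof -
    have "continuous_on UNIV (\<lambda>r. rev h e (cl r))"
    proof -
      have "continuous_on UNIV g" using isCont_g by (intro continuous_at_imp_continuous_on) auto
      then show ?thesis
        unfolding rev_def revenue_def cl_def
        by (intro continuous_intros continuous_on_compose2[OF \<open>continuous_on UNIV g\<close>]) auto
    qed
    from le_of_rational_le[OF this, of "rev h e (P (h, e))" r] show ?thesis using that cl(2)[OF that(2)] by (simp add: K_def)
  qed
  have K_all: "K (hist t \<omega>, \<eta> t \<omega>)" if \<omega>: "\<omega> \<in> space M" for \<omega>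
  proof -
    have "ab (hist t \<omega>) (\<eta> t \<omega>) = ts_sample g gmin \<theta>max \<sigma> 1 T x (\<lambda>s. p s \<omega>) (\<lambda>s. demand g \<alpha> \<beta> x p \<epsilon> s \<omega>) t (\<eta> t \<omega>)"
      unfolding ab_def by (rule ts_sample_cong) (erule hist_price_eq[OF t \<omega>] hist_demand_eq[OF t \<omega>])+
    then have "is_arg_max (rev (hist t \<omega>) (\<eta> t \<omega>)) (\<lambda>q. q \<in> {pmin..pmax}) (p t \<omega>)"
      using policy t \<omega> unfolding ts_policy_def Let_def rev_def by auto
    then show ?thesis unfolding K_def is_arg_max_linorder pP[OF \<omega>] using cl(1) by simp
  qed
  have played_width_W: "played_width t \<omega> = W (hist t \<omega>) (P (hist t \<omega>, \<eta> t \<omega>))" if \<omega>: "\<omega> \<in> space M" for \<omega>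
    unfolding played_width_def W_def pP[OF \<omega>] by (rule width_cong[symmetric]) (erule hist_price_eq[OF t \<omega>])
  obtain pst where pst: "pst \<in> {pmin..pmax}" "best_revenue t = true_revenue t pst"
    using opt_revenue_attained by blast
  define good where "good = (\<lambda>y. confident (hist_price t (fst y)) (hist_demand t (fst y)) (t - 1) \<and> norm (snd y :: real^2) \<le> \<kappa>)"
  have good_m [measurable]: "Measurable.pred ?N good"
  proof -
    have [measurable]: "Measurable.pred ?N (\<lambda>y. confident (hist_price t (fst y)) (hist_demand t (fst y)) (t - 1))"
      by (rule borel_measurable_confident[OF hist_price_range tT hp_fst hd_fst])
    show ?thesis unfolding good_def by measurable
  qed
  \<comment> \<open>As \<open>ennreal\<close> sends negative reals to 0, this is the positive part,
    on the good event, of the loss beyond \<open>C1\<close> times the width.\<close>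
  define F where "F = (\<lambda>y. (if good y then ennreal (best_revenue t - true_revenue t (P y) - C1 * W (fst y) (P y)) else 0))"
  have F_m [measurable]: "F \<in> borel_measurable ?N"
    unfolding F_def revenue_def by measurable
  define G where "G = (\<lambda>y. ennreal (W (fst y) (P y)))"
  have G_m [measurable]: "G \<in> borel_measurable ?N" unfolding G_def by measurable
  have AEK0: "AE \<omega> in M. AE \<omega>' in M. K (hist t \<omega>, \<eta> t \<omega>')"
    by (rule AE_indep_pair[OF hist_indep[OF t] K_m K_all])
  have AE_F: "AE \<omega> in M. AE \<omega>' in M. F (hist t \<omega>, \<eta> t \<omega>') \<le> ennreal (20 * C2) * (\<integral>\<^sup>+\<omega>''. G (hist t \<omega>, \<eta> t \<omega>'') \<partial>M)"
  proof (rule AE_mp[OF AEK0], rule AE_I2, rule impI)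
    fix \<omega> assume \<omega>: "\<omega> \<in> space M" and AEK: "AE \<omega>' in M. K (hist t \<omega>, \<eta> t \<omega>')"
    define h where "h = hist t \<omega>"
    have hsp: "h \<in> space (hist_space t)" using measurable_space[OF hist_measurable[OF t] \<omega>] by (simp add: h_def)
    let ?u = "psd_sqrt (sampling_cov x (hist_price t h) t) *v price_vec pst"
    let ?B = "{e. norm e \<le> 5/2 \<and> norm ?u / 2 \<le> ?u \<bullet> e}"
    have B [measurable]: "?B \<in> sets borel" by measurable
    show "AE \<omega>' in M. F (hist t \<omega>, \<eta> t \<omega>') \<le> ennreal (20 * C2) * (\<integral>\<^sup>+\<omega>''. G (hist t \<omega>, \<eta> t \<omega>'') \<partial>M)"
      using AEK
    proof eventually_elim
      case (elim \<omega>')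
      define e1 where "e1 = \<eta> t \<omega>'"
      have K1: "K (h, e1)" using elim by (simp add: h_def e1_def)
      show ?case
      proof (cases "good (h, e1)")
        case False
        then show ?thesis by (simp add: F_def h_def e1_def)
      next
        case True
        define Y where "Y = best_revenue t - true_revenue t (P (h, e1)) - C1 * W h (P (h, e1))"
        \<comment> \<open>The actual draw is fixed and a further sample point supplies the copy; off
          the optimistic set the left side is 0.\<close>
        have pt: "AE \<omega>'' in M. ennreal Y * indicator ?B (\<eta> t \<omega>'') \<le> ennreal C2 * G (h, \<eta> t \<omega>'')"
          using AEK
        proof eventually_elim
          case (elim \<omega>'')
          define e2 where "e2 = \<eta> t \<omega>''"
          have K2: "K (h, e2)" using elim by (simp add: h_def e2_def)
          show ?case
          proof (cases "e2 \<in> ?B")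
            case in_B: True
            have "best_revenue t - true_revenue t (P (h, e1))
                \<le> pmax * gmax * \<gamma> * ((\<kappa> + 1/2) * width x (hist_price t h) t (P (h, e1)) + (\<kappa> + 5/2) * width x (hist_price t h) t (P (h, e2)))"
            proof (rule optimism_step[OF t hist_price_range _ Pr Pr pst _ _ _
                  K_real[OF K1 Pr[of "(h, e2)"], unfolded rev_def ab_def] K_real[OF K2 pst(1), unfolded rev_def ab_def]])
              show "confident (hist_price t h) (hist_demand t h) (t - 1)" "norm e1 \<le> \<kappa>" using True by (auto simp: good_def)
              show "norm e2 \<le> 5/2" "norm ?u / 2 \<le> ?u \<bullet> e2" using in_B by auto
            qed
            then have "Y \<le> C2 * W h (P (h, e2))"
              by (simp add: Y_def C1_def C2_def W_def algebra_simps)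
            then have "ennreal Y \<le> ennreal C2 * ennreal (W h (P (h, e2)))"
              unfolding ennreal_mult'[OF C(2), symmetric] by (rule ennreal_leI)
            then show ?thesis using in_B by (simp add: e2_def G_def)
          qed (simp add: e2_def)
        qed
        have eB: "ennreal (1/20) \<le> (\<integral>\<^sup>+\<omega>''. indicator ?B (\<eta> t \<omega>'') \<partial>M)"
        proof -
          have "ennreal (1/20) \<le> emeasure gauss2 ?B" by (rule gauss2_halfplane_ge)
          also have "\<dots> = (\<integral>\<^sup>+e. indicator ?B e \<partial>gauss2)" by (rule nn_integral_indicator[symmetric]) simp
          also have "\<dots> = (\<integral>\<^sup>+\<omega>''. indicator ?B (\<eta> t \<omega>'') \<partial>M)"
            by (rule nn_integral_eta[OF t, symmetric]) simp
          finally show ?thesis .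
        qed
        have Gh: "(\<lambda>\<omega>''. G (h, \<eta> t \<omega>'')) \<in> borel_measurable M"
          using hsp by measurable
        \<comment> \<open>Integration over the copy: \<open>ennreal Y\<close> is constant, and the
          optimistic set has probability at least 1/20.\<close>
        have "ennreal Y * ennreal (1/20) \<le> ennreal Y * (\<integral>\<^sup>+\<omega>''. indicator ?B (\<eta> t \<omega>'') \<partial>M)"
          by (intro mult_left_mono eB) simp
        also have "\<dots> = (\<integral>\<^sup>+\<omega>''. ennreal Y * indicator ?B (\<eta> t \<omega>'') \<partial>M)"
          by (rule nn_integral_cmult[symmetric]) measurable
        also have "\<dots> \<le> (\<integral>\<^sup>+\<omega>''. ennreal C2 * G (h, \<eta> t \<omega>'') \<partial>M)" by (rule nn_integral_mono_AE[OF pt])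
        also have "\<dots> = ennreal C2 * (\<integral>\<^sup>+\<omega>''. G (h, \<eta> t \<omega>'') \<partial>M)" by (rule nn_integral_cmult[OF Gh])
        finally have "ennreal 20 * (ennreal Y * ennreal (1/20)) \<le> ennreal 20 * (ennreal C2 * (\<integral>\<^sup>+\<omega>''. G (h, \<eta> t \<omega>'') \<partial>M))"
          by (rule mult_left_mono) simp
        also have "ennreal 20 * (ennreal Y * ennreal (1/20)) = ennreal Y"
        proof -
          have "ennreal 20 * ennreal (1/20) = ennreal (20 * (1/20))" by (rule ennreal_mult'[symmetric]) simp
          then have "ennreal 20 * ennreal (1/20) = 1" by simp
          moreover have "ennreal 20 * (ennreal Y * ennreal (1/20)) = ennreal Y * (ennreal 20 * ennreal (1/20))"
            by (simp only: mult_ac)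
          ultimately show ?thesis by simp
        qed
        also have "ennreal 20 * (ennreal C2 * (\<integral>\<^sup>+\<omega>''. G (h, \<eta> t \<omega>'') \<partial>M)) = ennreal (20 * C2) * (\<integral>\<^sup>+\<omega>''. G (h, \<eta> t \<omega>'') \<partial>M)"
          using ennreal_mult'[of 20 C2] by (simp only: mult.assoc)
        finally show ?thesis using True by (simp add: F_def Y_def h_def e1_def)
      qed
    qed
  qed
  \<comment> \<open>The copied draw has, jointly with the history, the law of the actual one, so the
    mean width is that of the price played.\<close>
  have gG: "(\<integral>\<^sup>+\<omega>. (\<integral>\<^sup>+\<omega>'. G (hist t \<omega>, \<eta> t \<omega>') \<partial>M) \<partial>M) = (\<integral>\<^sup>+\<omega>. ennreal (played_width t \<omega>) \<partial>M)"
    unfolding nn_integral_indep_pair_fst[OF hist_indep[OF t] G_m, symmetric]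
    by (intro nn_integral_cong) (simp add: G_def played_width_W)
  have IF: "(\<integral>\<^sup>+\<omega>. F (hist t \<omega>, \<eta> t \<omega>) \<partial>M) \<le> ennreal (20 * C2) * (\<integral>\<^sup>+\<omega>. ennreal (played_width t \<omega>) \<partial>M)"
  proof -
    have Gm: "(\<lambda>\<omega>. \<integral>\<^sup>+\<omega>'. G (hist t \<omega>, \<eta> t \<omega>') \<partial>M) \<in> borel_measurable M" by measurable
    have "(\<integral>\<^sup>+\<omega>. F (hist t \<omega>, \<eta> t \<omega>) \<partial>M) = (\<integral>\<^sup>+\<omega>. (\<integral>\<^sup>+\<omega>'. F (hist t \<omega>, \<eta> t \<omega>') \<partial>M) \<partial>M)"
      by (rule nn_integral_indep_pair_fst[OF hist_indep[OF t] F_m])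
    also have "\<dots> \<le> (\<integral>\<^sup>+\<omega>. ennreal (20 * C2) * (\<integral>\<^sup>+\<omega>''. G (hist t \<omega>, \<eta> t \<omega>'') \<partial>M) \<partial>M)"
    proof (rule nn_integral_mono_AE, use AE_F in eventually_elim)
      case (elim \<omega>)
      then have "(\<integral>\<^sup>+\<omega>'. F (hist t \<omega>, \<eta> t \<omega>') \<partial>M)
          \<le> (\<integral>\<^sup>+\<omega>'. ennreal (20 * C2) * (\<integral>\<^sup>+\<omega>''. G (hist t \<omega>, \<eta> t \<omega>'') \<partial>M) \<partial>M)"
        by (rule nn_integral_mono_AE)
      then show ?case by (simp add: emeasure_space_1)
    qed
    also have "\<dots> = ennreal (20 * C2) * (\<integral>\<^sup>+\<omega>. (\<integral>\<^sup>+\<omega>''. G (hist t \<omega>, \<eta> t \<omega>'') \<partial>M) \<partial>M)"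
      by (rule nn_integral_cmult[OF Gm])
    finally show ?thesis unfolding gG .
  qed
  let ?Dp = "Dmax * pmax"
  have Dp: "0 \<le> ?Dp" using true_revenue_bounds[OF t, of pmin] prices by auto
  let ?B1 = "{\<omega>\<in>space M. \<sigma>\<^sup>2 * \<rho> < noise_dual (t - 1) \<omega> \<bullet> noise (t - 1) \<omega>}"
  let ?B2 = "{e :: real^2. \<kappa> < norm e}"
  note noise_measurable[OF tT, measurable] noise_dual_measurable[OF tT, measurable]
  have B1: "?B1 \<in> sets M" by measurable
  \<comment> \<open>When \<open>good\<close> holds, the loss splits into \<open>F\<close> and the
    term with \<open>C1\<close>; otherwise one of the two exceptional events occurs and the trivial
    bound on the loss is used.\<close>
  have pt: "ennreal (gap t \<omega>) \<le> ennreal ?Dp * (indicator ?B1 \<omega> + indicator ?B2 (\<eta> t \<omega>))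
      + (ennreal C1 * ennreal (played_width t \<omega>) + F (hist t \<omega>, \<eta> t \<omega>))" if \<omega>: "\<omega> \<in> space M" for \<omega>
  proof (cases "good (hist t \<omega>, \<eta> t \<omega>)")
    case True
    have "gap t \<omega> = C1 * played_width t \<omega> + (best_revenue t - true_revenue t (P (hist t \<omega>, \<eta> t \<omega>)) - C1 * W (hist t \<omega>) (P (hist t \<omega>, \<eta> t \<omega>)))"
      by (simp add: gap_def played_width_W[OF \<omega>] pP[OF \<omega>])
    also have "ennreal \<dots> \<le> ennreal (C1 * played_width t \<omega>) + F (hist t \<omega>, \<eta> t \<omega>)"
      unfolding F_def using True C played_width_bounds[OF t \<omega>] by (simp add: ennreal_plus_if)
    finally have "ennreal (gap t \<omega>) \<le> ennreal C1 * ennreal (played_width t \<omega>) + F (hist t \<omega>, \<eta> t \<omega>)"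
      using C by (simp add: ennreal_mult')
    also have "\<dots> \<le> ennreal ?Dp * (indicator ?B1 \<omega> + indicator ?B2 (\<eta> t \<omega>)) + \<dots>"
      by (intro add_increasing order_refl zero_le)
    finally show ?thesis .
  next
    case False
    have "(1::ennreal) \<le> indicator ?B1 \<omega> + indicator ?B2 (\<eta> t \<omega>)"
    proof (cases "\<omega> \<in> ?B1")
      case not_B1: False
      then have "confident (hist_price t (hist t \<omega>)) (hist_demand t (hist t \<omega>)) (t - 1)"
        using \<omega> by (intro confident_hist[OF t \<omega>]) auto
      then have "\<eta> t \<omega> \<in> ?B2" using False by (auto simp: good_def)
      then show ?thesis by (simp add: indicator_def)
    qed (simp add: indicator_def)
    then have Dp1: "ennreal ?Dp * 1 \<le> ennreal ?Dp * (indicator ?B1 \<omega> + indicator ?B2 (\<eta> t \<omega>))"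
      by (rule mult_left_mono) simp
    have "ennreal (gap t \<omega>) \<le> ennreal ?Dp * 1"
      using gap_bounds[OF t \<omega>] ennreal_leI[of "gap t \<omega>" ?Dp] by simp
    also have "\<dots> \<le> ennreal ?Dp * (indicator ?B1 \<omega> + indicator ?B2 (\<eta> t \<omega>))" by (rule Dp1)
    also have "\<dots> \<le> \<dots> + (ennreal C1 * ennreal (played_width t \<omega>) + F (hist t \<omega>, \<eta> t \<omega>))"
      by (intro add_increasing2 order_refl zero_le)
    finally show ?thesis .
  qed
  note int = gap_integrable[OF t] played_width_integrable[OF t]
  have Ig: "(\<integral>\<^sup>+\<omega>. ennreal (gap t \<omega>) \<partial>M) = ennreal (\<integral>\<omega>. gap t \<omega> \<partial>M)"
    using gap_bounds[OF t] by (intro nn_integral_eq_integral int AE_I2) auto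
  have Ip: "(\<integral>\<^sup>+\<omega>. ennreal (played_width t \<omega>) \<partial>M) = ennreal (\<integral>\<omega>. played_width t \<omega> \<partial>M)"
    using played_width_bounds[OF t] by (intro nn_integral_eq_integral int AE_I2) auto
  have p0: "0 \<le> (\<integral>\<omega>. played_width t \<omega> \<partial>M)"
    using played_width_bounds[OF t] by (intro integral_nonneg_AE AE_I2) auto
  have I1: "(\<integral>\<^sup>+\<omega>. indicator ?B1 \<omega> \<partial>M) \<le> ennreal (1 / T)"
    using confidence[OF tT] B1 by (simp add: emeasure_eq_measure ennreal_leI)
  have F_hist: "(\<lambda>\<omega>. F (hist t \<omega>, \<eta> t \<omega>)) \<in> borel_measurable M" by measurable
  have ind2 [measurable]: "(\<lambda>\<omega>. indicator ?B2 (\<eta> t \<omega>) :: ennreal) \<in> borel_measurable M" by measurable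
  have "ennreal (\<integral>\<omega>. gap t \<omega> \<partial>M) \<le> (\<integral>\<^sup>+\<omega>. ennreal ?Dp * (indicator ?B1 \<omega> + indicator ?B2 (\<eta> t \<omega>))
      + (ennreal C1 * ennreal (played_width t \<omega>) + F (hist t \<omega>, \<eta> t \<omega>)) \<partial>M)"
    unfolding Ig[symmetric] by (intro nn_integral_mono pt)
  also have "\<dots> = ennreal ?Dp * ((\<integral>\<^sup>+\<omega>. indicator ?B1 \<omega> \<partial>M) + (\<integral>\<^sup>+\<omega>. indicator ?B2 (\<eta> t \<omega>) \<partial>M))
      + (ennreal C1 * (\<integral>\<^sup>+\<omega>. ennreal (played_width t \<omega>) \<partial>M) + (\<integral>\<^sup>+\<omega>. F (hist t \<omega>, \<eta> t \<omega>) \<partial>M))"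
  proof -
    have b1: "(\<lambda>\<omega>. indicator ?B1 \<omega> :: ennreal) \<in> borel_measurable M" using B1 by (rule borel_measurable_indicator)
    have pm: "(\<lambda>\<omega>. ennreal (played_width t \<omega>)) \<in> borel_measurable M" by measurable
    have "(\<integral>\<^sup>+\<omega>. indicator ?B1 \<omega> + indicator ?B2 (\<eta> t \<omega>) \<partial>M) = (\<integral>\<^sup>+\<omega>. indicator ?B1 \<omega> \<partial>M) + (\<integral>\<^sup>+\<omega>. indicator ?B2 (\<eta> t \<omega>) \<partial>M)"
      by (rule nn_integral_add[OF b1 ind2])
    moreover have "(\<integral>\<^sup>+\<omega>. ennreal C1 * ennreal (played_width t \<omega>) + F (hist t \<omega>, \<eta> t \<omega>) \<partial>M)
        = ennreal C1 * (\<integral>\<^sup>+\<omega>. ennreal (played_width t \<omega>) \<partial>M) + (\<integral>\<^sup>+\<omega>. F (hist t \<omega>, \<eta> t \<omega>) \<partial>M)"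
      by (subst nn_integral_add[OF borel_measurable_times_ennreal[OF borel_measurable_const pm] F_hist])
        (simp only: nn_integral_cmult[OF pm])
    moreover have "(\<integral>\<^sup>+\<omega>. ennreal ?Dp * (indicator ?B1 \<omega> + indicator ?B2 (\<eta> t \<omega>))
        + (ennreal C1 * ennreal (played_width t \<omega>) + F (hist t \<omega>, \<eta> t \<omega>)) \<partial>M)
      = ennreal ?Dp * (\<integral>\<^sup>+\<omega>. indicator ?B1 \<omega> + indicator ?B2 (\<eta> t \<omega>) \<partial>M)
        + (\<integral>\<^sup>+\<omega>. ennreal C1 * ennreal (played_width t \<omega>) + F (hist t \<omega>, \<eta> t \<omega>) \<partial>M)"
      by (subst nn_integral_add[OF borel_measurable_times_ennreal[OF borel_measurable_const borel_measurable_add[OF b1 ind2]]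
            borel_measurable_add[OF borel_measurable_times_ennreal[OF borel_measurable_const pm] F_hist]])
        (simp only: nn_integral_cmult[OF borel_measurable_add[OF b1 ind2]])
    ultimately show ?thesis by (simp only:)
  qed
  also have "\<dots> \<le> ennreal ?Dp * (ennreal (1 / T) + ennreal (1 / (real T)\<^sup>2))
      + (ennreal C1 * ennreal (\<integral>\<omega>. played_width t \<omega> \<partial>M) + ennreal (20 * C2) * ennreal (\<integral>\<omega>. played_width t \<omega> \<partial>M))"
    using IF unfolding Ip by (intro add_mono mult_left_mono I1 eta_tail[OF t]) auto
  also have "\<dots> = ennreal (?Dp * (1 / T + 1 / (real T)\<^sup>2) + (C1 + 20 * C2) * (\<integral>\<omega>. played_width t \<omega> \<partial>M))"
    using Dp C p0 by (simp add: ennreal_mult'[symmetric] ennreal_plus[symmetric] distrib_right del: ennreal_plus)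
  finally show ?thesis
    using Dp C p0 by (subst (asm) ennreal_le_iff) auto
qed

end

text \<open>Every logarithm is at most a multiple of \<open>ln T\<close>, uniformly in
  \<open>d\<close>. Up to constants, \<open>gamma_bar\<close> contributes
  \<open>sqrt d * ln T\<close> and the square root \<open>sqrt (d * T) * ln T\<close>, whence the
  exponent 2.\<close>

lemma soft_O_ts_bound:
  assumes nn: "0 \<le> gmax" "0 \<le> pmax" "0 < \<theta>max" "0 \<le> \<sigma>" "0 < gmin" "0 \<le> Dmax"
  shows "soft_O (ts_bound gmin gmax \<theta>max \<sigma> pmax Dmax) (\<lambda>d T'. real d * sqrt (real T'))"
  unfolding soft_O_def
proof (intro exI allI impI)
  fix d T :: nat assume d: "1 \<le> d" and T: "6 \<le> T"
  define G where "G = 2 * \<theta>max + 6 * \<sigma> / gmin"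
  \<comment> \<open>504 is 36 times 14, where 14 is the rounded root of 24 * 2 * 4. The 6 in
    \<open>G\<close> is twice the 3 that comes from \<open>2 + 4 \<le> 3 * 3\<close>.\<close>
  let ?l = "ln (real T)" and ?C = "504 * gmax * pmax * G + 2 * Dmax * pmax"
  define c where "c = ln ((2 * real d + real T) / (2 * real d))"
  define L where "L = ln (4 * (real T)\<^sup>2)"
  define B where "B = real d * sqrt (real T)"
  have l: "1 \<le> ?l" using exp_le T by (simp add: ln_ge_iff)
  have Tr: "6 \<le> real T" and dr: "1 \<le> real d" using T d by auto
  have G: "0 \<le> G" using nn by (simp add: G_def)
  have frac: "1 \<le> (2 * real d + real T) / (2 * real d)" "(2 * real d + real T) / (2 * real d) \<le> (real T)\<^sup>2"
  proof -
    show "1 \<le> (2 * real d + real T) / (2 * real d)" using dr by (simp add: field_simps)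
    have "(2 * real d + real T) / (2 * real d) = 1 + real T / (2 * real d)" using dr by (simp add: add_divide_distrib)
    also have "\<dots> \<le> 1 + real T / 1" using dr Tr by (intro add_left_mono divide_left_mono) auto
    also have "\<dots> \<le> 6 * real T" using Tr by simp
    also have "\<dots> \<le> (real T)\<^sup>2" unfolding power2_eq_square using Tr by (intro mult_right_mono) auto
    finally show "(2 * real d + real T) / (2 * real d) \<le> (real T)\<^sup>2" .
  qed
  have c: "0 \<le> c" "c \<le> 2 * ?l"
  proof -
    show "0 \<le> c" using frac(1) by (simp add: c_def)
    have "c \<le> ln ((real T)\<^sup>2)" unfolding c_def using frac Tr by (intro ln_mono) auto
    then show "c \<le> 2 * ?l" using Tr by (simp add: ln_realpow)
  qed
  have L: "0 \<le> L" "L \<le> 4 * ?l"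
  proof -
    have sq: "36 \<le> (real T)\<^sup>2" using power_mono[OF Tr, of 2] by simp
    then show "0 \<le> L" by (simp add: L_def)
    have "4 * (real T)\<^sup>2 \<le> (real T)\<^sup>2 * (real T)\<^sup>2" using sq by (intro mult_right_mono) auto
    also have "\<dots> = real T ^ 4" by (simp add: power_add[symmetric])
    finally have "L \<le> ln (real T ^ 4)" unfolding L_def using sq Tr by (intro ln_mono) auto
    then show "L \<le> 4 * ?l" using Tr by (simp add: ln_realpow)
  qed
  have gam: "0 \<le> gamma_bar gmin \<theta>max \<sigma> d T" "gamma_bar gmin \<theta>max \<sigma> d T \<le> G * (sqrt (real d) * ?l)"
  proof -
    have sl: "1 \<le> sqrt (real d) * ?l"
      using mult_mono[of 1 "sqrt (real d)" 1 ?l] l dr by simp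
    have "2 * ?l + 2 * real d * c \<le> 2 * real d * ?l + 2 * real d * (2 * ?l)"
      using c dr l by (intro add_mono mult_mono mult_left_mono) auto
    also have "\<dots> \<le> 9 * real d * (?l * ?l)"
      using dr l mult_mono[of 1 ?l ?l ?l] by (simp add: mult_left_mono)
    also have "\<dots> = (3 * (sqrt (real d) * ?l))\<^sup>2" by (simp add: power_mult_distrib power2_eq_square[of ?l])
    finally have "sqrt (2 * ?l + 2 * real d * c) \<le> 3 * (sqrt (real d) * ?l)"
      using l by (intro real_le_lsqrt) auto
    then have "2 * \<sigma> / gmin * sqrt (2 * ?l + 2 * real d * c) \<le> 2 * \<sigma> / gmin * (3 * (sqrt (real d) * ?l))"
      using nn by (intro mult_left_mono) auto
    moreover have "2 * \<theta>max * 1 \<le> 2 * \<theta>max * (sqrt (real d) * ?l)" using sl nn by (intro mult_left_mono) auto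
    moreover have "gamma_bar gmin \<theta>max \<sigma> d T = 2 * \<theta>max + 2 * \<sigma> / gmin * sqrt (2 * ?l + 2 * real d * c)"
      by (simp only: gamma_bar_def c_def)
    moreover have "G * (sqrt (real d) * ?l) = 2 * \<theta>max * (sqrt (real d) * ?l) + 2 * \<sigma> / gmin * (3 * (sqrt (real d) * ?l))"
      by (simp add: G_def algebra_simps)
    ultimately show "gamma_bar gmin \<theta>max \<sigma> d T \<le> G * (sqrt (real d) * ?l)" by linarith
    show "0 \<le> gamma_bar gmin \<theta>max \<sigma> d T"
      using nn c l dr by (simp add: gamma_bar_def c_def[symmetric])
  qed
  have root: "sqrt (2 * exp 1 * pi * real d * real T * c * L) \<le> 14 * (sqrt (real d) * sqrt (real T) * ?l)"
  proof (rule real_le_lsqrt)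
    show "0 \<le> 14 * (sqrt (real d) * sqrt (real T) * ?l)" using l by simp
    have ep: "2 * exp 1 * pi \<le> (24 :: real)"
      using mult_mono[OF exp_le less_imp_le[OF pi_less_4]] by (simp add: mult.commute)
    have "2 * exp 1 * pi * real d * real T * c * L \<le> 24 * real d * real T * (2 * ?l) * (4 * ?l)"
      using ep c L l by (intro mult_mono) auto
    also have "\<dots> \<le> 196 * (real d * real T * (?l * ?l))" using l by (simp add: mult_ac)
    also have "\<dots> = (14 * (sqrt (real d) * sqrt (real T) * ?l))\<^sup>2"
      by (simp add: power_mult_distrib power2_eq_square[of ?l])
    finally show "2 * exp 1 * pi * real d * real T * c * L \<le> (14 * (sqrt (real d) * sqrt (real T) * ?l))\<^sup>2" .
  qed
  have B: "1 \<le> B * ?l ^ 2"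
  proof -
    have "1 * 1 \<le> real d * sqrt (real T)" using dr Tr by (intro mult_mono) auto
    moreover have "1 \<le> ?l ^ 2" using l by simp
    ultimately show ?thesis using mult_mono[of 1 B 1 "?l ^ 2"] by (simp add: B_def)
  qed
  let ?S = "sqrt (2 * exp 1 * pi * real d * real T * c * L)"
  have "36 * gmax * pmax * gamma_bar gmin \<theta>max \<sigma> d T * ?S
      \<le> 36 * gmax * pmax * (G * (sqrt (real d) * ?l)) * (14 * (sqrt (real d) * sqrt (real T) * ?l))"
    using nn gam root c L l G by (intro mult_mono mult_left_mono) auto
  also have "\<dots> = 504 * gmax * pmax * G * ((sqrt (real d) * sqrt (real d)) * sqrt (real T) * (?l * ?l))"
    by (simp only: mult_ac)
  also have "\<dots> = 504 * gmax * pmax * G * (B * ?l ^ 2)"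
    by (simp add: B_def power2_eq_square)
  finally have "ts_bound gmin gmax \<theta>max \<sigma> pmax Dmax d T \<le> 504 * gmax * pmax * G * (B * ?l ^ 2) + 2 * Dmax * pmax"
    by (simp add: ts_bound_def c_def[symmetric] L_def[symmetric])
  also have "\<dots> \<le> 504 * gmax * pmax * G * (B * ?l ^ 2) + 2 * Dmax * pmax * (B * ?l ^ 2)"
    using B nn mult_left_mono[OF B, of "2 * Dmax * pmax"] by simp
  also have "\<dots> = ?C * B * ?l ^ 2" by (simp add: algebra_simps)
  finally have "ts_bound gmin gmax \<theta>max \<sigma> pmax Dmax d T \<le> ?C * B * ?l ^ 2" .
  moreover have "0 \<le> ts_bound gmin gmax \<theta>max \<sigma> pmax Dmax d T"
    using nn gam c L by (simp add: ts_bound_def c_def[symmetric] L_def[symmetric])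
  moreover have "\<bar>real d * sqrt (real T)\<bar> = B" unfolding B_def by (intro abs_of_nonneg) simp
  ultimately show "\<bar>ts_bound gmin gmax \<theta>max \<sigma> pmax Dmax d T\<bar>
      \<le> (504 * gmax * pmax * (2 * \<theta>max + 6 * \<sigma> / gmin) + 2 * Dmax * pmax) * \<bar>real d * sqrt (real T)\<bar> * ln (real T) ^ 2"
    unfolding G_def by (simp only: abs_of_nonneg)
qed

section \<open>Summation over the horizon\<close>

context thompson_sampling
begin

text \<open>Cauchy-Schwarz over the periods converts the bound on squared widths, valid on every
  path, into one on their sum.\<close>

lemma sum_played_width_le:
  assumes \<omega>: "\<omega> \<in> space M"
  shows "(\<Sum>t=1..T. played_width t \<omega>) \<le> 2 * sqrt (real ncov * real T * ln ((2 * real ncov + real T) / (2 * real ncov)))"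
proof -
  let ?u = "\<lambda>t. matrix_inv (design_matrix 1 x (\<lambda>s. p s \<omega>) (t - 1)) *v played \<omega> t"
  have "(\<Sum>t=1..T. played \<omega> t \<bullet> ?u t) \<le> 2 * DIM(real^('n + 'n)) * ln (1 + T / DIM(real^('n + 'n)))"
  proof (rule elliptical_potential)
    show "design_op (played \<omega>) (s - 1) (?u s) = played \<omega> s" for s
      unfolding played_def[abs_def] by (rule design_matrix_inv)
  qed (rule played_norm[OF _ \<omega>])
  also have "\<dots> = 4 * real ncov * ln ((2 * real ncov + real T) / (2 * real ncov))"
    unfolding DIM_params using ncov_pos by (simp add: add_divide_distrib)
  finally have E: "(\<Sum>t=1..T. (played_width t \<omega>)\<^sup>2) \<le> 4 * real ncov * ln ((2 * real ncov + real T) / (2 * real ncov))"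
    by (simp add: played_width_def width_def played_def matrix_inv_design_quad(1))
  have "(\<Sum>t=1..T. played_width t \<omega>)\<^sup>2 \<le> (\<Sum>t=1..T. 1\<^sup>2) * (\<Sum>t=1..T. (played_width t \<omega>)\<^sup>2)"
    using Cauchy_Schwarz_ineq_sum[of "\<lambda>_. 1" "\<lambda>t. played_width t \<omega>" "{1..T}"] by simp
  also have "\<dots> \<le> real T * (4 * real ncov * ln ((2 * real ncov + real T) / (2 * real ncov)))"
    using E by (simp add: mult_left_mono)
  finally have "(\<Sum>t=1..T. played_width t \<omega>) \<le> sqrt (4 * (real ncov * real T * ln ((2 * real ncov + real T) / (2 * real ncov))))"
    by (intro real_le_rsqrt) (simp add: mult_ac)
  then show ?thesis by (simp add: real_sqrt_mult)
qed

text \<open>An inequality rather than an identity, because the expected product of price and shock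
  has only been shown to be nonnegative.\<close>

lemma regret_le_sum_gap: "regret M g pmin pmax \<alpha> \<beta> x p \<epsilon> T \<le> (\<Sum>t=1..T. (\<integral>\<omega>. gap t \<omega> \<partial>M))"
proof -
  note gi = gap_integrable
  note pe = expected_price_noise_nonneg
  have eq: "p t \<omega> * demand g \<alpha> \<beta> x p \<epsilon> t \<omega> = best_revenue t - gap t \<omega> + p t \<omega> * \<epsilon> t \<omega>" for t \<omega>
    by (simp add: demand_def gap_def revenue_def algebra_simps)
  have "(\<integral>\<omega>. (\<Sum>t=1..T. p t \<omega> * demand g \<alpha> \<beta> x p \<epsilon> t \<omega>) \<partial>M)
      = (\<Sum>t=1..T. (\<integral>\<omega>. best_revenue t - gap t \<omega> + p t \<omega> * \<epsilon> t \<omega> \<partial>M))"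
    unfolding eq by (rule Bochner_Integration.integral_sum)
      (intro Bochner_Integration.integrable_add Bochner_Integration.integrable_diff integrable_const gi pe(1))
  also have "\<dots> = (\<Sum>t=1..T. best_revenue t - (\<integral>\<omega>. gap t \<omega> \<partial>M) + (\<integral>\<omega>. p t \<omega> * \<epsilon> t \<omega> \<partial>M))"
  proof (rule sum.cong[OF refl])
    fix t assume t: "t \<in> {1..T}"
    show "(\<integral>\<omega>. best_revenue t - gap t \<omega> + p t \<omega> * \<epsilon> t \<omega> \<partial>M) = best_revenue t - (\<integral>\<omega>. gap t \<omega> \<partial>M) + (\<integral>\<omega>. p t \<omega> * \<epsilon> t \<omega> \<partial>M)"
      using gi[OF t] pe(1)[OF t] by (simp add: prob_space)
  qed
  also have "\<dots> \<ge> (\<Sum>t=1..T. best_revenue t - (\<integral>\<omega>. gap t \<omega> \<partial>M))"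
    using pe(2) by (intro sum_mono) simp
  finally show ?thesis by (simp add: regret_def sum_subtractf)
qed

lemma regret_bound: "regret M g pmin pmax \<alpha> \<beta> x p \<epsilon> T \<le> ts_bound gmin gmax \<theta>max \<sigma> pmax Dmax ncov T"
proof -
  define K where "K = pmax * gmax * \<gamma> * (\<kappa> + 1/2) + 20 * (pmax * gmax * \<gamma> * (\<kappa> + 5/2))"
  define c where "c = ln ((2 * real ncov + real T) / (2 * real ncov))"
  define L where "L = ln (4 * (real T)\<^sup>2)"
  let ?R = "sqrt (real ncov * real T * c)"
  have T: "6 \<le> real T" using horizon by simp
  have c0: "0 \<le> c" using ncov_pos by (simp add: c_def)
  have nonneg: "0 \<le> pmax * gmax * \<gamma>" using prices gmax_nonneg \<gamma>_pos by simp
  have K: "0 \<le> K" using nonneg \<kappa>_nonneg by (simp add: K_def)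
  have Dp: "0 \<le> Dmax * pmax" using true_revenue_bounds[of 1 pmin] horizon prices by auto
  have "regret M g pmin pmax \<alpha> \<beta> x p \<epsilon> T \<le> (\<Sum>t=1..T. (\<integral>\<omega>. gap t \<omega> \<partial>M))"
    by (rule regret_le_sum_gap)
  also have "\<dots> \<le> (\<Sum>t=1..T. Dmax * pmax * (1 / T + 1 / (real T)\<^sup>2) + K * (\<integral>\<omega>. played_width t \<omega> \<partial>M))"
    unfolding K_def by (intro sum_mono expected_gap_le)
  also have "\<dots> = Dmax * pmax * (1 + 1 / T) + K * (\<Sum>t=1..T. (\<integral>\<omega>. played_width t \<omega> \<partial>M))"
  proof -
    have "real T * (Dmax * pmax * (1 / T + 1 / (real T)\<^sup>2)) = Dmax * pmax * (1 + 1 / T)"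
      using T by (simp add: power2_eq_square field_simps)
    then show ?thesis by (simp add: sum.distrib sum_distrib_left[symmetric])
  qed
  also have "(\<Sum>t=1..T. (\<integral>\<omega>. played_width t \<omega> \<partial>M)) \<le> 2 * ?R"
  proof -
    note pi = played_width_integrable
    have "(\<Sum>t=1..T. (\<integral>\<omega>. played_width t \<omega> \<partial>M)) = (\<integral>\<omega>. (\<Sum>t=1..T. played_width t \<omega>) \<partial>M)"
      by (rule Bochner_Integration.integral_sum[symmetric]) (rule pi)
    also have "\<dots> \<le> (\<integral>\<omega>. 2 * ?R \<partial>M)"
      using sum_played_width_le pi by (intro integral_mono) (auto simp: c_def)
    finally show ?thesis by (simp add: prob_space)
  qed
  finally have le: "regret M g pmin pmax \<alpha> \<beta> x p \<epsilon> T \<le> Dmax * pmax * (1 + 1 / T) + K * (2 * ?R)"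
    using K by (simp add: mult_left_mono)
  have L4: "4 \<le> L" using ln_T by (simp add: L_def)
  have sL: "2 \<le> sqrt L" using L4 by (intro real_le_rsqrt) simp
  \<comment> \<open>\<open>42 * \<kappa> + 101\<close> is twice the sum of
    \<open>\<kappa> + 1/2\<close> and 20 times \<open>\<kappa> + 5/2\<close>. With
    \<open>\<kappa> = 2 * sqrt L\<close> it is \<open>84 * sqrt L + 101\<close>, below 36 * 3.8
    times \<open>sqrt L\<close> because \<open>sqrt L\<close> is at least 2; and 3.8 squared is
    below 15, a lower bound for \<open>2 * exp 1 * pi\<close>.\<close>
  have "K * 2 = pmax * gmax * \<gamma> * (42 * \<kappa> + 101)" by (simp add: K_def algebra_simps)
  also have "\<dots> \<le> pmax * gmax * \<gamma> * (36 * sqrt (2 * exp 1 * pi) * sqrt L)"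
  proof (rule mult_left_mono[OF _ nonneg])
    have "1 + 1 + (1::real)\<^sup>2 / 2 \<le> exp 1" by (rule exp_lower_Taylor_quadratic) simp
    then have e: "5/2 \<le> exp (1::real)" by simp
    have "(38/10)\<^sup>2 \<le> 2 * (5/2) * (3::real)" by (simp add: power2_eq_square)
    also have "\<dots> \<le> 2 * exp 1 * pi" using e pi_gt3 by (intro mult_mono) auto
    finally have "38/10 \<le> sqrt (2 * exp 1 * pi)" by (rule real_le_rsqrt)
    then have "36 * (38/10) * sqrt L \<le> 36 * sqrt (2 * exp 1 * pi) * sqrt L"
      using sL L4 by (intro mult_right_mono mult_left_mono) auto
    moreover have "42 * \<kappa> + 101 \<le> 36 * (38/10) * sqrt L" using sL by (simp add: \<kappa>_def L_def[symmetric])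
    ultimately show "42 * \<kappa> + 101 \<le> 36 * sqrt (2 * exp 1 * pi) * sqrt L" by linarith
  qed
  finally have "K * (2 * ?R) \<le> pmax * gmax * \<gamma> * (36 * sqrt (2 * exp 1 * pi) * sqrt L) * ?R"
    using c0 by (simp only: mult.assoc[symmetric]) (rule mult_right_mono, auto)
  also have "\<dots> = 36 * gmax * pmax * \<gamma> * sqrt (2 * exp 1 * pi * real ncov * real T * c * L)"
    by (simp add: real_sqrt_mult mult_ac)
  finally have main: "K * (2 * ?R) \<le> 36 * gmax * pmax * \<gamma> * sqrt (2 * exp 1 * pi * real ncov * real T * c * L)" .
  \<comment> \<open>Over the whole horizon the exceptional events contribute
    \<open>1 + 1 / T\<close>, at most 2.\<close>
  have "Dmax * pmax * (1 + 1 / T) \<le> Dmax * pmax * 2"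
    using Dp T by (intro mult_left_mono) auto
  then show ?thesis
    using le main by (simp add: ts_bound_def \<gamma>_def c_def L_def)
qed

end

theorem theorem3:
  fixes M :: "'w measure"
    and \<X> :: "(real^'n) set"
    and g :: "real \<Rightarrow> real"
    and \<alpha> \<beta> :: "real^'n"
    and pmin pmax \<theta>max Dmax gmin gmax \<sigma> :: real
    and T :: nat
    and x :: "nat \<Rightarrow> real^'n"
    and p \<epsilon> :: "nat \<Rightarrow> 'w \<Rightarrow> real"
    and \<eta> :: "nat \<Rightarrow> 'w \<Rightarrow> real^2"
  assumes prob: "prob_space M"
    and prices: "0 \<le> pmin" "pmin \<le> pmax"
    and sigma: "0 \<le> \<sigma>"
    and horizon: "6 \<le> T"
    \<comment> \<open>boundedness\<close>
    and \<theta>max: "0 < \<theta>max"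
    and true_param: "stack \<alpha> \<beta> \<in> cball 0 \<theta>max"
    and demand_bounds: "\<And>y q. y \<in> \<X> \<Longrightarrow> q \<in> {pmin..pmax} \<Longrightarrow>
          0 \<le> g (y \<bullet> \<alpha> + (y \<bullet> \<beta>) * q) \<and> g (y \<bullet> \<alpha> + (y \<bullet> \<beta>) * q) \<le> Dmax"
    and covariate_bounds: "\<And>y q. y \<in> \<X> \<Longrightarrow> q \<in> {pmin..pmax} \<Longrightarrow> norm (regressor y q) \<le> 1"
    \<comment> \<open>link function\<close>
    and g_mono: "strict_mono g"
    and g_diff: "\<And>z. g differentiable (at z)"
    and gmin: "0 < gmin"
    and g_deriv: "\<And>y \<theta> q. y \<in> \<X> \<Longrightarrow> \<theta> \<in> enlarged_params gmin \<theta>max \<sigma> T \<Longrightarrow>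
          q \<in> {pmin..pmax} \<Longrightarrow>
          gmin \<le> deriv g (y \<bullet> upper \<theta> + (y \<bullet> lower \<theta>) * q) \<and>
          deriv g (y \<bullet> upper \<theta> + (y \<bullet> lower \<theta>) * q) \<le> gmax"
    \<comment> \<open>covariates, shocks and algorithm\<close>
    and covariates: "\<And>t. t \<in> {1..T} \<Longrightarrow> x t \<in> \<X>"
    and shocks: "shock_assumption M \<sigma> p \<epsilon> T"
    and draws: "randomization M p \<epsilon> \<eta> T"
    and policy: "ts_policy M g gmin \<theta>max \<sigma> pmin pmax 1 T \<alpha> \<beta> x p \<epsilon> \<eta>"
  shows "regret M g pmin pmax \<alpha> \<beta> x p \<epsilon> T \<le> ts_bound gmin gmax \<theta>max \<sigma> pmax Dmax CARD('n) T
    \<and> soft_O (ts_bound gmin gmax \<theta>max \<sigma> pmax Dmax) (\<lambda>d T'. real d * sqrt (real T'))"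
proof -
  interpret thompson_sampling \<X> g \<alpha> \<beta> pmin pmax \<theta>max Dmax gmin gmax \<sigma> T x M p \<epsilon> \<eta>
    by (intro thompson_sampling.intro pricing_model.intro thompson_sampling_axioms.intro) fact+
  have "x 1 \<in> \<X>" using horizon covariates by auto
  then have "0 \<le> Dmax" using demand_bounds[of "x 1" pmin] prices by force
  then show ?thesis
    using regret_bound soft_O_ts_bound[OF gmax_nonneg _ \<theta>max sigma gmin] prices by (auto simp: ncov_def)
qed

end
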